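(* Let $\mathcal{N}_1,\mathcal{N}_2,\mathcal{N}_3$ be the sets of partitions defined in the context, and for $a=1,2,3$ let $$N_a := \sum_{i,j\ge 0}\frac{(-1)^j q^{\binom{i}{2}+2\binom{j}{2}+2ij+A_a(i,j)}}{(q;q)_i\,(q^2;q^2)_j},$$ where $A_1(i,j)=i+j$, $A_2(i,j)=i+3j$ and $A_3(i,j)=2i+3j$. Then (as formal power series in $q$) $$\sum_{\lambda\in\mathcal{N}_1}q^{|\lambda|}=\frac{1}{(q^{2},q^{3},q^{4},q^{10},q^{11},q^{12};q^{14})_\infty}=N_1,$$ $$\sum_{\lambda\in\mathcal{N}_2}q^{|\lambda|}=\frac{1}{(q,q^{4},q^{6},q^{8},q^{10},q^{13};q^{14})_\infty}=N_2,$$ $$\sum_{\lambda\in\mathcal{N}_3}q^{|\lambda|}=\frac{1}{(q^{2},q^{5},q^{6},q^{8},q^{9},q^{12};q^{14})_\infty}=N_3.$$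
   Context: A partition is a finite weakly decreasing sequence $\lambda=(\lambda_1,\dots,\lambda_\ell)$ of positive integers (possibly empty); $\ell(\lambda)=\ell$ is its length, $|\lambda|=\sum_i\lambda_i$, and $m_i(\lambda)=\#\{j\mid\lambda_j=i\}$. For $n\in\mathbb{Z}_{\ge0}\sqcup\{\infty\}$, $(a;q)_n=\prod_{0\le j<n}(1-aq^j)$ and $(a_1,\dots,a_k;q)_n=(a_1;q)_n\cdots(a_k;q)_n$. A finite sequence $(i_1,\dots,i_N)$ matches a nonempty finite sequence $(j_1,\dots,j_n)$ if $(i_{k+1},\dots,i_{k+n})=(j_1,\dots,j_n)$ for some $0\le k\le N-n$. $\mathcal{N}$ is the set of partitions $\lambda$ satisfying all of the following: (N1) for all $1\le i\le\ell(\lambda)-1$, $\lambda_i-\lambda_{i+1}\ne1$; (N2) for all $1\le i\le\ell(\lambda)-2$, $\lambda_i-\lambda_{i+2}\ge3$; (N3) for all $1\le i\le\ell(\lambda)-2$, $\lambda_i-\lambda_{i+2}=3\Rightarrow\lambda_i\ne\lambda_{i+1}$; (N4) for all $1\le i\le\ell(\lambda)-2$, ($\lambda_i-\lambda_{i+2}=3$ and $\lambda_i$ odd) $\Rightarrow\lambda_{i+1}\ne\lambda_{i+2}$; (N5) for all $1\le i\le\ell(\lambda)-2$, ($\lambda_i-\lambda_{i+2}=4$ and $\lambda_i$ odd) $\Rightarrow$ ($\lambda_i\ne\lambda_{i+1}$ and $\lambda_{i+1}\ne\lambda_{i+2}$); (N6) the sequence $(\lambda_1-\lambda_2,\lambda_2-\lambda_3,\dots,\lambda_{\ell(\lambda)-1}-\lambda_{\ell(\lambda)})$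 does not match $(3,2^*,3,0)$, where $2^*$ denotes any number (possibly zero) of repetitions of $2$ (i.e. it matches none of the sequences $(3,2,\dots,2,3,0)$ with $k\ge0$ copies of $2$). Then $\mathcal{N}_1=\{\lambda\in\mathcal{N}\mid m_1(\lambda)=0\}$; $\mathcal{N}_2=\{\lambda\in\mathcal{N}\mid m_i(\lambda)\le1\text{ for }i=1,2,3\}$; $\mathcal{N}_3$ is the set of $\lambda\in\mathcal{N}$ with $m_1(\lambda)=m_3(\lambda)=0$, $m_2(\lambda)\le1$, and such that $\lambda$ does not match $(2k+3,2k,2k-2,\dots,4,2)$ for any $k\ge1$. *)

theory Defs
  imports
    "HOL-Analysis.Analysis"
    "HOL-Computational_Algebra.Formal_Power_Series"
    "HOL-Library.Extended_Nat"
    "HOL-Library.Sublist"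
begin

text \<open>
  Partitions are lists indexed from 0, so the part \<open>\<lambda>\<^sub>i\<close> is \<open>xs ! (i - 1)\<close>, the size of
  \<open>xs\<close> is \<open>sum_list xs\<close>, and \<open>m\<^sub>i\<close> is \<open>count_list xs i\<close>.
\<close>

definition is_partition :: "nat list \<Rightarrow> bool" where
  "is_partition xs \<longleftrightarrow> sorted_wrt (\<ge>) xs \<and> (\<forall>x \<in> set xs. 0 < x)"

abbreviation matches :: "nat list \<Rightarrow> nat list \<Rightarrow> bool" where
  "matches xs ys \<equiv> sublist ys xs"

text \<open>
  All differences below are taken on weakly decreasing lists, so truncated subtraction on
  \<open>nat\<close> never truncates.
\<close>

definition differences :: "nat list \<Rightarrow> nat list" where
  "differences xs = map (\<lambda>i. xs ! i - xs ! (i + 1)) [0..<length xs - 1]"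

definition setN :: "nat list set" where
  "setN = {xs. is_partition xs \<and>
     (\<forall>i. i + 1 < length xs \<longrightarrow> xs ! i - xs ! (i + 1) \<noteq> 1) \<and>
     (\<forall>i. i + 2 < length xs \<longrightarrow> xs ! i - xs ! (i + 2) \<ge> 3) \<and>
     (\<forall>i. i + 2 < length xs \<longrightarrow>
        xs ! i - xs ! (i + 2) = 3 \<longrightarrow> xs ! i \<noteq> xs ! (i + 1)) \<and>
     (\<forall>i. i + 2 < length xs \<longrightarrow>
        xs ! i - xs ! (i + 2) = 3 \<and> odd (xs ! i) \<longrightarrow> xs ! (i + 1) \<noteq> xs ! (i + 2)) \<and>
     (\<forall>i. i + 2 < length xs \<longrightarrow>
        xs ! i - xs ! (i + 2) = 4 \<and> odd (xs ! i) \<longrightarrow>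
          xs ! i \<noteq> xs ! (i + 1) \<and> xs ! (i + 1) \<noteq> xs ! (i + 2)) \<and>
     (\<forall>k. \<not> matches (differences xs) ([3] @ replicate k 2 @ [3, 0]))}"

definition setN1 :: "nat list set" where
  "setN1 = {xs \<in> setN. count_list xs 1 = 0}"

definition setN2 :: "nat list set" where
  "setN2 = {xs \<in> setN. \<forall>i \<in> {1, 2, 3}. count_list xs i \<le> 1}"

text \<open>The list in the last condition is \<open>(2k + 3, 2k, 2k - 2, \<dots>, 4, 2)\<close>.\<close>

definition setN3 :: "nat list set" where
  "setN3 = {xs \<in> setN. count_list xs 1 = 0 \<and> count_list xs 3 = 0 \<and> count_list xs 2 \<le> 1 \<and>
     (\<forall>k \<ge> 1. \<not> matches xs ((2 * k + 3) # map (\<lambda>i. 2 * i) (rev [1..<k + 1])))}"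

text \<open>
  Limits of power series are taken in the \<open>X\<close>-adic topology, the one carried by the type
  \<open>rat fps\<close>; convergence there is coefficientwise stabilisation.
\<close>

definition qpoch :: "rat fps \<Rightarrow> rat fps \<Rightarrow> enat \<Rightarrow> rat fps" where
  "qpoch a q n = (case n of enat m \<Rightarrow> (\<Prod>j<m. 1 - a * q ^ j) | \<infinity> \<Rightarrow> (\<Prod>j. 1 - a * q ^ j))"

definition qpochs :: "rat fps list \<Rightarrow> rat fps \<Rightarrow> enat \<Rightarrow> rat fps" where
  "qpochs as q n = (\<Prod>a\<leftarrow>as. qpoch a q n)"

text \<open>\<open>prodinf\<close> is unspecified for divergent products; here it is the actual limit.\<close>

lemma has_prod_qpoch:
  assumes "fps_nth a 0 = 0" and "fps_nth q 0 = 0"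
  shows "(\<lambda>j. 1 - a * q ^ j) has_prod qpoch a q \<infinity>"
proof -
  define P where "P n = (\<Prod>j<n. 1 - a * q ^ j)" for n
  have high: "fps_nth (f * (a * q ^ n)) k = 0" if "k \<le> n" for f :: "rat fps" and n k
  proof -
    have X_dvd: "fps_X dvd g" if "fps_nth g 0 = 0" for g :: "rat fps"
    proof (cases "g = 0")
      case False
      with that have "subdegree g \<noteq> 0"
        by (simp add: subdegree_eq_0_iff)
      with False show ?thesis
        by (simp add: fps_dvd_iff)
    qed simp
    have "fps_X ^ Suc n dvd f * (a * q ^ n)"
      using X_dvd[OF assms(1)] X_dvd[OF assms(2)]
      unfolding power_Suc by (intro dvd_mult mult_dvd_mono dvd_power_same)
    then obtain c where "f * (a * q ^ n) = fps_X ^ Suc n * c"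
      by (rule dvdE)
    then show ?thesis
      using that by (simp add: fps_X_power_mult_nth del: power_Suc)
  qed
  have step: "fps_nth (P (Suc n)) k = fps_nth (P n) k" if "k \<le> n" for n k
    using high[OF that, of "P n"] by (simp add: P_def right_diff_distrib)
  have stable: "fps_nth (P n) k = fps_nth (P k) k" if "k \<le> n" for n k
    using that by (induction n rule: dec_induct) (auto simp: step)
  define L where "L = Abs_fps (\<lambda>k. fps_nth (P k) k)"
  have "P \<longlonglongrightarrow> L"
    unfolding tendsto_fps_iff L_def fps_nth_Abs_fps eventually_sequentially
    using stable by blast
  then have "(\<lambda>n. P (Suc n)) \<longlonglongrightarrow> L"
    by (rule LIMSEQ_Suc)
  moreover have "fps_nth L 0 = 1"
    by (simp add: L_def P_def)
  then have "L \<noteq> 0"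
    by auto
  ultimately have "(\<lambda>j. 1 - a * q ^ j) has_prod L"
    by (simp add: has_prod_def raw_has_prod_def P_def lessThan_Suc_atMost)
  with has_prod_unique[OF this] show ?thesis
    by (simp add: qpoch_def)
qed

abbreviation q :: "rat fps" where
  "q \<equiv> fps_X"

definition double_sum_term :: "(nat \<Rightarrow> nat \<Rightarrow> nat) \<Rightarrow> nat \<Rightarrow> nat \<Rightarrow> rat fps" where
  "double_sum_term A i j =
     (- 1) ^ j * q ^ ((i choose 2) + 2 * (j choose 2) + 2 * i * j + A i j) /
     (qpoch q q (enat i) * qpoch (q ^ 2) (q ^ 2) (enat j))"

end

theory Submission
  imports Defs "HOL-Computational_Algebra.Formal_Laurent_Series"
begin

text \<open>
  Read in increasing order, the partitions in each of the three classes are the words accepted by a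
  finite automaton, so their generating functions by number of parts (marked by \<open>x\<close>) and size satisfy
  a linear system of functional equations under \<open>x \<mapsto> q\<^sup>2 x\<close>. Multiplying by
  \<open>1 / (x; q\<^sup>2)\<^sub>\<infinity>\<close> turns the system into recurrences for the coefficients of the powers of \<open>x\<close>, which are
  solved by finite convolution sums. Letting \<open>x \<rightarrow> 1\<close> writes each generating function as \<open>(-q; q)\<^sub>\<infinity>\<close>
  times a single sum over \<open>j\<close>. Euler's identity, applied to the sum over \<open>i\<close>, reduces the double sums to
  the same single sums. These are Rogers-Selberg-type sums in the form of Slater: a Bailey pair converts
  each into a combination of two theta series, which the quintuple product identity evaluates as a
  product modulo 14.
\<close>

section \<open>Limits and sums of formal power series\<close>

text \<open>The conditions on neighbouring parts involve only differences and parities, so shifting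
  all parts by 2 preserves them while shifting by 1 does not. This fixes the substitution and the
  base \<open>q^2\<close>. Evaluation at x = 1 is impossible after multiplication by 1/(x; q^2)_inf,
  which has a pole there. Coefficient limits replace it: in G/(x; q^2)_inf the coefficient of x^M
  tends to G(1)/(q^2; q^2)_inf. The solutions of the recurrences are not derived. Their weights are
  the j-summands that the double sums leave behind, and creative telescoping then checks that they
  fit. The Bailey and quintuple identities contain negative powers. They are proved in finite form
  over an arbitrary field and specialised to Laurent series in q; sums whose exponents are all
  nonnegative then return to power series. Two infinite sums, Euler's and \<open>Phi 0\<close>, are
  evaluated by showing that they can be written with an auxiliary parameter on which they do not
  depend, and sending that parameter to infinity.\<close>

lemma X_power_dvd_iff: "fps_X ^ n dvd (f :: rat fps) \<longleftrightarrow> (\<forall>i<n. fps_nth f i = 0)"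
proof
  assume "fps_X ^ n dvd f"
  then obtain c where "f = fps_X ^ n * c" by (rule dvdE)
  then show "\<forall>i<n. fps_nth f i = 0" by (simp add: fps_X_power_mult_nth)
next
  assume *: "\<forall>i<n. fps_nth f i = 0"
  have "f = fps_X ^ n * fps_shift n f"
    using * by (intro fps_ext) (simp add: fps_X_power_mult_nth)
  then show "fps_X ^ n dvd f" by (metis dvd_triv_left)
qed

text \<open>With closeness expressed as divisibility by a power of X, limits of sums, products and
  inverses reduce to arithmetic with ideals.\<close>

lemma fps_tendsto_iff_dvd:
  fixes f :: "'b \<Rightarrow> rat fps"
  shows "(f \<longlongrightarrow> g) F \<longleftrightarrow> (\<forall>n. \<forall>\<^sub>F x in F. fps_X ^ n dvd f x - g)"
proof
  assume "(f \<longlongrightarrow> g) F"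
  then have *: "\<forall>\<^sub>F x in F. fps_nth (f x) i = fps_nth g i" for i
    by (simp add: tendsto_fps_iff)
  show "\<forall>n. \<forall>\<^sub>F x in F. fps_X ^ n dvd f x - g"
  proof
    fix n :: nat
    have "\<forall>\<^sub>F x in F. \<forall>i\<in>{..<n}. fps_nth (f x) i = fps_nth g i"
      using * by (intro eventually_ball_finite) auto
    then show "\<forall>\<^sub>F x in F. fps_X ^ n dvd f x - g"
      by eventually_elim (simp add: X_power_dvd_iff)
  qed
next
  assume *: "\<forall>n. \<forall>\<^sub>F x in F. fps_X ^ n dvd f x - g"
  show "(f \<longlongrightarrow> g) F"
    unfolding tendsto_fps_iff
  proof
    fix n
    from *[rule_format, of "Suc n"] show "\<forall>\<^sub>F x in F. fps_nth (f x) n = fps_nth g n"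
      by eventually_elim (auto simp: X_power_dvd_iff simp del: power_Suc)
  qed
qed

lemma fps_tendsto_add:
  fixes f g :: "'b \<Rightarrow> rat fps"
  assumes "(f \<longlongrightarrow> a) F" "(g \<longlongrightarrow> b) F"
  shows "((\<lambda>x. f x + g x) \<longlongrightarrow> a + b) F"
  using assms unfolding fps_tendsto_iff_dvd
proof safe
  fix n
  assume "\<forall>n. \<forall>\<^sub>F x in F. fps_X ^ n dvd f x - a" "\<forall>n. \<forall>\<^sub>F x in F. fps_X ^ n dvd g x - b"
  then have "\<forall>\<^sub>F x in F. fps_X ^ n dvd f x - a" "\<forall>\<^sub>F x in F. fps_X ^ n dvd g x - b" by auto
  then show "\<forall>\<^sub>F x in F. fps_X ^ n dvd f x + g x - (a + b)"
  proof eventually_elim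
    case (elim x)
    have "f x + g x - (a + b) = (f x - a) + (g x - b)" by simp
    with elim show ?case by (metis dvd_add)
  qed
qed

lemma fps_tendsto_mult:
  fixes f g :: "'b \<Rightarrow> rat fps"
  assumes "(f \<longlongrightarrow> a) F" "(g \<longlongrightarrow> b) F"
  shows "((\<lambda>x. f x * g x) \<longlongrightarrow> a * b) F"
  using assms unfolding fps_tendsto_iff_dvd
proof safe
  fix n
  assume "\<forall>n. \<forall>\<^sub>F x in F. fps_X ^ n dvd f x - a" "\<forall>n. \<forall>\<^sub>F x in F. fps_X ^ n dvd g x - b"
  then have "\<forall>\<^sub>F x in F. fps_X ^ n dvd f x - a" "\<forall>\<^sub>F x in F. fps_X ^ n dvd g x - b" by auto
  then show "\<forall>\<^sub>F x in F. fps_X ^ n dvd f x * g x - a * b"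
  proof eventually_elim
    case (elim x)
    have "f x * g x - a * b = (f x - a) * g x + a * (g x - b)" by (simp add: algebra_simps)
    with elim show ?case by (metis dvd_add dvd_mult dvd_mult2)
  qed
qed

lemma fps_tendsto_cmult:
  fixes g :: "'b \<Rightarrow> rat fps"
  assumes "(g \<longlongrightarrow> b) F"
  shows "((\<lambda>x. a * g x) \<longlongrightarrow> a * b) F"
  by (rule fps_tendsto_mult[OF tendsto_const assms])

lemma fps_tendsto_diff:
  fixes f g :: "'b \<Rightarrow> rat fps"
  assumes "(f \<longlongrightarrow> a) F" "(g \<longlongrightarrow> b) F"
  shows "((\<lambda>x. f x - g x) \<longlongrightarrow> a - b) F"
  using fps_tendsto_add[OF assms(1) fps_tendsto_cmult[OF assms(2), of "-1"]] by simp

lemma fps_tendsto_nth_eq: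
  fixes f :: "nat \<Rightarrow> rat fps"
  assumes "f \<longlonglongrightarrow> a" "\<And>n. fps_nth (f n) i = c"
  shows "fps_nth a i = c"
proof -
  have "\<forall>\<^sub>F n in sequentially. fps_nth (f n) i = fps_nth a i"
    using assms(1) by (simp add: tendsto_fps_iff)
  then obtain n where "fps_nth (f n) i = fps_nth a i"
    using eventually_happens trivial_limit_sequentially by blast
  then show ?thesis using assms(2) by simp
qed

lemma fps_tendsto_inverse:
  fixes f :: "nat \<Rightarrow> rat fps"
  assumes "f \<longlonglongrightarrow> a" "\<And>n. fps_nth (f n) 0 = 1"
  shows "(\<lambda>n. inverse (f n)) \<longlonglongrightarrow> inverse a"
  unfolding fps_tendsto_iff_dvd
proof
  fix n
  have a0: "fps_nth a 0 = 1" using fps_tendsto_nth_eq[OF assms] .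
  from assms(1) have "\<forall>\<^sub>F x in sequentially. fps_X ^ n dvd f x - a"
    by (simp add: fps_tendsto_iff_dvd)
  then show "\<forall>\<^sub>F x in sequentially. fps_X ^ n dvd inverse (f x) - inverse a"
  proof eventually_elim
    case (elim x)
    have 1: "inverse (f x) * f x = 1" "inverse a * a = 1"
      using assms(2)[of x] a0 by (simp_all add: inverse_mult_eq_1)
    have "inverse (f x) - inverse a = inverse (f x) * (inverse a * a) - inverse a * (inverse (f x) * f x)"
      by (simp only: 1) simp
    also have "\<dots> = - (inverse (f x) * inverse a) * (f x - a)"
      by (simp add: algebra_simps)
    finally show ?case using elim by (metis dvd_mult)
  qed
qed

lemma fps_dvd_limit:
  fixes f :: "nat \<Rightarrow> rat fps"
  assumes "f \<longlonglongrightarrow> a" "\<And>n. fps_X ^ w dvd f n"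
  shows "fps_X ^ w dvd a"
proof -
  from assms(1) have "\<forall>\<^sub>F x in sequentially. fps_X ^ w dvd f x - a"
    by (simp add: fps_tendsto_iff_dvd)
  then obtain n where "fps_X ^ w dvd f n - a"
    using eventually_happens trivial_limit_sequentially by blast
  then have "fps_X ^ w dvd f n - (f n - a)" using assms(2) by (metis dvd_diff)
  then show ?thesis by simp
qed

text \<open>Only finitely many terms reach a given coefficient, so finite partial sums are
  eventually constant there. The weight \<open>w\<close> bounds the order of vanishing from
  below.\<close>

lemma fps_has_sum_infsum:
  fixes g :: "'i \<Rightarrow> rat fps"
  assumes fin: "\<And>n. finite {i\<in>A. w i < n}"
    and dvd: "\<And>i. i \<in> A \<Longrightarrow> fps_X ^ w i dvd g i"
  shows "(g has_sum infsum g A) A"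
proof -
  define S where "S = Abs_fps (\<lambda>n. fps_nth (sum g {i\<in>A. w i < Suc n}) n)"
  have "(sum g \<longlongrightarrow> S) (finite_subsets_at_top A)"
    unfolding tendsto_fps_iff
  proof
    fix n
    let ?D = "{i\<in>A. w i < Suc n}"
    have "\<forall>\<^sub>F F in finite_subsets_at_top A. finite F \<and> ?D \<subseteq> F \<and> F \<subseteq> A"
      using fin[of "Suc n"] unfolding eventually_finite_subsets_at_top by (intro exI[of _ ?D]) auto
    then show "\<forall>\<^sub>F F in finite_subsets_at_top A. fps_nth (sum g F) n = fps_nth S n"
    proof eventually_elim
      case (elim F)
      have "fps_nth (sum g F) n = (\<Sum>i\<in>F. fps_nth (g i) n)" by (simp add: fps_sum_nth)
      also have "\<dots> = (\<Sum>i\<in>?D. fps_nth (g i) n)"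
      proof (rule sum.mono_neutral_right)
        show "\<forall>i\<in>F - ?D. fps_nth (g i) n = 0"
        proof
          fix i assume "i \<in> F - ?D"
          then have "i \<in> A" "n < w i" using elim by auto
          then show "fps_nth (g i) n = 0" using dvd[of i] by (simp add: X_power_dvd_iff)
        qed
      qed (use elim in auto)
      finally show ?case by (simp add: S_def fps_sum_nth)
    qed
  qed
  then have "(g has_sum S) A" by (simp add: has_sum_def)
  with infsumI[OF this] show ?thesis by simp
qed

text \<open>Dominated convergence; the dominating bound is a lower bound on the order of vanishing.\<close>

lemma fps_tannery:
  fixes f :: "nat \<Rightarrow> 'i \<Rightarrow> rat fps"
  assumes fin: "\<And>n. finite {i\<in>A. w i < n}"
    and dvd: "\<And>L i. i \<in> A \<Longrightarrow> fps_X ^ w i dvd f L i"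
    and lim: "\<And>i. i \<in> A \<Longrightarrow> (\<lambda>L. f L i) \<longlonglongrightarrow> g i"
    and B: "\<And>L. finite (B L)" "\<And>L. B L \<subseteq> A" "\<And>L i. i \<in> A - B L \<Longrightarrow> f L i = 0"
  shows "(\<lambda>L. \<Sum>i\<in>B L. f L i) \<longlonglongrightarrow> infsum g A"
proof -
  have dvdg: "fps_X ^ w i dvd g i" if "i \<in> A" for i
    using fps_dvd_limit[OF lim[OF that] dvd[OF that]] .
  have hs: "(sum g \<longlongrightarrow> infsum g A) (finite_subsets_at_top A)"
    using fps_has_sum_infsum[OF fin dvdg] by (simp add: has_sum_def)
  show ?thesis unfolding fps_tendsto_iff_dvd
  proof
    fix n
    let ?D = "{i\<in>A. w i < n}"
    have "\<forall>\<^sub>F F in finite_subsets_at_top A. fps_X ^ n dvd sum g F - infsum g A"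
      using hs by (simp add: fps_tendsto_iff_dvd)
    then have "\<exists>F. finite F \<and> F \<subseteq> A \<and>
        (\<forall>G. finite G \<and> F \<subseteq> G \<and> G \<subseteq> A \<longrightarrow> fps_X ^ n dvd sum g G - infsum g A)"
      by (simp only: eventually_finite_subsets_at_top)
    then obtain F where F: "finite F" "F \<subseteq> A"
      and F': "\<And>G. finite G \<Longrightarrow> F \<subseteq> G \<Longrightarrow> G \<subseteq> A \<Longrightarrow> fps_X ^ n dvd sum g G - infsum g A"
      by (elim exE conjE) (metis (no_types, lifting))
    \<comment> \<open>\<open>F\<close> makes the partial sum of the limits close to the infinite
      sum; \<open>?D\<close> collects the indices whose terms may be nonzero below order n. Outside
      \<open>G\<close> every term is divisible by \<open>X^n\<close>, uniformly in L.\<close>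
    define G where "G = F \<union> ?D"
    have G: "finite G" "F \<subseteq> G" "G \<subseteq> A" "?D \<subseteq> G" using F fin[of n] by (auto simp: G_def)
    have g: "fps_X ^ n dvd sum g G - infsum g A" using F' G by blast
    have "\<forall>\<^sub>F L in sequentially. \<forall>i\<in>G. fps_X ^ n dvd f L i - g i"
      using G lim by (intro eventually_ball_finite) (auto simp: fps_tendsto_iff_dvd)
    then show "\<forall>\<^sub>F L in sequentially. fps_X ^ n dvd (\<Sum>i\<in>B L. f L i) - infsum g A"
    proof eventually_elim
      case (elim L)
      have "(\<Sum>i\<in>B L. f L i) = (\<Sum>i\<in>B L \<union> G. f L i)"
        using B G by (intro sum.mono_neutral_left) auto
      also have "\<dots> = (\<Sum>i\<in>G. f L i) + (\<Sum>i\<in>B L - G. f L i)"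
        using B G by (subst sum.union_disjoint[symmetric]) (auto intro!: sum.cong)
      finally have eq: "(\<Sum>i\<in>B L. f L i) - infsum g A =
          (\<Sum>i\<in>G. f L i - g i) + (\<Sum>i\<in>B L - G. f L i) + (sum g G - infsum g A)"
        by (simp add: sum_subtractf)
      have 1: "fps_X ^ n dvd (\<Sum>i\<in>G. f L i - g i)" using elim by (intro dvd_sum) auto
      have 2: "fps_X ^ n dvd (\<Sum>i\<in>B L - G. f L i)"
      proof (intro dvd_sum)
        fix i assume i: "i \<in> B L - G"
        then have "i \<in> A" using B(2) by blast
        moreover from this i G(4) have "n \<le> w i" by (metis (mono_tags, lifting) DiffD2 linorder_not_less mem_Collect_eq subsetD)
        ultimately have "i \<in> A" "n \<le> w i" by auto
        then show "fps_X ^ n dvd f L i" using dvd[of i L] power_le_dvd by blast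
      qed
      show ?case unfolding eq using 1 2 g by (intro dvd_add)
    qed
  qed
qed

lemma fps_sum_tendsto_infsum:
  fixes g :: "'i \<Rightarrow> rat fps"
  assumes fin: "\<And>n. finite {i\<in>A. w i < n}"
    and dvd: "\<And>i. i \<in> A \<Longrightarrow> fps_X ^ w i dvd g i"
    and B: "\<And>L. finite (B L)" "\<And>L. B L \<subseteq> A" "\<And>i. i \<in> A \<Longrightarrow> \<forall>\<^sub>F L in sequentially. i \<in> B L"
  shows "(\<lambda>L. \<Sum>i\<in>B L. g i) \<longlonglongrightarrow> infsum g A"
proof -
  have "(\<lambda>L. \<Sum>i\<in>B L. if i \<in> B L then g i else 0) \<longlonglongrightarrow> infsum g A"
  proof (rule fps_tannery[where w = w])
    fix i assume "i \<in> A"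
    from B(3)[OF this] show "(\<lambda>L. if i \<in> B L then g i else 0) \<longlonglongrightarrow> g i"
      by (intro tendsto_eventually) (erule eventually_mono, simp)
  qed (use fin dvd B in auto)
  then show ?thesis by simp
qed

lemma fps_tannery_nat:
  fixes f :: "nat \<Rightarrow> nat \<Rightarrow> rat fps"
  assumes "\<And>L i. fps_X ^ i dvd f L i" "\<And>i. (\<lambda>L. f L i) \<longlonglongrightarrow> g i"
    and "\<And>L i. L < i \<Longrightarrow> f L i = 0"
  shows "(\<lambda>L. \<Sum>i\<le>L. f L i) \<longlonglongrightarrow> infsum g UNIV"
  by (rule fps_tannery[where w = "\<lambda>i. i"]) (use assms in auto)

lemma fps_sum_tendsto_nat:
  fixes g :: "nat \<Rightarrow> rat fps"
  assumes "\<And>i. fps_X ^ i dvd g i"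
  shows "(\<lambda>L. \<Sum>i\<le>L. g i) \<longlonglongrightarrow> infsum g UNIV"
  by (rule fps_sum_tendsto_infsum[where w = "\<lambda>i. i"])
     (use assms in \<open>auto simp: eventually_sequentially\<close>)

lemma finite_int_abs_less: "finite {i::int. nat \<bar>i\<bar> < n}"
  by (rule finite_subset[of _ "{- int n..int n}"]) auto

lemma fps_tannery_int:
  fixes f :: "nat \<Rightarrow> int \<Rightarrow> rat fps"
  assumes "\<And>L i. fps_X ^ nat \<bar>i\<bar> dvd f L i" "\<And>i. (\<lambda>L. f L i) \<longlonglongrightarrow> g i"
    and "\<And>L i. int L < \<bar>i\<bar> \<Longrightarrow> f L i = 0"
  shows "(\<lambda>L. \<Sum>i\<in>{- int L..int L}. f L i) \<longlonglongrightarrow> infsum g UNIV"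
  by (rule fps_tannery[where w = "\<lambda>i. nat \<bar>i\<bar>"]) (use assms in \<open>auto simp: finite_int_abs_less\<close>)

text \<open>The index shift needed when the term at 0 vanishes and the remaining terms reproduce
  another series up to a factor.\<close>

lemma infsum_fps_shift_zero:
  fixes g :: "nat \<Rightarrow> rat fps"
  assumes "\<And>i. fps_X ^ i dvd g i" "\<And>i. fps_X ^ i dvd g' i" "g' 0 = 0" "\<And>i. g' (Suc i) = c * g i"
  shows "infsum g' UNIV = c * infsum g UNIV"
proof (rule LIMSEQ_unique)
  show "(\<lambda>L. \<Sum>i\<le>Suc L. g' i) \<longlonglongrightarrow> infsum g' UNIV"
    by (rule LIMSEQ_Suc[OF fps_sum_tendsto_nat[OF assms(2)]])
  have "(\<Sum>i\<le>Suc L. g' i) = c * (\<Sum>i\<le>L. g i)" for L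
    by (simp add: sum.atMost_Suc_shift assms sum_distrib_left del: sum.atMost_Suc)
  then show "(\<lambda>L. \<Sum>i\<le>Suc L. g' i) \<longlonglongrightarrow> c * infsum g UNIV"
    using fps_tendsto_cmult[OF fps_sum_tendsto_nat[OF assms(1)]] by simp
qed

section \<open>The automaton\<close>

text \<open>
  The automaton reads the parts in increasing order; its bound \<open>r\<close> is measured from the last part \<open>p\<close>.
  In state \<open>Free\<close> the next part is any \<open>a \<ge> r\<close>. In states \<open>Doublable\<close> and \<open>Single\<close>, where
  \<open>r = p + 1\<close>, the next part is either at least \<open>p + 2\<close> or, for \<open>Doublable\<close> only, a second \<open>p\<close>.
  State \<open>Armed\<close> is entered after a repeated odd part: as long as the parts climb in steps of
  2 after the initial step 3, another step of 3 would complete the pattern forbidden by (N6). Starting in state \<open>Armed\<close> rules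
  out the additional pattern in the third class.
\<close>

datatype state = Free | Single | Doublable | Armed

fun accepts :: "state \<Rightarrow> nat \<Rightarrow> nat list \<Rightarrow> bool" where
  "accepts s r [] = True"
| "accepts Free r (a # as) = (r \<le> a \<and> accepts Doublable (a + 1) as)"
| "accepts Single r (a # as) =
     (r < a \<and> accepts (if r + 4 \<le> a \<or> even a \<and> r + 3 \<le> a then Doublable else Single) (a + 1) as)"
| "accepts Doublable r (a # as) =
     (if a + 1 = r then (if even a then accepts Free (a + 4) as else accepts Armed (a + 2) as)
      else r < a \<and> accepts (if r + 4 \<le> a \<or> even a \<and> r + 3 \<le> a then Doublable else Single) (a + 1) as)"
| "accepts Armed r (a # as) =
     (a = r + 1 \<and> accepts Armed (a + 1) as \<or> r + 3 \<le> a \<and> accepts Doublable (a + 1) as)"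

definition triple :: "nat \<Rightarrow> nat \<Rightarrow> nat \<Rightarrow> bool" where
  "triple c b a \<longleftrightarrow> a - c \<ge> 3 \<and> (a - c = 3 \<longrightarrow> a \<noteq> b) \<and> (a - c = 3 \<and> odd a \<longrightarrow> b \<noteq> c) \<and>
     (a - c = 4 \<and> odd a \<longrightarrow> a \<noteq> b \<and> b \<noteq> c)"

text \<open>Conditions (N1)--(N5) and (N6), for the reversed list of parts.\<close>

fun admissible :: "nat list \<Rightarrow> bool" where
  "admissible (c # b # a # as) = (c \<le> b \<and> b \<noteq> c + 1 \<and> triple c b a \<and> admissible (b # a # as))"
| "admissible [c, b] = (c \<le> b \<and> b \<noteq> c + 1)"
| "admissible _ = True"

fun climb :: "nat \<Rightarrow> nat list \<Rightarrow> bool" where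
  "climb p [] = False"
| "climb p (a # as) = (a = p + 3 \<or> a = p + 2 \<and> climb a as)"

fun nomatch :: "nat list \<Rightarrow> bool" where
  "nomatch (c # b # a # as) = (\<not> (b = c \<and> a = b + 3 \<and> climb a as) \<and> nomatch (b # a # as))"
| "nomatch _ = True"

text \<open>One simultaneous induction, because reading a part leads from each situation to the
  others: (1) p was just repeated, (2) p follows b at distance at least 2, (3) p lies on an armed
  climb, (4) p has no predecessor. In (3) the pending obligation is
  \<open>\<not> climb p as\<close>. Only even p occur there: (N4) excludes a step of 3 after a
  repeated even part, so climbs start at an odd part plus 3 and continue in steps of 2.\<close>

lemma accepts_iff:
  shows "admissible (p # p # as) \<and> nomatch (p # p # as) \<longleftrightarrow>
          (if even p then accepts Free (p + 4) as else accepts Armed (p + 2) as)"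
    and "b + 2 \<le> p \<Longrightarrow> admissible (b # p # as) \<and> nomatch (b # p # as) \<longleftrightarrow>
          accepts (if b + 5 \<le> p \<or> even p \<and> b + 4 \<le> p then Doublable else Single) (p + 1) as"
    and "even p \<Longrightarrow> p = b + 2 \<or> p = b + 3 \<Longrightarrow>
          admissible (b # p # as) \<and> nomatch (b # p # as) \<and> \<not> climb p as \<longleftrightarrow> accepts Armed (p + 1) as"
    and "admissible (p # as) \<and> nomatch (p # as) \<longleftrightarrow> accepts Doublable (p + 1) as"
proof (induction as arbitrary: b p)
  case Nil
  { case 1 then show ?case by simp }
  { case 2 then show ?case by simp }
  { case 3 then show ?case by auto }
  { case 4 then show ?case by simp }
next
  case (Cons a as)
  note D = Cons.IH(1) and S = Cons.IH(2) and A = Cons.IH(3)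
  have admissible_le: "p \<le> a \<and> a \<noteq> p + 1" if "admissible (p # a # as)" for p using that by (cases as) auto
  { case (1 p)
    have "admissible (p # p # a # as) \<and> nomatch (p # p # a # as) \<longleftrightarrow>
      triple p p a \<and> \<not> (a = p + 3 \<and> climb a as) \<and> admissible (p # a # as) \<and> nomatch (p # a # as)" by auto
    also have "\<dots> \<longleftrightarrow> (if even p then accepts Free (p + 4) (a # as) else accepts Armed (p + 2) (a # as))"
    \<comment> \<open>After a repeated p the critical distances are 3 and 4. For odd p the parity
      conditions allow 3 and forbid 4; for even p they forbid 3 and allow 4.\<close>
    proof (cases "a < p + 3")
      case True
      then show ?thesis by (auto simp: triple_def)
    next
      case False
      then have le: "p + 2 \<le> a" by simp
      show ?thesis
      proof (cases "a = p + 3")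
        case True
        then show ?thesis using S[of p a] A[of a p] by (auto simp: triple_def)
      next
        case False
        then have a: "p + 4 \<le> a" using \<open>\<not> a < p + 3\<close> by simp
        show ?thesis
        proof (cases "a = p + 4")
          case True
          then show ?thesis using S[of p a] by (auto simp: triple_def)
        next
          case False
          then have "p + 5 \<le> a" using a by simp
          then show ?thesis using S[of p a] by (auto simp: triple_def)
        qed
      qed
    qed
    finally show ?case . }
  { case (2 b p)
    have "admissible (b # p # a # as) \<and> nomatch (b # p # a # as) \<longleftrightarrow>
      triple b p a \<and> admissible (p # a # as) \<and> nomatch (p # a # as)" using 2 by auto
    also have "\<dots> \<longleftrightarrow> accepts (if b + 5 \<le> p \<or> even p \<and> b + 4 \<le> p then Doublable else Single) (p + 1) (a # as)"
    proof (cases "a = p")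
      case True
      have "triple b p p \<longleftrightarrow> b + 5 \<le> p \<or> even p \<and> b + 4 \<le> p" using 2 by (auto simp: triple_def)
      then show ?thesis using True D[of p] by auto
    next
      case False
      show ?thesis
      proof (cases "p + 2 \<le> a")
        case True
        then have "triple b p a" using 2 by (auto simp: triple_def)
        then show ?thesis using True S[of p a] by (auto simp: add.commute add.left_commute)
      next
        case F: False
        then have "\<not> admissible (p # a # as)" using admissible_le[of p] False by auto
        then show ?thesis using F False by auto
      qed
    qed
    finally show ?case . }
  { case (3 b p)
    then have "even p" by simp
    have "admissible (b # p # a # as) \<and> nomatch (b # p # a # as) \<and> \<not> climb p (a # as) \<longleftrightarrow>
      triple b p a \<and> admissible (p # a # as) \<and> nomatch (p # a # as) \<and> \<not> climb p (a # as)" using 3 by auto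
    also have "\<dots> \<longleftrightarrow> accepts Armed (p + 1) (a # as)"
    proof (cases "p + 2 \<le> a")
      case True
      then have t: "triple b p a" using 3 by (auto simp: triple_def)
      consider "a = p + 2" | "a = p + 3" | "p + 4 \<le> a" using True by linarith
      then show ?thesis
      proof cases
        case 1
        then show ?thesis using t A[of a p] 3 by auto
      next
        case 2
        then show ?thesis by auto
      next
        \<comment> \<open>A step of at least 4 ends the climb. Since p is even, distance exactly 4
          gives an even part, so the new part may be repeated.\<close>
        case ge: 3
        have "p + 5 \<le> a \<or> even a \<and> p + 4 \<le> a" using ge \<open>even p\<close> by (cases "a = p + 4") auto
        then show ?thesis using ge t S[of p a] by (auto simp: add.commute add.left_commute)
      qed
    next
      case F: False
      show ?thesis
      proof (cases "a = p")
        case True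
        then show ?thesis using 3 by (auto simp: triple_def)
      next
        case False
        then have "\<not> admissible (p # a # as)" using admissible_le[of p] F by auto
        then show ?thesis using F False by auto
      qed
    qed
    finally show ?case . }
  { case (4 p)
    show ?case
    proof (cases "a = p")
      case True
      then show ?thesis using D[of p] by auto
    next
      case False
      show ?thesis
      proof (cases "p + 2 \<le> a")
        case True
        then show ?thesis using S[of p a] by (auto simp: add.commute add.left_commute)
      next
        case F: False
        then have "\<not> admissible (p # a # as)" using admissible_le[of p] False by auto
        then show ?thesis using F False by auto
      qed
    qed }
qed

section \<open>From indexed conditions to the recursive predicates on the reversed list\<close>

lemma all_nat_split: "(\<forall>i::nat. P i) \<longleftrightarrow> P 0 \<and> (\<forall>i. P (Suc i))"
  by (metis nat.exhaust)

lemma ex_nat_split: "(\<exists>i::nat. P i) \<longleftrightarrow> P 0 \<or> (\<exists>i. P (Suc i))"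
  by (metis nat.exhaust)

lemma admissible_iff:
  "admissible ys \<longleftrightarrow> sorted ys \<and> (\<forall>i. i + 1 < length ys \<longrightarrow> ys ! (i + 1) \<noteq> ys ! i + 1) \<and>
     (\<forall>i. i + 2 < length ys \<longrightarrow> triple (ys ! i) (ys ! (i + 1)) (ys ! (i + 2)))"
proof (induction ys rule: admissible.induct)
  case (1 c b a as)
  let ?P = "\<lambda>i. i + 1 < length (c # b # a # as) \<longrightarrow> (c # b # a # as) ! (i + 1) \<noteq> (c # b # a # as) ! i + 1"
  let ?Q = "\<lambda>i. i + 2 < length (c # b # a # as) \<longrightarrow>
     triple ((c # b # a # as) ! i) ((c # b # a # as) ! (i + 1)) ((c # b # a # as) ! (i + 2))"
  have P: "(\<forall>i. ?P i) \<longleftrightarrow> b \<noteq> c + 1 \<and>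
      (\<forall>i. i + 1 < length (b # a # as) \<longrightarrow> (b # a # as) ! (i + 1) \<noteq> (b # a # as) ! i + 1)"
    by (subst all_nat_split) simp
  have Q: "(\<forall>i. ?Q i) \<longleftrightarrow> triple c b a \<and> (\<forall>i. i + 2 < length (b # a # as) \<longrightarrow>
      triple ((b # a # as) ! i) ((b # a # as) ! (i + 1)) ((b # a # as) ! (i + 2)))"
    by (subst all_nat_split) simp
  have "sorted (c # b # a # as) \<longleftrightarrow> c \<le> b \<and> sorted (b # a # as)" by auto
  then show ?case unfolding P Q using 1 by (simp only: admissible.simps) blast
qed (auto simp: less_Suc_eq)

fun increments :: "nat list \<Rightarrow> nat list" where
  "increments (b # a # as) = (a - b) # increments (a # as)"
| "increments _ = []"

lemma length_increments: "length (increments ys) = length ys - 1"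
  by (induction ys rule: increments.induct) auto

lemma nth_increments: "i + 1 < length ys \<Longrightarrow> increments ys ! i = ys ! (i + 1) - ys ! i"
proof (induction ys arbitrary: i rule: increments.induct)
  case (1 b a as)
  then show ?case by (cases i) auto
qed auto

lemma differences_rev: "differences xs = rev (increments (rev xs))"
proof (rule nth_equalityI)
  show "length (differences xs) = length (rev (increments (rev xs)))"
    by (simp add: differences_def length_increments)
  fix i assume "i < length (differences xs)"
  then have i: "i + 1 < length xs" by (simp add: differences_def)
  then have "rev (increments (rev xs)) ! i = increments (rev xs) ! (length xs - 2 - i)"
    by (subst rev_nth) (simp_all add: length_increments numeral_2_eq_2)
  also have "\<dots> = rev xs ! (length xs - 2 - i + 1) - rev xs ! (length xs - 2 - i)"
    using i by (subst nth_increments) auto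
  also have "rev xs ! (length xs - 2 - i + 1) = xs ! i"
    using i by (subst rev_nth) (auto intro!: arg_cong[of _ _ "(!) xs"])
  also have "rev xs ! (length xs - 2 - i) = xs ! (i + 1)"
    using i by (subst rev_nth) (auto intro!: arg_cong[of _ _ "(!) xs"])
  finally have "rev (increments (rev xs)) ! i = xs ! i - xs ! (i + 1)" .
  moreover have "differences xs ! i = xs ! i - xs ! (i + 1)"
    using i unfolding differences_def by (subst nth_map) auto
  ultimately show "differences xs ! i = rev (increments (rev xs)) ! i" by simp
qed

lemma climb_iff_increments:
  "sorted (p # as) \<Longrightarrow> (\<exists>k. prefix (replicate k 2 @ [3]) (increments (p # as))) \<longleftrightarrow> climb p as"
proof (induction as arbitrary: p)
  case (Cons a as)
  have "(\<exists>k. prefix (replicate k 2 @ [3]) (increments (p # a # as))) \<longleftrightarrow>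
      prefix [3] (increments (p # a # as)) \<or> (\<exists>k. prefix (2 # replicate k 2 @ [3]) (increments (p # a # as)))"
    by (subst ex_nat_split) simp
  also have "\<dots> \<longleftrightarrow> a - p = 3 \<or> a - p = 2 \<and> (\<exists>k. prefix (replicate k 2 @ [3]) (increments (a # as)))"
    by auto
  also have "\<dots> \<longleftrightarrow> climb p (a # as)" using Cons by auto
  finally show ?case .
qed auto

text \<open>Reversal turns the pattern (3, 2, ..., 2, 3, 0) into (0, 3, 2, ..., 2, 3): a match
  starts at a repeated part, continues with a step of 3, and the rest is what \<open>climb\<close>
  reads.\<close>

lemma nomatch_iff_increments:
  "sorted ys \<Longrightarrow> (\<exists>k. sublist ([0, 3] @ replicate k 2 @ [3]) (increments ys)) \<longleftrightarrow> \<not> nomatch ys"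
proof (induction ys rule: nomatch.induct)
  case (1 c b a as)
  have "(\<exists>k. sublist ([0, 3] @ replicate k 2 @ [3]) (increments (c # b # a # as))) \<longleftrightarrow>
     (\<exists>k. prefix ([0, 3] @ replicate k 2 @ [3]) (increments (c # b # a # as))) \<or>
     (\<exists>k. sublist ([0, 3] @ replicate k 2 @ [3]) (increments (b # a # as)))"
    by (simp add: sublist_Cons_right ex_disj_distrib)
  also have "(\<exists>k. prefix ([0, 3] @ replicate k 2 @ [3]) (increments (c # b # a # as))) \<longleftrightarrow>
     b - c = 0 \<and> a - b = 3 \<and> (\<exists>k. prefix (replicate k 2 @ [3]) (increments (a # as)))"
    by auto
  also have "(\<exists>k. prefix (replicate k 2 @ [3]) (increments (a # as))) \<longleftrightarrow> climb a as"
    using 1 by (intro climb_iff_increments) auto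
  finally have *: "(\<exists>k. sublist ([0, 3] @ replicate k 2 @ [3]) (increments (c # b # a # as))) \<longleftrightarrow>
      b - c = 0 \<and> a - b = 3 \<and> climb a as \<or>
      (\<exists>k. sublist ([0, 3] @ replicate k 2 @ [3]) (increments (b # a # as)))" .
  have "(\<exists>k. sublist ([0, 3] @ replicate k 2 @ [3]) (increments (b # a # as))) \<longleftrightarrow> \<not> nomatch (b # a # as)"
    using 1 by (intro "1.IH") auto
  moreover have "b - c = 0 \<and> a - b = 3 \<and> climb a as \<longleftrightarrow> b = c \<and> a = b + 3 \<and> climb a as" using 1 by auto
  ultimately show ?case unfolding * nomatch.simps by blast
qed (auto simp: sublist_Cons_right)

lemma all_less_rev:
  assumes "\<And>i. i + k < n \<Longrightarrow> Q (n - Suc k - i) \<longleftrightarrow> R i"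
  shows "(\<forall>i. i + k < n \<longrightarrow> Q i) \<longleftrightarrow> (\<forall>i :: nat. i + k < n \<longrightarrow> R i)"
proof (intro iffI allI impI)
  fix i assume "\<forall>i. i + k < n \<longrightarrow> Q i" "i + k < n"
  then show "R i" using assms[of i] by simp
next
  fix i assume *: "\<forall>i. i + k < n \<longrightarrow> R i" "i + k < n"
  then have "n - Suc k - (n - Suc k - i) = i" "n - Suc k - i + k < n" by auto
  then show "Q i" using assms[of "n - Suc k - i"] * by simp
qed

lemma all_triples_rev:
  "(\<forall>i. i + 2 < length xs \<longrightarrow> Q (xs ! i) (xs ! (i + 1)) (xs ! (i + 2))) \<longleftrightarrow>
   (\<forall>i. i + 2 < length xs \<longrightarrow> Q (rev xs ! (i + 2)) (rev xs ! (i + 1)) (rev xs ! i))"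
proof (rule all_less_rev)
  fix i assume "i + 2 < length xs"
  then have "rev xs ! (i + 2) = xs ! (length xs - Suc 2 - i)" "rev xs ! (i + 1) = xs ! (length xs - Suc 2 - i + 1)"
    "rev xs ! i = xs ! (length xs - Suc 2 - i + 2)"
    by (auto simp: rev_nth intro!: arg_cong[of _ _ "(!) xs"])
  then show "Q (xs ! (length xs - Suc 2 - i)) (xs ! (length xs - Suc 2 - i + 1)) (xs ! (length xs - Suc 2 - i + 2)) \<longleftrightarrow>
    Q (rev xs ! (i + 2)) (rev xs ! (i + 1)) (rev xs ! i)" by (simp only:)
qed

lemma all_pairs_rev:
  "(\<forall>i. i + 1 < length xs \<longrightarrow> Q (xs ! i) (xs ! (i + 1))) \<longleftrightarrow>
   (\<forall>i. i + 1 < length xs \<longrightarrow> Q (rev xs ! (i + 1)) (rev xs ! i))"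
proof (rule all_less_rev)
  fix i assume "i + 1 < length xs"
  then have "rev xs ! (i + 1) = xs ! (length xs - Suc 1 - i)" "rev xs ! i = xs ! (length xs - Suc 1 - i + 1)"
    by (auto simp: rev_nth intro!: arg_cong[of _ _ "(!) xs"])
  then show "Q (xs ! (length xs - Suc 1 - i)) (xs ! (length xs - Suc 1 - i + 1)) \<longleftrightarrow>
    Q (rev xs ! (i + 1)) (rev xs ! i)" by (simp only:)
qed

lemma setN_iff: "xs \<in> setN \<longleftrightarrow> admissible (rev xs) \<and> nomatch (rev xs) \<and> 0 \<notin> set xs"
proof -
  define ys where "ys = rev xs"
  have T: "((\<forall>i. i + 2 < length xs \<longrightarrow> xs ! i - xs ! (i + 2) \<ge> 3) \<and>
     (\<forall>i. i + 2 < length xs \<longrightarrow>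
        xs ! i - xs ! (i + 2) = 3 \<longrightarrow> xs ! i \<noteq> xs ! (i + 1)) \<and>
     (\<forall>i. i + 2 < length xs \<longrightarrow>
        xs ! i - xs ! (i + 2) = 3 \<and> odd (xs ! i) \<longrightarrow> xs ! (i + 1) \<noteq> xs ! (i + 2)) \<and>
     (\<forall>i. i + 2 < length xs \<longrightarrow>
        xs ! i - xs ! (i + 2) = 4 \<and> odd (xs ! i) \<longrightarrow>
          xs ! i \<noteq> xs ! (i + 1) \<and> xs ! (i + 1) \<noteq> xs ! (i + 2)) \<and> R) \<longleftrightarrow>
     (\<forall>i. i + 2 < length xs \<longrightarrow> triple (xs ! (i + 2)) (xs ! (i + 1)) (xs ! i)) \<and> R" for R
    unfolding triple_def by blast
  have s: "sorted_wrt (\<ge>) xs \<longleftrightarrow> sorted ys" by (simp add: ys_def sorted_wrt_rev)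
  have P: "(\<forall>i. i + 1 < length xs \<longrightarrow> xs ! i - xs ! (i + 1) \<noteq> 1) \<longleftrightarrow>
    (\<forall>i. i + 1 < length ys \<longrightarrow> ys ! (i + 1) \<noteq> ys ! i + 1)"
  proof -
    have *: "a - b \<noteq> 1 \<longleftrightarrow> a \<noteq> b + 1" for a b :: nat by arith
    show ?thesis
      using all_pairs_rev[of xs "\<lambda>a b. a \<noteq> b + 1"] unfolding ys_def length_rev * .
  qed
  have N: "sorted ys \<Longrightarrow> (\<forall>k. \<not> matches (differences xs) ([3] @ replicate k 2 @ [3, 0])) \<longleftrightarrow> nomatch ys"
    using nomatch_iff_increments[of ys] by (simp add: differences_rev ys_def sublist_rev_right) blast
  have 0: "(\<forall>x\<in>set xs. 0 < x) \<longleftrightarrow> 0 \<notin> set xs" by (metis gr0I less_irrefl)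
  have Q: "(\<forall>i. i + 2 < length xs \<longrightarrow> triple (xs ! (i + 2)) (xs ! (i + 1)) (xs ! i)) \<longleftrightarrow>
    (\<forall>i. i + 2 < length ys \<longrightarrow> triple (ys ! i) (ys ! (i + 1)) (ys ! (i + 2)))"
    using all_triples_rev[of xs "\<lambda>a b c. triple c b a"] unfolding ys_def length_rev .
  have "xs \<in> setN \<longleftrightarrow> (sorted ys \<and> 0 \<notin> set xs) \<and>
    (\<forall>i. i + 1 < length ys \<longrightarrow> ys ! (i + 1) \<noteq> ys ! i + 1) \<and>
    (\<forall>i. i + 2 < length ys \<longrightarrow> triple (ys ! i) (ys ! (i + 1)) (ys ! (i + 2))) \<and>
    (\<forall>k. \<not> matches (differences xs) ([3] @ replicate k 2 @ [3, 0]))"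
    unfolding setN_def is_partition_def mem_Collect_eq T P s Q 0 ..
  also have "\<dots> \<longleftrightarrow> admissible ys \<and> nomatch ys \<and> 0 \<notin> set xs"
  proof (cases "sorted ys")
    case True
    show ?thesis unfolding admissible_iff N[OF True] by blast
  next
    case False
    then show ?thesis unfolding admissible_iff by blast
  qed
  finally show ?thesis unfolding ys_def .
qed

section \<open>The three classes as languages of the automaton\<close>

lemma admissible_Cons_le: "admissible (a # as) \<Longrightarrow> x \<in> set as \<Longrightarrow> a \<le> x"
  by (simp add: admissible_iff)

lemma admissible_Cons_Cons_le: "admissible (a # b # as) \<Longrightarrow> x \<in> set as \<Longrightarrow> a + 3 \<le> x"
proof (cases as)
  case (Cons c cs)
  assume "admissible (a # b # as)" "x \<in> set as"
  moreover from this Cons have "admissible (c # cs)" by (cases cs) auto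
  ultimately show ?thesis using Cons admissible_Cons_le[of c cs x] by (auto simp: triple_def)
qed simp

lemma setN1_iff: "xs \<in> setN1 \<longleftrightarrow> accepts Free 2 (rev xs)"
proof (cases "rev xs")
  case Nil
  then show ?thesis by (simp add: setN1_def setN_iff)
next
  case (Cons a as)
  have set: "set xs = set (a # as)" by (metis Cons set_rev)
  have "xs \<in> setN1 \<longleftrightarrow> admissible (a # as) \<and> nomatch (a # as) \<and> 0 \<notin> set (a # as) \<and> 1 \<notin> set (a # as)"
    unfolding setN1_def mem_Collect_eq setN_iff Cons set count_list_0_iff by blast
  also have "\<dots> \<longleftrightarrow> admissible (a # as) \<and> nomatch (a # as) \<and> 2 \<le> a"
    using admissible_Cons_le[of a as 0] admissible_Cons_le[of a as 1] by auto
  finally show ?thesis using accepts_iff(4)[of a as] unfolding Cons by auto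
qed

text \<open>The start state \<open>Single\<close> with bound 0 behaves as if a part -1 had been
  read. A first part may then be repeated exactly when it is at least 4, which is the bound on the
  multiplicities of 1, 2 and 3.\<close>

lemma setN2_iff: "xs \<in> setN2 \<longleftrightarrow> accepts Single 0 (rev xs)"
proof (cases "rev xs")
  case Nil
  then show ?thesis by (simp add: setN2_def setN_iff)
next
  case (Cons a as)
  have set: "set xs = set (a # as)" by (metis Cons set_rev)
  have cnt: "count_list xs i = count_list (a # as) i" for i by (metis Cons count_list_rev)
  have "xs \<in> setN2 \<longleftrightarrow> admissible (a # as) \<and> nomatch (a # as) \<and> 0 \<notin> set (a # as) \<and>
      (\<forall>i\<in>{1, 2, 3}. count_list (a # as) i \<le> 1)"
    unfolding setN2_def mem_Collect_eq setN_iff Cons set cnt by blast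
  also have "\<dots> \<longleftrightarrow> 0 < a \<and> admissible (a # as) \<and> nomatch (a # as) \<and> (a < 4 \<and> as \<noteq> [] \<longrightarrow> hd as \<noteq> a)"
  proof (cases "admissible (a # as) \<and> 0 < a")
    case admissible: True
    have 0: "0 \<notin> set (a # as)" using admissible admissible_Cons_le[of a as 0] by auto
    have "(\<forall>i\<in>{1, 2, 3}. count_list (a # as) i \<le> 1) \<longleftrightarrow> (a < 4 \<and> as \<noteq> [] \<longrightarrow> hd as \<noteq> a)"
    proof (cases "a < 4")
      case False
      have "count_list as i = 0" if "i < 4" for i
        using admissible_Cons_le[of a as i] admissible that False by (auto simp: count_list_0_iff)
      then show ?thesis using False by auto
    next
      case a: True
      show ?thesis
      proof (cases as)
        case (Cons b bs)
        have "count_list bs i = 0" if "i < 4" for i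
          using admissible_Cons_Cons_le[of a b bs i] admissible that Cons by (auto simp: count_list_0_iff)
        then show ?thesis using a admissible Cons by auto
      qed auto
    qed
    with admissible 0 show ?thesis by blast
  qed auto
  also have "\<dots> \<longleftrightarrow> accepts Single 0 (a # as)"
  proof (cases "a < 4")
    case True
    have "accepts Single (a + 1) as \<longleftrightarrow> accepts Doublable (a + 1) as \<and> (as \<noteq> [] \<longrightarrow> hd as \<noteq> a)"
      by (cases as) auto
    moreover have "\<not> (even a \<and> 3 \<le> a)" using True by presburger
    ultimately show ?thesis using accepts_iff(4)[of a as] True by auto
  next
    case False
    then show ?thesis using accepts_iff(4)[of a as] by auto
  qed
  finally show ?thesis unfolding Cons .
qed

lemma climb_iff_prefix:
  "(\<exists>k. prefix (map (\<lambda>i. p + 2 * i) [1..<k + 1] @ [p + 2 * k + 3]) as) \<longleftrightarrow> climb p as"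
proof (induction as arbitrary: p)
  case (Cons a as)
  have *: "map (\<lambda>i. p + 2 * i) [1..<Suc k + 1] = (p + 2) # map (\<lambda>i. (p + 2) + 2 * i) [1..<k + 1]" for k
  proof -
    have "[1..<Suc k + 1] = 1 # map Suc [1..<k + 1]"
      by (simp add: upt_conv_Cons map_Suc_upt del: upt_Suc)
    then show ?thesis by simp
  qed
  have "(\<exists>k. prefix (map (\<lambda>i. p + 2 * i) [1..<k + 1] @ [p + 2 * k + 3]) (a # as)) \<longleftrightarrow>
    a = p + 3 \<or> (\<exists>k. prefix (map (\<lambda>i. p + 2 * i) [1..<Suc k + 1] @ [p + 2 * Suc k + 3]) (a # as))"
    by (subst ex_nat_split) auto
  also have "(\<exists>k. prefix (map (\<lambda>i. p + 2 * i) [1..<Suc k + 1] @ [p + 2 * Suc k + 3]) (a # as)) \<longleftrightarrow>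
    a = p + 2 \<and> (\<exists>k. prefix (map (\<lambda>i. (p + 2) + 2 * i) [1..<k + 1] @ [(p + 2) + 2 * k + 3]) as)"
    unfolding * by (auto simp: algebra_simps)
  finally show ?case unfolding Cons.IH by auto
qed simp

text \<open>The reversed pattern begins with 2. As 2 is absent from the tail, the pattern can match
  only at the head.\<close>

lemma sublist_two_climb:
  assumes "2 \<notin> set as"
  shows "(\<exists>k\<ge>1. sublist (map (\<lambda>i. 2 * i) [1..<k + 1] @ [2 * k + 3]) (a # as)) \<longleftrightarrow> a = 2 \<and> climb 2 as"
proof -
  have *: "map (\<lambda>i. 2 * i) [1..<Suc k + 1] @ [2 * Suc k + 3] =
    2 # map (\<lambda>i. 2 + 2 * i) [1..<k + 1] @ [2 + 2 * k + 3]" for k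
  proof -
    have "[1..<Suc k + 1] = 1 # map Suc [1..<k + 1]"
      by (simp add: upt_conv_Cons map_Suc_upt del: upt_Suc)
    then show ?thesis by simp
  qed
  have "(\<exists>k\<ge>1. sublist (map (\<lambda>i. 2 * i) [1..<k + 1] @ [2 * k + 3]) (a # as)) \<longleftrightarrow>
    (\<exists>k. sublist (map (\<lambda>i. 2 * i) [1..<Suc k + 1] @ [2 * Suc k + 3]) (a # as))"
    by (subst ex_nat_split) simp
  also have "\<dots> \<longleftrightarrow> (\<exists>k. a = 2 \<and> prefix (map (\<lambda>i. 2 + 2 * i) [1..<k + 1] @ [2 + 2 * k + 3]) as)"
  proof -
    have "\<not> sublist (2 # ys) as" for ys using assms set_mono_sublist[of "2 # ys" as] by auto
    then show ?thesis unfolding * sublist_Cons_right by auto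
  qed
  also have "\<dots> \<longleftrightarrow> a = 2 \<and> climb 2 as" using climb_iff_prefix[of 2 as] by blast
  finally show ?thesis .
qed

text \<open>The start state behaves as if an even part 0 had been read on an armed climb. The steps
  1 and 3 from 0 are excluded, which removes the parts 1 and 3; a part 2 stays armed, hence is not
  repeated and may not be followed by a completed climb.\<close>

lemma setN3_iff: "xs \<in> setN3 \<longleftrightarrow> accepts Armed 1 (rev xs)"
proof (cases "rev xs")
  case Nil
  then show ?thesis by (simp add: setN3_def setN_iff)
next
  case (Cons a as)
  have set: "set xs = set (a # as)" by (metis Cons set_rev)
  have cnt: "count_list xs i = count_list (a # as) i" for i by (metis Cons count_list_rev)
  have m: "matches xs ((2 * k + 3) # map (\<lambda>i. 2 * i) (rev [1..<k + 1])) \<longleftrightarrow>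
    sublist (map (\<lambda>i. 2 * i) [1..<k + 1] @ [2 * k + 3]) (a # as)" for k
  proof -
    have "matches xs ((2 * k + 3) # map (\<lambda>i. 2 * i) (rev [1..<k + 1])) \<longleftrightarrow>
      sublist (rev ((2 * k + 3) # map (\<lambda>i. 2 * i) (rev [1..<k + 1]))) (rev xs)"
      by (simp only: sublist_rev)
    then show ?thesis unfolding Cons by (simp add: rev_map)
  qed
  have "xs \<in> setN3 \<longleftrightarrow> admissible (a # as) \<and> nomatch (a # as) \<and> 0 \<notin> set (a # as) \<and> 1 \<notin> set (a # as) \<and>
      3 \<notin> set (a # as) \<and> count_list (a # as) 2 \<le> 1 \<and>
      \<not> (\<exists>k\<ge>1. sublist (map (\<lambda>i. 2 * i) [1..<k + 1] @ [2 * k + 3]) (a # as))"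
    unfolding setN3_def mem_Collect_eq m setN_iff Cons cnt set count_list_0_iff by blast
  also have "\<dots> \<longleftrightarrow> accepts Armed 1 (a # as)"
  proof (cases "admissible (a # as)")
    case admissible: True
    consider "a < 2 \<or> a = 3" | "a = 2" | "4 \<le> a" by linarith
    then show ?thesis
    proof cases
      case 1
      then have "a = 0 \<or> a = 1 \<or> a = 3" by auto
      then show ?thesis by auto
    next
      case 2
      show ?thesis
      proof (cases "2 \<in> set as")
        case True
        then have "count_list as 2 \<noteq> 0" by (simp add: count_list_0_iff)
        moreover obtain b bs where "as = b # bs" using True by (cases as) auto
        moreover from this have "b = 2"
          using admissible 2 True admissible_Cons_Cons_le[of a b bs 2] by auto
        ultimately show ?thesis using 2 by auto
      next
        case False
        have 1: "x \<noteq> 0 \<and> x \<noteq> 1 \<and> x \<noteq> 3" if x: "x \<in> set as" for x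
        proof -
          obtain b bs where as: "as = b # bs" using x by (cases as) auto
          have "b \<noteq> 3" "2 \<le> b" using admissible 2 as admissible_Cons_le[of a as b] by (cases bs; auto)+
          then have "4 \<le> b" using False as by (cases "b = 2") auto
          then show ?thesis using admissible_Cons_Cons_le[of a b bs x] x as admissible 2 by auto
        qed
        \<comment> \<open>Prepending the virtual part 0 costs nothing, so the armed case of
          \<open>accepts_iff\<close> applies with b = 0 and p = 2.\<close>
        have 3: "admissible (0 # 2 # as) \<and> nomatch (0 # 2 # as) \<longleftrightarrow> admissible (2 # as) \<and> nomatch (2 # as)"
        proof (cases as)
          case (Cons b bs)
          have "b \<noteq> 3" "2 \<le> b" "b \<noteq> 2" using admissible 2 Cons False admissible_Cons_le[of a as b] by (cases bs; auto)+
          then have "triple 0 2 b" by (auto simp: triple_def)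
          then show ?thesis using Cons by auto
        qed auto
        have "0 \<notin> set as" "1 \<notin> set as" "3 \<notin> set as" "count_list as 2 = 0"
          using 1 False by (auto simp: count_list_0_iff)
        then show ?thesis
          using sublist_two_climb[OF False, of a] accepts_iff(3)[of 2 0 as] 3
          by (auto simp: 2)
      qed
    next
      case 3
      have 4: "\<forall>x\<in>set as. 4 \<le> x" using admissible_Cons_le[OF admissible] 3 by force
      then have "2 \<notin> set as" "0 \<notin> set as" "1 \<notin> set as" "3 \<notin> set as" by auto
      moreover from this have "count_list as 2 = 0" by (simp add: count_list_0_iff)
      ultimately show ?thesis
        using sublist_two_climb[of as a] accepts_iff(4)[of a as] 3 by auto
    qed
  next
    case False
    have "\<not> accepts Armed 1 (a # as)"
    proof
      assume "accepts Armed 1 (a # as)"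
      then have "a = 1 + 1 \<and> accepts Armed (a + 1) as \<or> accepts Doublable (a + 1) as"
        unfolding accepts.simps by blast
      then have "a = 2 \<and> accepts Armed (2 + 1) as \<or> accepts Doublable (a + 1) as"
        by (metis one_add_one)
      then show False
      proof
        assume *: "a = 2 \<and> accepts Armed (2 + 1) as"
        then have "admissible (0 # 2 # as)" using accepts_iff(3)[of 2 0 as] by (metis add_0 even_numeral)
        then have "admissible (2 # as)" by (cases as) auto
        with * False show False by simp
      next
        assume "accepts Doublable (a + 1) as"
        with False accepts_iff(4)[of a as] show False by simp
      qed
    qed
    with False show ?thesis by simp
  qed
  finally show ?thesis unfolding Cons .
qed

section \<open>Functional equations\<close>

text \<open>The outer variable marks the number of parts, and \<open>eta\<close> below is the substitution \<open>x \<mapsto> q\<^sup>2 x\<close>.\<close>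

definition gf :: "nat list set \<Rightarrow> rat fps fps" where
  "gf S = Abs_fps (\<lambda>M. Abs_fps (\<lambda>n. of_nat (card {ys \<in> S. length ys = M \<and> sum_list ys = n})))"

lemma finite_lists_length_sum: "finite {ys \<in> S. length ys = M \<and> sum_list ys = (n :: nat)}"
  by (rule finite_subset[OF _ finite_lists_length_eq[of "{..n}" M]]) (auto intro: member_le_sum_list)

lemma gf_nth: "fps_nth (fps_nth (gf S) M) n = of_nat (card {ys \<in> S. length ys = M \<and> sum_list ys = n})"
  by (simp add: gf_def)

lemma gf_Un:
  assumes "S \<inter> T = {}"
  shows "gf (S \<union> T) = gf S + gf T"
proof (intro fps_ext)
  fix M n
  let ?A = "\<lambda>S :: nat list set. {ys \<in> S. length ys = M \<and> sum_list ys = n}"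
  have "?A (S \<union> T) = ?A S \<union> ?A T" by auto
  moreover have "card (?A S \<union> ?A T) = card (?A S) + card (?A T)"
    using assms by (intro card_Un_disjoint finite_lists_length_sum) auto
  ultimately show "fps_nth (fps_nth (gf (S \<union> T)) M) n = fps_nth (fps_nth (gf S + gf T) M) n"
    by (simp add: gf_nth)
qed

lemma gf_Cons: "gf ((#) a ` S) = fps_const (q ^ a) * fps_X * gf S"
proof (intro fps_ext)
  fix M n
  show "fps_nth (fps_nth (gf ((#) a ` S)) M) n = fps_nth (fps_nth (fps_const (q ^ a) * fps_X * gf S) M) n"
  proof (cases M)
    case 0
    then have "{ys \<in> (#) a ` S. length ys = M \<and> sum_list ys = n} = {}" by auto
    then show ?thesis using 0 by (simp add: gf_nth mult.assoc)
  next
    case (Suc m)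
    show ?thesis
    proof (cases "a \<le> n")
      case True
      have "{ys \<in> (#) a ` S. length ys = M \<and> sum_list ys = n} =
        (#) a ` {ys \<in> S. length ys = m \<and> sum_list ys = n - a}" using Suc True by auto
      then show ?thesis using Suc True
        by (simp add: gf_nth mult.assoc card_image fps_X_power_mult_nth)
    next
      case False
      then have "{ys \<in> (#) a ` S. length ys = M \<and> sum_list ys = n} = {}" by auto
      then show ?thesis using Suc False
        by (simp only: gf_nth card.empty) (simp add: mult.assoc fps_X_power_mult_nth)
    qed
  qed
qed

section \<open>Shifting all parts by 2\<close>

definition eta :: "rat fps fps \<Rightarrow> rat fps fps" where
  "eta f = Abs_fps (\<lambda>M. q ^ (2 * M) * fps_nth f M)"

lemma eta_nth: "fps_nth (eta f) M = q ^ (2 * M) * fps_nth f M"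
  by (simp add: eta_def)

lemma eta_add: "eta (f + g) = eta f + eta g"
  by (intro fps_ext) (simp add: eta_nth algebra_simps)

lemma eta_diff: "eta (f - g) = eta f - eta g"
  by (intro fps_ext) (simp add: eta_nth algebra_simps)

lemma eta_mult: "eta (f * g) = eta f * eta g"
proof (rule fps_ext)
  fix M
  have "q ^ (2 * i) * fps_nth f i * (q ^ (2 * (M - i)) * fps_nth g (M - i)) =
    q ^ (2 * M) * (fps_nth f i * fps_nth g (M - i))" if "i \<in> {0..M}" for i
  proof -
    have "q ^ (2 * i) * q ^ (2 * (M - i)) = q ^ (2 * M)"
      using that by (simp flip: power_add)
    then show ?thesis by (metis (no_types, lifting) mult.assoc mult.left_commute)
  qed
  then have "(\<Sum>i=0..M. q ^ (2 * i) * fps_nth f i * (q ^ (2 * (M - i)) * fps_nth g (M - i))) =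
    q ^ (2 * M) * (\<Sum>i=0..M. fps_nth f i * fps_nth g (M - i))"
    unfolding sum_distrib_left by (rule sum.cong[OF refl])
  then show "fps_nth (eta (f * g)) M = fps_nth (eta f * eta g) M"
    by (simp only: eta_nth fps_mult_nth)
qed

lemma eta_const: "eta (fps_const c) = fps_const c"
  by (intro fps_ext) (simp add: eta_nth)

lemma eta_X: "eta fps_X = fps_const (q ^ 2) * fps_X"
  by (intro fps_ext) (simp add: eta_nth fps_X_def)

lemma gf_map_add2: "gf (map ((+) 2) ` S) = eta (gf S)"
proof (intro fps_ext)
  fix M n
  have s: "sum_list (map ((+) 2) ys) = 2 * length ys + sum_list ys" for ys :: "nat list"
    by (induction ys) auto
  have inj: "inj_on (map ((+) (2::nat))) A" for A by (simp add: inj_on_def)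
  show "fps_nth (fps_nth (gf (map ((+) 2) ` S)) M) n = fps_nth (fps_nth (eta (gf S)) M) n"
  proof (cases "2 * M \<le> n")
    case True
    have "{ys \<in> map ((+) 2) ` S. length ys = M \<and> sum_list ys = n} =
        map ((+) 2) ` {ys \<in> S. length ys = M \<and> sum_list ys = n - 2 * M}" using True by (auto simp: s)
    then show ?thesis using True by (simp add: gf_nth eta_nth card_image[OF inj] fps_X_power_mult_nth)
  next
    case False
    then have "{ys \<in> map ((+) 2) ` S. length ys = M \<and> sum_list ys = n} = {}" by (auto simp: s)
    then show ?thesis using False
      by (simp only: gf_nth card.empty) (simp add: eta_nth fps_X_power_mult_nth)
  qed
qed

definition lang :: "state \<Rightarrow> nat \<Rightarrow> nat list set" where
  "lang s r = {ys. accepts s r ys}"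

text \<open>The automaton compares parts only with the bound and tests only their parity, and 2 is
  the least positive shift that keeps parities.\<close>

lemma accepts_shift: "accepts s (r + 2) (map ((+) 2) as) = accepts s r as"
proof (induction as arbitrary: s r)
  case (Cons a as)
  have eqs: "2 + a + 1 = (a + 1) + 2" "2 + a + 2 = (a + 2) + 2" "2 + a + 4 = (a + 4) + 2" by simp_all
  have IH: "accepts s (2 + a + 1) (map ((+) 2) as) = accepts s (a + 1) as"
     "accepts s (2 + a + 2) (map ((+) 2) as) = accepts s (a + 2) as"
     "accepts s (2 + a + 4) (map ((+) 2) as) = accepts s (a + 4) as" for s
    unfolding eqs by (rule Cons.IH)+
  have conds: "(r + 2 \<le> 2 + a) = (r \<le> a)" "(r + 2 < 2 + a) = (r < a)"
    "(r + 2 + 4 \<le> 2 + a) = (r + 4 \<le> a)" "even (2 + a) = even a"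
    "(r + 2 + 3 \<le> 2 + a) = (r + 3 \<le> a)" "(2 + a + 1 = r + 2) = (a + 1 = r)"
    "(2 + a = r + 2 + 1) = (a = r + 1)" by auto
  show ?case by (cases s) (simp_all only: accepts.simps list.map IH conds)
qed simp

lemma accepts_ge: "accepts s r as \<Longrightarrow> x \<in> set as \<Longrightarrow> r \<le> x + 1 \<and> (s \<noteq> Doublable \<longrightarrow> r \<le> x)"
proof (induction as arbitrary: s r)
  case (Cons a as)
  show ?case
  proof (cases "x = a")
    case True
    then show ?thesis using Cons.prems by (cases s) (auto split: if_splits)
  next
    case False
    then have x: "x \<in> set as" using Cons.prems by auto
    obtain s' r' where "accepts s' r' as" "a + 1 \<le> r'" "r' = a + 1 \<longrightarrow> s' \<noteq> Doublable \<or> a + 1 \<noteq> r"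
      using Cons.prems(1)
      by (cases s) (auto split: if_splits)
    then have "a \<le> x" using Cons.IH[of s' r'] x by auto
    moreover have "r \<le> a + 1 \<and> (s \<noteq> Doublable \<longrightarrow> r \<le> a)"
      using Cons.prems by (cases s) (auto split: if_splits)
    ultimately show ?thesis by auto
  qed
qed simp

text \<open>In the other states all parts of an accepted word are at least r + 2, so 2 can be
  subtracted. A word of \<open>Doublable\<close> may contain r + 1, which for r = 0 is too
  small.\<close>

lemma lang_shift:
  assumes "s \<noteq> Doublable"
  shows "lang s (r + 2) = map ((+) 2) ` lang s r"
proof (intro equalityI subsetI)
  fix ys assume "ys \<in> lang s (r + 2)"
  then have accepts: "accepts s (r + 2) ys" by (simp add: lang_def)
  have "2 \<le> x" if "x \<in> set ys" for x using accepts_ge[OF accepts that] assms by simp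
  then have "map ((+) 2) (map (\<lambda>x. x - 2) ys) = map id ys"
    unfolding map_map by (intro map_cong) (auto simp del: add_2_eq_Suc)
  then have "ys = map ((+) 2) (map (\<lambda>x. x - 2) ys)" by simp
  moreover from this accepts have "map (\<lambda>x. x - 2) ys \<in> lang s r"
    unfolding lang_def by (metis mem_Collect_eq accepts_shift)
  ultimately show "ys \<in> map ((+) 2) ` lang s r" by blast
qed (auto simp: lang_def accepts_shift simp del: add_2_eq_Suc')

lemma gf_lang_shift: "s \<noteq> Doublable \<Longrightarrow> r' = r + 2 \<Longrightarrow> gf (lang s r') = eta (gf (lang s r))"
  by (simp only: lang_shift gf_map_add2 not_False_eq_True)

lemma set_eq_by_Cons:
  assumes "[] \<in> S \<longleftrightarrow> [] \<in> T"
    and "\<And>a as. a = 0 \<or> a = 1 \<or> a = 2 \<or> a = 3 \<or> a = 4 \<or> 5 \<le> a \<Longrightarrow> a # as \<in> S \<longleftrightarrow> a # as \<in> T"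
  shows "S = (T :: nat list set)"
proof (rule set_eqI)
  fix x
  have "a = 0 \<or> a = 1 \<or> a = 2 \<or> a = 3 \<or> a = 4 \<or> 5 \<le> a" for a :: nat by arith
  then show "x \<in> S \<longleftrightarrow> x \<in> T" using assms by (cases x) auto
qed

lemma Cons_in_image_Cons: "a # as \<in> (#) b ` S \<longleftrightarrow> a = b \<and> as \<in> S" "[] \<notin> (#) b ` S"
  by auto

text \<open>Once the few smallest first parts are split off, the remaining words form the language
  of another start, because the states agree on large parts. Every language on the right is then a
  shift of one of four basic ones, or of type \<open>Doublable\<close>, which is expanded in
  turn.\<close>

lemma
  shows lang_Armed: "lang Armed 1 = (#) 2 ` lang Armed 3 \<union> lang Free 4"
    and lang_Single_0: "lang Single 0 = (#) 1 ` lang Single 2 \<union> lang Single 1"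
    and lang_Single_1: "lang Single 1 = (#) 2 ` lang Single 3 \<union> (#) 3 ` lang Single 4 \<union> lang Free 4"
    and lang_Free: "lang Free 2 = (#) 2 ` lang Doublable 3 \<union> (#) 3 ` lang Doublable 4 \<union> lang Free 4"
    and lang_Doublable_3: "lang Doublable 3 = (#) 2 ` lang Free 6 \<union> lang Single 3"
    and lang_Doublable_4: "lang Doublable 4 = (#) 3 ` lang Armed 5 \<union> lang Single 4"
  by (rule set_eq_by_Cons; unfold lang_def Un_iff Cons_in_image_Cons mem_Collect_eq accepts.simps;
      ((elim disjE)?; simp del: One_nat_def))+

text \<open>Opaque names, so that algebraic reasoning treats the constants \<open>q^k\<close> and
  the outer variable as atoms.\<close>

definition "qc k = fps_const (q ^ k)"
definition "xvar = (fps_X :: rat fps fps)"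

lemma eta_xvar: "eta xvar = qc 2 * xvar" and eta_qc: "eta (qc k) = qc k" and qc_mult: "qc k * qc l = qc (k + l)"
  by (simp_all add: qc_def xvar_def eta_X eta_const fps_const_mult power_add)

context
  fixes V O1 S A :: "rat fps fps"
  assumes V: "V = gf (lang Free 2)" and O1: "O1 = gf (lang Single 0)" and S: "S = gf (lang Single 1)"
    and A: "A = gf (lang Armed 1)"
begin

lemma Armed_eq: "A = qc 2 * xvar * eta A + eta V"
proof -
  have r: "gf (lang Armed 3) = eta (gf (lang Armed 1))" "gf (lang Free 4) = eta (gf (lang Free 2))"
    by (rule gf_lang_shift; simp)+
  have "gf (lang Armed 1) = gf ((#) 2 ` lang Armed 3) + gf (lang Free 4)"
    unfolding lang_Armed by (intro gf_Un) (auto simp: lang_def)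
  then show ?thesis
    unfolding A V gf_Cons qc_def xvar_def r .
qed

lemma Single_0_eq: "O1 = qc 1 * xvar * eta O1 + S"
proof -
  have r: "gf (lang Single 2) = eta (gf (lang Single 0))"
    by (rule gf_lang_shift; simp)
  have "gf (lang Single 0) = gf ((#) 1 ` lang Single 2) + gf (lang Single 1)"
    unfolding lang_Single_0 by (intro gf_Un) (auto simp: lang_def)
  then show ?thesis
    unfolding O1 S gf_Cons qc_def xvar_def r .
qed

lemma Single_1_eq: "S = qc 2 * xvar * eta S + qc 3 * xvar * eta (eta O1) + eta V"
proof -
  have r: "gf (lang Single 4) = eta (gf (lang Single 2))" "gf (lang Single 2) = eta (gf (lang Single 0))"
    "gf (lang Single 3) = eta (gf (lang Single 1))" "gf (lang Free 4) = eta (gf (lang Free 2))"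
    by (rule gf_lang_shift; simp)+
  have "gf (lang Single 1) = gf ((#) 2 ` lang Single 3) + gf ((#) 3 ` lang Single 4) + gf (lang Free 4)"
    unfolding lang_Single_1 by (subst gf_Un, (auto simp: lang_def)[1], subst gf_Un) (auto simp: lang_def)
  then show ?thesis
    unfolding O1 S V gf_Cons qc_def xvar_def r .
qed

text \<open>The two \<open>Doublable\<close> languages are not covered by the shift lemma and are
  eliminated by reading one more part. This closes the system in the four unknowns V, O1, S and
  A.\<close>

lemma Free_eq: "V = qc 2 * xvar * (qc 2 * xvar * eta (eta V) + eta S) +
    qc 3 * xvar * (qc 3 * xvar * eta (eta A) + eta (eta O1)) + eta V"
proof -
  have r: "gf (lang Single 4) = eta (gf (lang Single 2))" "gf (lang Single 2) = eta (gf (lang Single 0))"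
    "gf (lang Single 3) = eta (gf (lang Single 1))" "gf (lang Free 4) = eta (gf (lang Free 2))"
    "gf (lang Free 6) = eta (gf (lang Free 4))"
    "gf (lang Armed 5) = eta (gf (lang Armed 3))" "gf (lang Armed 3) = eta (gf (lang Armed 1))"
    by (rule gf_lang_shift; simp)+
  have 1: "gf (lang Doublable 3) = gf ((#) 2 ` lang Free 6) + gf (lang Single 3)"
    unfolding lang_Doublable_3 by (intro gf_Un) (auto simp: lang_def)
  have 2: "gf (lang Doublable 4) = gf ((#) 3 ` lang Armed 5) + gf (lang Single 4)"
    unfolding lang_Doublable_4 by (intro gf_Un) (auto simp: lang_def)
  have "gf (lang Free 2) = gf ((#) 2 ` lang Doublable 3) + gf ((#) 3 ` lang Doublable 4) + gf (lang Free 4)"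
    unfolding lang_Free by (subst gf_Un, (auto simp: lang_def)[1], subst gf_Un) (auto simp: lang_def)
  then show ?thesis
    unfolding A O1 S V gf_Cons qc_def xvar_def 1 2 r .
qed

end

(* This simproc rewrites equations between powers of q into equations between monomials. *)
declare [[simproc del: poly_fps_eq]]

section \<open>Reciprocal q-products and the convolution sums that will solve the
  recurrences\<close>

lemma power_cong_exp: "m = n \<Longrightarrow> x ^ m = x ^ n"
  by simp

lemma fps_prod_nth_0: "fps_nth (prod f A) 0 = (\<Prod>i\<in>A. fps_nth (f i) 0)" for f :: "'i \<Rightarrow> rat fps"
  by (induction A rule: infinite_finite_induct) auto

lemma one_minus_q_power_nz: "0 < n \<Longrightarrow> 1 - q ^ n \<noteq> 0"
proof
  assume "0 < n" "1 - q ^ n = 0"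
  then have "fps_nth (1 - q ^ n) 0 = 0" by simp
  with \<open>0 < n\<close> show False by simp
qed

text \<open>
  \<open>rpoch c b n\<close> is \<open>1 / (q\<^sup>c; q\<^sup>b)\<^sub>n\<close>; in particular \<open>e b n\<close> is \<open>1 / (q\<^sup>b; q\<^sup>b)\<^sub>n\<close>, for which 0 at negative
  \<open>n\<close> is the value compatible with the recurrence \<open>e_pred\<close>.
\<close>

definition rpoch :: "nat \<Rightarrow> nat \<Rightarrow> int \<Rightarrow> rat fps" where
  "rpoch c b n = (if n < 0 then 0 else inverse (\<Prod>j<nat n. 1 - q ^ (c + b * j)))"

abbreviation "e b \<equiv> rpoch b b"

lemma rpoch_neg [simp]: "n < 0 \<Longrightarrow> rpoch c b n = 0"
  by (simp add: rpoch_def)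

lemma rpoch_0 [simp]: "rpoch c b 0 = 1"
  by (simp add: rpoch_def)

lemma rpoch_Suc: "0 < c \<Longrightarrow> (1 - q ^ (c + b * n)) * rpoch c b (int (Suc n)) = rpoch c b (int n)"
proof -
  assume c: "0 < c"
  let ?P = "\<lambda>n. \<Prod>j<n. 1 - q ^ (c + b * j)"
  have 1: "fps_nth (?P n) 0 \<noteq> 0" for n using c by (simp add: fps_prod_nth_0)
  have 2: "fps_nth (1 - q ^ (c + b * n)) 0 \<noteq> 0" using c by simp
  have "inverse (?P (Suc n)) = inverse (?P n) * inverse (1 - q ^ (c + b * n))"
    using 1 2 by (simp add: fps_inverse_mult)
  then have "(1 - q ^ (c + b * n)) * inverse (?P (Suc n)) =
    inverse (?P n) * (inverse (1 - q ^ (c + b * n)) * (1 - q ^ (c + b * n)))" by (simp only: ac_simps)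
  also have "inverse (1 - q ^ (c + b * n)) * (1 - q ^ (c + b * n)) = 1"
    using 2 by (rule inverse_mult_eq_1)
  finally show ?thesis unfolding rpoch_def by (simp only: mult_1_right) (simp add: nat_add_distrib)
qed

lemma e_Suc: "0 < b \<Longrightarrow> (1 - q ^ (b * Suc n)) * e b (int (Suc n)) = e b (int n)"
  using rpoch_Suc[of b b n] by (simp only: mult_Suc_right)

lemma e_pred: "0 < b \<Longrightarrow> e b (n - 1) = (1 - q ^ (b * nat n)) * e b n"
proof (cases "n \<le> 0")
  case False
  assume b: "0 < b"
  define m where "m = nat (n - 1)"
  have n: "n = int (Suc m)" using False by (simp add: m_def)
  have "nat n = Suc m" "n - 1 = int m" using n by auto
  then show ?thesis using e_Suc[OF b, of m] unfolding n by simp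
qed auto

definition qplus :: "nat \<Rightarrow> rat fps" where "qplus n = (\<Prod>j<n. 1 + q ^ Suc j)"

lemma qplus_0 [simp]: "qplus 0 = 1" and qplus_Suc: "qplus (Suc n) = qplus n * (1 + q ^ Suc n)"
  by (simp_all add: qplus_def)

lemma qplus_nth_0: "fps_nth (qplus n) 0 = 1"
  by (simp add: qplus_def fps_prod_nth_0)

lemma qplus_inverse: "inverse (qplus n) * qplus n = 1"
  by (rule inverse_mult_eq_1) (simp add: qplus_nth_0)

lemma inverse_qplus_Suc: "inverse (qplus (Suc n)) * (1 + q ^ Suc n) = inverse (qplus n)"
proof -
  have "inverse (qplus (Suc n)) * (1 + q ^ Suc n) = (inverse (qplus n) * qplus n) * inverse (qplus (Suc n)) * (1 + q ^ Suc n)"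
    by (simp add: qplus_inverse)
  also have "\<dots> = inverse (qplus n) * (inverse (qplus (Suc n)) * qplus (Suc n))" by (simp only: qplus_Suc ac_simps)
  finally show ?thesis by (simp only: qplus_inverse mult_1_right)
qed

text \<open>The j-summand left from the third double sum once its sum over i has been evaluated and
  (-q; q)_inf taken out. Times 1 + q^(2j+1) it is the one left from the second.\<close>

definition u :: "nat \<Rightarrow> rat fps" where
  "u j = (-1) ^ j * q ^ (j^2 + 2 * j) * e 2 (int j) * inverse (qplus (2 * j + 1))"

lemma u_Suc: "(1 - q ^ (4 * j + 4)) * (1 + q ^ (2 * j + 3)) * u (Suc j) = - (q ^ (2 * j + 3)) * u j"
proof -
  have e: "(1 - q ^ (2 * j + 2)) * e 2 (int (Suc j)) = e 2 (int j)"
    using e_Suc[of 2 j] by (simp add: algebra_simps)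
  have 1: "inverse (qplus (2 * j + 3)) * (1 + q ^ (2 * j + 3)) = inverse (qplus (2 * j + 2))"
    using inverse_qplus_Suc[of "2 * j + 2"] by (simp add: eval_nat_numeral)
  have 2: "inverse (qplus (2 * j + 2)) * (1 + q ^ (2 * j + 2)) = inverse (qplus (2 * j + 1))"
    using inverse_qplus_Suc[of "2 * j + 1"] by (simp add: eval_nat_numeral)
  have 3: "1 - q ^ (4 * j + 4) = (1 - q ^ (2 * j + 2)) * (1 + q ^ (2 * j + 2))"
  proof -
    have "q ^ (4 * j + 4) = q ^ (2 * j + 2) * q ^ (2 * j + 2)"
      by (simp only: power_add[symmetric] power_mult[symmetric] power_mult_distrib, rule power_cong_exp, simp)
    then show ?thesis by (simp only:) (simp add: algebra_simps)
  qed
  have 4: "q ^ ((Suc j)^2 + 2 * Suc j) = q ^ (j^2 + 2 * j) * q ^ (2 * j + 3)"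
    by (simp only: power_add[symmetric], rule power_cong_exp, simp add: power2_eq_square)
  have "(1 - q ^ (4 * j + 4)) * (1 + q ^ (2 * j + 3)) * u (Suc j) =
    - ((-1) ^ j * (q ^ (j^2 + 2 * j) * q ^ (2 * j + 3)) * ((1 - q ^ (2 * j + 2)) * e 2 (int (Suc j))) *
     (inverse (qplus (2 * j + 3)) * (1 + q ^ (2 * j + 3)) * (1 + q ^ (2 * j + 2))))"
    unfolding 3 u_def 4 by (simp add: ac_simps eval_nat_numeral)
  also have "\<dots> = - (q ^ (2 * j + 3)) * u j"
    unfolding e 1 2 u_def by (simp add: ac_simps)
  finally show ?thesis .
qed

text \<open>Up to the factor \<open>qplus (2 * M + 1)\<close> this will be the coefficient of x^M in
  A/(x; q^2)_inf; \<open>omega\<close> is the analogue for O1, with factor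
  \<open>qplus (2 * M)\<close>.\<close>

definition alpha :: "nat \<Rightarrow> rat fps" where
  "alpha M = (\<Sum>j\<le>M. u j * e 2 (int M - int j))"

definition omega :: "nat \<Rightarrow> rat fps" where
  "omega M = (\<Sum>j\<le>M. u j * (1 + q ^ (2 * j + 1)) * e 2 (int M - int j))"

text \<open>The difference of consecutive values of \<open>e 2\<close> produces q^(2(m+1-j)).
  Multiplied by q^(2j+1) it becomes q^(2m+3), which is free of j and leaves the sum.\<close>

lemma omega_Suc: "omega (Suc m) - omega m = alpha (Suc m) - alpha m + q ^ (2 * m + 3) * alpha (Suc m)"
proof -
  have omega: "omega m = (\<Sum>j\<le>Suc m. u j * (1 + q ^ (2 * j + 1)) * e 2 (int (Suc m) - 1 - int j))"
    unfolding omega_def by (simp add: algebra_simps)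
  have alpha: "alpha m = (\<Sum>j\<le>Suc m. u j * e 2 (int (Suc m) - 1 - int j))"
    unfolding alpha_def by (simp add: algebra_simps)
  have "omega (Suc m) - omega m = (\<Sum>j\<le>Suc m. u j * (1 + q ^ (2 * j + 1)) *
     (e 2 (int (Suc m) - int j) - e 2 (int (Suc m) - 1 - int j)))"
    unfolding omega by (simp only: omega_def sum_subtractf[symmetric] right_diff_distrib)
  also have "\<dots> = (\<Sum>j\<le>Suc m. u j * e 2 (int (Suc m) - int j) - u j * e 2 (int (Suc m) - 1 - int j) +
     q ^ (2 * m + 3) * (u j * e 2 (int (Suc m) - int j)))"
  proof (rule sum.cong[OF refl])
    fix j assume "j \<in> {..Suc m}"
    then have j: "j \<le> Suc m" by simp
    have "e 2 (int (Suc m) - 1 - int j) = e 2 (int (Suc m) - int j - 1)" by (simp add: algebra_simps)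
    also have "\<dots> = (1 - q ^ (2 * nat (int (Suc m) - int j))) * e 2 (int (Suc m) - int j)"
      by (rule e_pred) simp
    also have "nat (int (Suc m) - int j) = Suc m - j" using j by simp
    finally have e: "e 2 (int (Suc m) - 1 - int j) = (1 - q ^ (2 * (Suc m - j))) * e 2 (int (Suc m) - int j)" .
    have q: "q ^ (2 * m + 3) = q ^ (2 * j + 1) * q ^ (2 * (Suc m - j))"
      by (simp only: power_add[symmetric], rule power_cong_exp) (use j in simp)
    show "u j * (1 + q ^ (2 * j + 1)) * (e 2 (int (Suc m) - int j) - e 2 (int (Suc m) - 1 - int j)) =
       u j * e 2 (int (Suc m) - int j) - u j * e 2 (int (Suc m) - 1 - int j) +
        q ^ (2 * m + 3) * (u j * e 2 (int (Suc m) - int j))"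
      unfolding e q by (simp only: ring_distribs mult_1_left mult_1_right) (simp only: ac_simps, simp add: algebra_simps)
  qed
  also have "\<dots> = alpha (Suc m) - alpha m + q ^ (2 * m + 3) * alpha (Suc m)"
    unfolding alpha by (simp only: alpha_def sum.distrib sum_subtractf sum_distrib_left)
  finally show ?thesis .
qed

text \<open>The termwise telescoping relation of \<open>alpha_Suc\<close> after all quotients of
  consecutive terms are made explicit: x, J and D stand for q, q^(2j) and q^(2d), where m = j +
  d.\<close>

lemma alpha_poly:
  fixes x J D u e :: "'a :: comm_ring_1"
  shows "u * ((1 - (J * D * x^2)^2) * (1 + J * D * x^3) * e - (1 + x^2 - (J * D * x^2)^2) * ((1 - D * x^2) * e) +
      (1 - J * D * x) * ((1 - D * x^2) * (x^2 - D * x^2) * e) -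
      (J * D * x^2)^2 * (1 + J * x) * ((1 - D * x^2) * e)) =
    J * x^3 * u * D^2 * ((1 - D * x^2) * e) + (1 - J^2) * (1 + J * x) * u * (D * x^2)^2 * e"
  by (simp add: algebra_simps power2_eq_square power3_eq_cube)

text \<open>This is the third recurrence of \<open>hat_rec\<close> with the factors of
  \<open>qplus\<close> divided out, so it is what the proposed solution has to satisfy.\<close>

lemma alpha_Suc:
  "(1 - q ^ (4 * m + 4)) * (1 + q ^ (2 * m + 3)) * alpha (Suc m) - (1 + q^2 - q ^ (4 * m + 4)) * alpha m +
   (q^2 - q ^ (2 * m + 3)) * (if m = 0 then 0 else alpha (m - 1)) = q ^ (4 * m + 4) * omega m" (is "?lhs = _")
proof -
  define M where "M = int (Suc m)"
  define E where "E k j = e 2 (M - k - int j)" for k j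
  define G where "G j = - ((1 - q ^ (4 * j)) * (1 + q ^ (2 * j + 1)) * u j * q ^ (4 * (Suc m - j)) * E 0 j)" for j
  \<comment> \<open>\<open>G\<close> is a certificate for creative telescoping of the summand.\<close>
  let ?t = "\<lambda>j. u j * ((1 - q ^ (4 * m + 4)) * (1 + q ^ (2 * m + 3)) * E 0 j
    - (1 + q^2 - q ^ (4 * m + 4)) * E 1 j + (q^2 - q ^ (2 * m + 3)) * E 2 j
    - q ^ (4 * m + 4) * (1 + q ^ (2 * j + 1)) * E 1 j)"
  have omega: "omega m = (\<Sum>j\<le>Suc m. u j * (1 + q ^ (2 * j + 1)) * E 1 j)"
    unfolding omega_def E_def M_def by (simp add: algebra_simps)
  have al0: "alpha (Suc m) = (\<Sum>j\<le>Suc m. u j * E 0 j)"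
    unfolding alpha_def E_def M_def by simp
  have al1: "alpha m = (\<Sum>j\<le>Suc m. u j * E 1 j)"
    unfolding alpha_def E_def M_def by (simp add: algebra_simps)
  have al2: "(if m = 0 then 0 else alpha (m - 1)) = (\<Sum>j\<le>Suc m. u j * E 2 j)"
    unfolding alpha_def E_def M_def by (cases m) (simp_all add: algebra_simps)
  have "(\<Sum>j\<le>Suc m. ?t j) = (\<Sum>j\<le>Suc m. G (Suc j) - G j)"
  proof (rule sum.cong[OF refl])
    fix j assume "j \<in> {..Suc m}"
    \<comment> \<open>The top index has no d with m = j + d; there all values of \<open>e 2\<close>
      at negative arguments vanish and the relation is immediate.\<close>
    then consider "j = Suc m" | d where "Suc m = Suc (j + d)"
      by (metis atMost_iff le_neq_implies_less less_imp_Suc_add)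
    then show "?t j = G (Suc j) - G j"
    proof cases
      case 1
      have "E 0 j = 1" "E 1 j = 0" "E 2 j = 0" "E 0 (Suc j) = 0" by (simp_all add: E_def M_def 1)
      moreover have "4 * m + 4 = 4 * j" "2 * m + 3 = 2 * j + 1" "Suc m - j = 0" using 1 by auto
      ultimately show ?thesis by (simp only: G_def) (simp add: algebra_simps)
    next
      case 2
      define J D where "J = q ^ (2 * j)" and "D = q ^ (2 * d)"
      have M: "M = int (Suc (j + d))" using 2 by (simp add: M_def)
      have Ed: "E 0 j = e 2 (int d + 1)" "E 1 j = e 2 (int d)" "E 2 j = e 2 (int d - 1)"
         "E 0 (Suc j) = e 2 (int d)" by (simp_all add: E_def M algebra_simps)
      have E1: "e 2 (int d) = (1 - D * q^2) * e 2 (int d + 1)"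
        using e_pred[of 2 "int d + 1"] by (simp add: D_def nat_add_distrib algebra_simps power_add power2_eq_square)
      have "q^2 * e 2 (int d - 1) = (q^2 - D * q^2) * e 2 (int d)"
        unfolding D_def by (subst e_pred) (simp_all add: algebra_simps)
      then have E2: "q^2 * e 2 (int d - 1) = (1 - D * q^2) * (q^2 - D * q^2) * e 2 (int d + 1)"
        unfolding E1 by (simp only: ac_simps)
      have m: "m = j + d" using 2 by simp
      have q: "q ^ (4 * m + 4) = (J * D * q^2)^2" "q ^ (2 * m + 3) = J * D * q^3"
        "q ^ (4 * j) = J^2" "q ^ (4 * (Suc m - j)) = (D * q^2)^2"
        "q ^ (4 * (Suc m - Suc j)) = D^2" "q ^ (2 * j + 3) = J * q^3"
        unfolding J_def D_def m
        by (simp_all only: power_add[symmetric] power_mult[symmetric] power_mult_distrib;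
          rule power_cong_exp; simp)+
      have q': "q ^ (2 * j + 1) = J * q" by (simp add: J_def)
      have E2': "(q^2 - J * D * q^3) * e 2 (int d - 1) = (1 - J * D * q) * ((1 - D * q^2) * (q^2 - D * q^2) * e 2 (int d + 1))"
        unfolding E2[symmetric] by algebra
      have "G (Suc j) = - ((1 - q ^ (4 * j + 4)) * (1 + q ^ (2 * j + 3)) * u (Suc j)) * q ^ (4 * (Suc m - Suc j)) * E 0 (Suc j)"
        unfolding G_def by (simp add: eval_nat_numeral)
      also have "\<dots> = J * q^3 * u j * D^2 * ((1 - D * q^2) * e 2 (int d + 1))"
        unfolding u_Suc unfolding q q' Ed(4) E1 by simp
      finally have G1: "G (Suc j) = J * q^3 * u j * D^2 * ((1 - D * q^2) * e 2 (int d + 1))" .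
      have G0: "G j = - ((1 - J^2) * (1 + J * q) * u j * (D * q^2)^2 * e 2 (int d + 1))"
        unfolding G_def Ed q q' ..
      show ?thesis
        unfolding G1 G0 unfolding Ed q q' E2' E1 using alpha_poly[of "u j" J D q "e 2 (int d + 1)"] by simp
    qed
  qed
  \<comment> \<open>Both ends vanish: \<open>G\<close> at m + 2 contains \<open>e 2 (-1)\<close>,
    and \<open>G 0\<close> contains the factor 1 - q^0.\<close>
  also have "\<dots> = 0"
  proof -
    have "(\<Sum>j\<le>Suc m. G (Suc j) - G j) = G (Suc (Suc m)) - G 0"
      by (subst lessThan_Suc_atMost[symmetric], subst sum_lessThan_telescope) simp
    then show ?thesis by (simp add: G_def E_def M_def)
  qed
  finally have *: "(\<Sum>j\<le>Suc m. ?t j) = 0" .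
  have "?lhs - q ^ (4 * m + 4) * omega m =
   (\<Sum>j\<le>Suc m. ?t j)"
    unfolding omega al0 al1 al2 unfolding sum_distrib_left sum_subtractf[symmetric] sum.distrib[symmetric]
    by (rule sum.cong[OF refl]) algebra
  with * show ?thesis by simp
qed

section \<open>Solving the system for the coefficients of the powers of x\<close>

text \<open>Euler's expansion of \<open>1 / (x; q\<^sup>2)\<^sub>\<infinity>\<close> in powers of \<open>x\<close>.\<close>

definition euler :: "rat fps fps" where "euler = Abs_fps (\<lambda>k. e 2 (int k))"

lemma xvar_mult_nth: "fps_nth (xvar * f) n = (if n = 0 then 0 else fps_nth f (n - 1))"
  by (simp add: xvar_def)

lemma qc_mult_nth: "fps_nth (qc k * f) n = q ^ k * fps_nth f n"
  by (simp add: qc_def)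

lemma eta_euler: "eta euler = (1 - xvar) * euler"
proof (rule fps_ext)
  fix n
  have "q ^ (2 * n) * e 2 (int n) = e 2 (int n) - e 2 (int n - 1)"
    by (subst e_pred) (simp_all add: algebra_simps)
  then show "fps_nth (eta euler) n = fps_nth ((1 - xvar) * euler) n"
    by (cases n) (simp_all add: eta_nth left_diff_distrib xvar_mult_nth euler_def, simp add: xvar_def)
qed

text \<open>
  The system and its images under \<open>eta\<close>, with the unknowns \<open>S\<close> and \<open>V\<close> eliminated and multiplied by
  \<open>E = 1 / (x; q\<^sup>2)\<^sub>\<infinity>\<close>; the factors \<open>1 - q\<^sup>2\<^sup>i x\<close> are absorbed by \<open>eta E = (1 - x) E\<close>.
\<close>

lemma hat_poly:
  fixes x c E A A1 A2 A3 O0 O1 O2 O3 S S1 S2 V V1 V2 V3 :: "'a :: comm_ring_1"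
  assumes "A = c^2 * x * A1 + V1" "A1 = c^2 * (c^2 * x) * A2 + V2" "A2 = c^2 * (c^4 * x) * A3 + V3"
    and "O0 = c * x * O1 + S" "O1 = c * (c^2 * x) * O2 + S1" "O2 = c * (c^4 * x) * O3 + S2"
    and "S = c^2 * x * S1 + c^3 * x * O2 + V1"
    and "V1 = c^2 * (c^2 * x) * (c^2 * (c^2 * x) * V3 + S2) + c^3 * (c^2 * x) * (c^3 * (c^2 * x) * A3 + O3) + V2"
  shows "(1 - x) * E * V1 = E * A - x * (E * A) - c^2 * (x * ((1 - x) * E * A1))" (is ?first)
    and "E * O0 - E * A = x * (E * O0) + c * (x * ((1 - x) * E * O1)) + c^2 * (x * ((1 - x) * E * O1)) +
      c^3 * (x * ((1 - c^2 * x) * (1 - x) * E * O2)) - x * (E * A) - c^2 * (x * ((1 - x) * E * A1))" (is ?second)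
    and "E * A - (1 - x) * E * A1 - x * (E * A) - c^2 * (x * (E * A)) + c^4 * (x * ((1 - c^2 * x) * (1 - x) * E * A2))
      + c^2 * (x * (x * (E * A))) + c^4 * (x * (x * ((1 - x) * E * A1))) - c^8 * (x * (x * ((1 - c^2 * x) * (1 - x) * E * A2)))
      - c^10 * (x * (x * ((1 - c^4 * x) * (1 - c^2 * x) * (1 - x) * E * A3))) =
      c^4 * (x * ((1 - c^2 * x) * (1 - x) * E * O2)) + c^5 * (x * ((1 - c^4 * x) * (1 - c^2 * x) * (1 - x) * E * O3))" (is "?lhs = ?rhs")
proof -
  have V1: "V1 = A - c^2 * x * A1" using assms(1) by simp
  have V2: "V2 = A1 - c^4 * x * A2" using assms(2) by (simp add: eval_nat_numeral ac_simps)
  have V3: "V3 = A2 - c^6 * x * A3" using assms(3) by (simp add: eval_nat_numeral ac_simps)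
  have S: "S = O0 - c * x * O1" using assms(4) by simp
  have S1: "S1 = O1 - c^3 * x * O2" using assms(5) by (simp add: eval_nat_numeral ac_simps)
  have S2: "S2 = O2 - c^5 * x * O3" using assms(6) by (simp add: eval_nat_numeral ac_simps)
  show ?first
    unfolding V1 by (simp add: algebra_simps)
  have k2: "O0 - A = c * x * O1 + c^2 * x * O1 + c^3 * x * (1 - c^2 * x) * O2 - c^2 * x * A1"
    using assms(7) unfolding V1 S S1 by (simp add: eval_nat_numeral algebra_simps)
  have "E * O0 - E * A - x * (E * O0) + x * (E * A) = (1 - x) * E * (O0 - A)" by (simp add: algebra_simps)
  also have "\<dots> = c * (x * ((1 - x) * E * O1)) + c^2 * (x * ((1 - x) * E * O1)) +
      c^3 * (x * ((1 - c^2 * x) * (1 - x) * E * O2)) - c^2 * (x * ((1 - x) * E * A1))"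
    unfolding k2 by (simp add: algebra_simps)
  finally show ?second
    by (simp add: algebra_simps)
  have k3: "A = A1 + c^2 * x * A1 - c^4 * x * (1 - c^4 * x) * A2 + c^10 * x^2 * (1 - c^4 * x) * A3 + c^4 * x * O2 +
      c^5 * x * (1 - c^4 * x) * O3"
    using assms(8) unfolding V1 V2 V3 S2 by (simp add: eval_nat_numeral algebra_simps)
  have "?lhs =
     (1 - x) * (1 - c^2 * x) * E * (A - A1 - c^2 * x * A1 + c^4 * x * (1 - c^4 * x) * A2 - c^10 * x^2 * (1 - c^4 * x) * A3)"
    by (simp add: eval_nat_numeral algebra_simps)
  also have "\<dots> = (1 - x) * (1 - c^2 * x) * E * (c^4 * x * O2 + c^5 * x * (1 - c^4 * x) * O3)"
    by (subst k3) simp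
  also have "\<dots> = ?rhs"
    by (simp add: algebra_simps)
  finally show "?lhs = ?rhs" .
qed

lemma hat_series:
  fixes V O1 S A :: "rat fps fps"
  assumes V: "V = gf (lang Free 2)" and O1: "O1 = gf (lang Single 0)" and S: "S = gf (lang Single 1)"
    and A: "A = gf (lang Armed 1)"
  shows "eta (euler * V) = euler * A - xvar * (euler * A) - qc 2 * (xvar * eta (euler * A))" (is ?first)
    and "euler * O1 - euler * A = xvar * (euler * O1) + qc 1 * (xvar * eta (euler * O1)) + qc 2 * (xvar * eta (euler * O1)) +
      qc 3 * (xvar * eta (eta (euler * O1))) - xvar * (euler * A) - qc 2 * (xvar * eta (euler * A))" (is ?second)
    and "euler * A - eta (euler * A) - xvar * (euler * A) - qc 2 * (xvar * (euler * A)) + qc 4 * (xvar * eta (eta (euler * A)))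
      + qc 2 * (xvar * (xvar * (euler * A))) + qc 4 * (xvar * (xvar * eta (euler * A))) - qc 8 * (xvar * (xvar * eta (eta (euler * A))))
      - qc 10 * (xvar * (xvar * eta (eta (eta (euler * A))))) =
      qc 4 * (xvar * eta (eta (euler * O1))) + qc 5 * (xvar * eta (eta (eta (euler * O1))))" (is "?lhs = ?rhs")
proof -
  \<comment> \<open>\<open>hat_poly\<close> is stated with a single constant c, so every
    \<open>qc k\<close> has to become a power of \<open>qc 1\<close>.\<close>
  have ccp: "qc k = qc 1 ^ k" for k
    by (induction k) (simp_all add: qc_def fps_const_mult[symmetric] del: fps_const_mult)
  note Armed_eq' = Armed_eq[OF assms] and Single_0_eq' = Single_0_eq[OF assms] and Single_1_eq' = Single_1_eq[OF assms]
    and Free_eq' = Free_eq[OF assms]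
  have eta_1: "eta 1 = 1" using eta_const[of 1] by simp
  have eta1: "eta (euler * f) = (1 - xvar) * euler * eta f" for f
    by (simp add: eta_mult eta_euler)
  have eta2: "eta (eta (euler * f)) = (1 - qc 2 * xvar) * (1 - xvar) * euler * eta (eta f)" for f
    unfolding eta1 by (simp add: eta_mult eta_euler eta_diff eta_1 eta_xvar mult.assoc)
  have eta3: "eta (eta (eta (euler * f))) = (1 - qc 4 * xvar) * (1 - qc 2 * xvar) * (1 - xvar) * euler * eta (eta (eta f))" for f
  proof -
    have "eta (qc 2 * xvar) = qc 4 * xvar" by (simp add: eta_mult eta_qc eta_xvar qc_mult mult.assoc[symmetric])
    then show ?thesis
      unfolding eta2 by (simp add: eta_mult eta_euler eta_diff eta_1 eta_xvar mult.assoc)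
  qed
  have E2: "eta (qc k * f) = qc k * eta f" for k f by (simp add: eta_mult eta_qc)
  have e1: "A = (qc 1)^2 * xvar * eta A + eta V" using Armed_eq' unfolding ccp[of 2] .
  have e2: "eta A = (qc 1)^2 * ((qc 1)^2 * xvar) * eta (eta A) + eta (eta V)"
    using arg_cong[OF Armed_eq', of eta] unfolding eta_add eta_mult eta_qc eta_xvar unfolding ccp[of 2] .
  have e3: "eta (eta A) = (qc 1)^2 * ((qc 1)^4 * xvar) * eta (eta (eta A)) + eta (eta (eta V))"
  proof -
    have "eta (eta A) = qc 2 * (qc 2 * (qc 2 * xvar)) * eta (eta (eta A)) + eta (eta (eta V))"
      using arg_cong[OF Armed_eq', of "\<lambda>f. eta (eta f)"] unfolding eta_add eta_mult eta_qc eta_xvar .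
    also have "qc 2 * (qc 2 * xvar) = qc 4 * xvar" by (simp add: qc_mult mult.assoc[symmetric])
    finally show ?thesis unfolding ccp[of 2] ccp[of 4] .
  qed
  have o1: "O1 = qc 1 * xvar * eta O1 + S" using Single_0_eq' .
  have o2: "eta O1 = qc 1 * ((qc 1)^2 * xvar) * eta (eta O1) + eta S"
    using arg_cong[OF Single_0_eq', of eta] unfolding eta_add eta_mult eta_qc eta_xvar unfolding ccp[of 2] .
  have o3: "eta (eta O1) = qc 1 * ((qc 1)^4 * xvar) * eta (eta (eta O1)) + eta (eta S)"
  proof -
    have "eta (eta O1) = qc 1 * (qc 2 * (qc 2 * xvar)) * eta (eta (eta O1)) + eta (eta S)"
      using arg_cong[OF Single_0_eq', of "\<lambda>f. eta (eta f)"] unfolding eta_add eta_mult eta_qc eta_xvar .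
    also have "qc 2 * (qc 2 * xvar) = qc 4 * xvar" by (simp add: qc_mult mult.assoc[symmetric])
    finally show ?thesis unfolding ccp[of 4] .
  qed
  have s1: "S = (qc 1)^2 * xvar * eta S + (qc 1)^3 * xvar * eta (eta O1) + eta V"
    using Single_1_eq' unfolding ccp[of 2] ccp[of 3] .
  have v1: "eta V = (qc 1)^2 * ((qc 1)^2 * xvar) * ((qc 1)^2 * ((qc 1)^2 * xvar) * eta (eta (eta V)) + eta (eta S)) +
     (qc 1)^3 * ((qc 1)^2 * xvar) * ((qc 1)^3 * ((qc 1)^2 * xvar) * eta (eta (eta A)) + eta (eta (eta O1))) + eta (eta V)"
    using arg_cong[OF Free_eq', of eta] unfolding eta_add eta_mult eta_qc eta_xvar unfolding ccp[of 2] ccp[of 3] .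
  note hp = hat_poly[OF e1 e2 e3 o1 o2 o3 s1 v1, of euler]
  show ?first
    using hp(1) unfolding eta1 ccp[of 2] .
  show ?second
    using hp(2) unfolding eta2 unfolding eta1 ccp[of 2] ccp[of 3] .
  show "?lhs = ?rhs"
    using hp(3) unfolding eta3 unfolding eta2 unfolding eta1 ccp[of 2] ccp[of 4] ccp[of 5] ccp[of 8] ccp[of 10] .
qed

text \<open>Since \<open>eta\<close> only rescales coefficients by powers of q, comparing the
  coefficients of x^(m+1) in \<open>hat_series\<close> gives recurrences; the third has order
  two.\<close>

lemma hat_rec:
  fixes V O1 S A :: "rat fps fps"
  assumes V: "V = gf (lang Free 2)" and O1: "O1 = gf (lang Single 0)" and S: "S = gf (lang Single 1)"
    and A: "A = gf (lang Armed 1)"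
  defines "a \<equiv> fps_nth (euler * A)" and "b \<equiv> fps_nth (euler * O1)" and "v \<equiv> fps_nth (euler * V)"
  shows "q ^ (2 * m + 2) * v (Suc m) = a (Suc m) - (1 + q ^ (2 * m + 2)) * a m" (is ?first)
    and "b (Suc m) - a (Suc m) = (1 + q ^ (2 * m + 2)) * ((1 + q ^ (2 * m + 1)) * b m - a m)" (is ?second)
    and "(1 - q ^ (2 * m + 2)) * a (Suc m) = (1 + q^2 - q ^ (4 * m + 4)) * a m -
      (if m = 0 then 0 else (q^2 - q ^ (2 * m + 3)) * (1 + q ^ (2 * m)) * (1 + q ^ (2 * m + 1)) * a (m - 1)) +
      q ^ (4 * m + 4) * (1 + q ^ (2 * m + 1)) * b m" (is ?third)
proof -
  define K where "K = q ^ (2 * m)"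
  have q: "q ^ (2 * m) = K" "q ^ (2 * m + 1) = K * q" "q ^ (2 * m + 2) = K * q^2" "q ^ (2 * m + 3) = K * q^3"
     "q ^ (4 * m + 4) = K^2 * q^4"
    unfolding K_def
    by (simp_all only: power_add[symmetric] power_mult[symmetric] power_Suc2[symmetric])
      (simp_all add: power_add power_mult)
  note hs = hat_series[OF V O1 S A]
  have nth: "fps_nth (f + g) n = fps_nth f n + fps_nth g n" "fps_nth (f - g) n = fps_nth f n - fps_nth g n"
    for f g :: "rat fps fps" and n by simp_all
  have *: "fps_nth (eta f) (Suc m) = K * q^2 * fps_nth f (Suc m)" "fps_nth (eta f) m = K * fps_nth f m" for f
    by (simp_all add: eta_nth K_def power2_eq_square algebra_simps)
  show ?first
    using arg_cong[OF hs(1), of "\<lambda>f. fps_nth f (Suc m)"]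
    unfolding nth qc_mult_nth xvar_mult_nth * a_def v_def q by (simp add: algebra_simps *)
  show ?second
    using arg_cong[OF hs(2), of "\<lambda>f. fps_nth f (Suc m)"]
    unfolding nth qc_mult_nth xvar_mult_nth * a_def b_def q
    by (simp add: algebra_simps power2_eq_square power3_eq_cube *)
  have 3: "a (Suc m) - K * q^2 * a (Suc m) - a m - q^2 * a m + q^4 * (K * (K * a m))
      + (if m = 0 then 0 else q^2 * a (m - 1) + q^4 * fps_nth (eta (euler * A)) (m - 1)
         - q^8 * fps_nth (eta (eta (euler * A))) (m - 1) - q^10 * fps_nth (eta (eta (eta (euler * A)))) (m - 1)) =
     q^4 * (K * (K * b m)) + q^5 * (K * (K * (K * b m)))"
    using arg_cong[OF hs(3), of "\<lambda>f. fps_nth f (Suc m)"]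
    unfolding nth qc_mult_nth xvar_mult_nth * a_def b_def
    by (cases "m = 0", simp_all add: algebra_simps * del: fps_mult_nth_0)
      (simp_all add: algebra_simps eta_nth K_def)
  have 4: "(if m = 0 then 0 else q^2 * a (m - 1) + q^4 * fps_nth (eta (euler * A)) (m - 1)
         - q^8 * fps_nth (eta (eta (euler * A))) (m - 1) - q^10 * fps_nth (eta (eta (eta (euler * A)))) (m - 1)) =
     (if m = 0 then 0 else (q^2 - K * q^3) * (1 + K) * (1 + K * q) * a (m - 1))"
  proof (cases m)
    case (Suc k)
    define J where "J = q ^ (2 * k)"
    have K: "K = J * q^2" by (simp add: K_def J_def Suc power2_eq_square)
    have e: "fps_nth (eta f) k = J * fps_nth f k" for f by (simp add: eta_nth J_def)
    \<comment> \<open>This factorisation is what makes the normalisation by \<open>qplus\<close>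
      possible: (1 + q^(2m)) (1 + q^(2m+1)) is the quotient of \<open>qplus (2 * m + 1)\<close> by
      \<open>qplus (2 * m - 1)\<close>.\<close>
    have "q^2 * x + q^4 * (J * x) - q^8 * (J * (J * x)) - q^10 * (J * (J * (J * x))) =
      (q^2 - J * q^2 * q^3) * (1 + J * q^2) * (1 + J * q^2 * q) * x" for x
      by (simp add: algebra_simps eval_nat_numeral)
    then show ?thesis unfolding K using Suc by (simp add: e a_def)
  qed simp
  show ?third
    using 3[unfolded 4] unfolding q
    by (simp add: algebra_simps eval_nat_numeral)
qed

lemma gf_nth_0: "[] \<in> S \<Longrightarrow> fps_nth (gf S) 0 = 1"
proof (rule fps_ext)
  fix n assume "[] \<in> S"
  then have "{ys \<in> S. length ys = 0 \<and> sum_list ys = n} = (if n = 0 then {[]} else {})" by auto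
  then show "fps_nth (fps_nth (gf S) 0) n = fps_nth 1 n" by (simp add: gf_nth del: length_0_conv)
qed

text \<open>The factors 1 + q^k in \<open>hat_rec\<close> are quotients of values of
  \<open>qplus\<close>. Without them the third recurrence is \<open>alpha_Suc\<close>, which
  determines a, and the second is \<open>omega_Suc\<close>, which then determines b; both sequences
  start at 1.\<close>

lemma hat_explicit:
  "fps_nth (euler * gf (lang Armed 1)) m = qplus (2 * m + 1) * alpha m \<and> fps_nth (euler * gf (lang Single 0)) m = qplus (2 * m) * omega m"
proof (induction m rule: less_induct)
  case (less m)
  define a where "a = fps_nth (euler * gf (lang Armed 1))"
  define b where "b = fps_nth (euler * gf (lang Single 0))"
  have IH: "a k = qplus (2 * k + 1) * alpha k" "b k = qplus (2 * k) * omega k" if "k < m" for k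
    using less.IH[OF that] by (simp_all add: a_def b_def)
  show ?case
  proof (cases m)
    case 0
    have "fps_nth (gf (lang s r)) 0 = 1" for s r by (rule gf_nth_0) (simp add: lang_def)
    moreover have "u 0 = inverse (qplus 1)" by (simp add: u_def)
    moreover have "inverse (qplus 1) * (1 + q) = 1" using inverse_qplus_Suc[of 0] by simp
    moreover have "qplus 1 * inverse (qplus 1) = 1" using qplus_inverse[of 1] by (simp add: mult.commute)
    ultimately show ?thesis
      by (simp add: 0 alpha_def omega_def euler_def del: One_nat_def)
  next
    case (Suc k)
    have ak: "a k = qplus (2 * k + 1) * alpha k" and bk: "b k = qplus (2 * k) * omega k" using IH Suc by auto
    have P1: "qplus (2 * k + 1) = qplus (2 * k) * (1 + q ^ (2 * k + 1))" by (simp add: qplus_Suc)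
    have P2: "qplus (2 * Suc k) = qplus (2 * k + 1) * (1 + q ^ (2 * k + 2))" using qplus_Suc[of "2 * k + 1"] by simp
    have P3: "qplus (2 * Suc k + 1) = qplus (2 * k + 1) * (1 + q ^ (2 * k + 2)) * (1 + q ^ (2 * k + 3))"
      using qplus_Suc[of "2 * k + 2"] P2 by (simp add: eval_nat_numeral)
    have R: "(1 - q ^ (2 * k + 2)) * a (Suc k) = (1 + q^2 - q ^ (4 * k + 4)) * a k -
      (if k = 0 then 0 else (q^2 - q ^ (2 * k + 3)) * (1 + q ^ (2 * k)) * (1 + q ^ (2 * k + 1)) * a (k - 1)) +
      q ^ (4 * k + 4) * (1 + q ^ (2 * k + 1)) * b k"
      unfolding a_def b_def by (rule hat_rec(3)[OF refl refl refl refl])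
    have a1: "(if k = 0 then 0 else (q^2 - q ^ (2 * k + 3)) * (1 + q ^ (2 * k)) * (1 + q ^ (2 * k + 1)) * a (k - 1)) =
      qplus (2 * k + 1) * ((q^2 - q ^ (2 * k + 3)) * (if k = 0 then 0 else alpha (k - 1)))"
    proof (cases k)
      case (Suc l)
      have "qplus (2 * k + 1) = qplus (2 * l + 1) * (1 + q ^ (2 * k)) * (1 + q ^ (2 * k + 1))"
        unfolding P1 using qplus_Suc[of "2 * l + 1"] Suc by simp
      moreover have "a l = qplus (2 * l + 1) * alpha l" using IH \<open>m = Suc k\<close> Suc by auto
      ultimately show ?thesis using Suc by (simp add: ac_simps)
    qed simp
    have "(1 - q ^ (2 * k + 2)) * a (Suc k) = qplus (2 * k + 1) * ((1 + q^2 - q ^ (4 * k + 4)) * alpha k -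
       (q^2 - q ^ (2 * k + 3)) * (if k = 0 then 0 else alpha (k - 1)) + q ^ (4 * k + 4) * omega k)"
      unfolding R a1 ak bk unfolding P1 by (simp add: algebra_simps)
    also have "\<dots> = qplus (2 * k + 1) * ((1 - q ^ (4 * k + 4)) * (1 + q ^ (2 * k + 3)) * alpha (Suc k))"
    proof -
      have "(1 + q^2 - q ^ (4 * k + 4)) * alpha k -
          (q^2 - q ^ (2 * k + 3)) * (if k = 0 then 0 else alpha (k - 1)) + q ^ (4 * k + 4) * omega k =
        (1 - q ^ (4 * k + 4)) * (1 + q ^ (2 * k + 3)) * alpha (Suc k)"
        using alpha_Suc[of k] by (simp add: algebra_simps)
      then show ?thesis by (simp only:)
    qed
    also have "1 - q ^ (4 * k + 4) = (1 - q ^ (2 * k + 2)) * (1 + q ^ (2 * k + 2))"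
    proof -
      have "q ^ (4 * k + 4) = q ^ (2 * k + 2) * q ^ (2 * k + 2)"
        by (simp only: power_add[symmetric], rule power_cong_exp, simp)
      then show ?thesis by (simp only:) (simp add: algebra_simps)
    qed
    finally have "(1 - q ^ (2 * k + 2)) * a (Suc k) = (1 - q ^ (2 * k + 2)) * (qplus (2 * Suc k + 1) * alpha (Suc k))"
      unfolding P3 by (simp only: ac_simps)
    then have a: "a (Suc k) = qplus (2 * Suc k + 1) * alpha (Suc k)"
      using one_minus_q_power_nz[of "2 * k + 2"] by (simp only: mult_cancel_left) simp
    have "b (Suc k) - a (Suc k) = (1 + q ^ (2 * k + 2)) * ((1 + q ^ (2 * k + 1)) * b k - a k)"
      unfolding a_def b_def by (rule hat_rec(2)[OF refl refl refl refl])
    then have "b (Suc k) = a (Suc k) + (1 + q ^ (2 * k + 2)) * ((1 + q ^ (2 * k + 1)) * b k - a k)"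
      by (simp add: algebra_simps)
    also have "\<dots> = qplus (2 * Suc k) * ((1 + q ^ (2 * k + 3)) * alpha (Suc k) + omega k - alpha k)"
      unfolding a ak bk P2 P3 P1 by (simp add: algebra_simps)
    also have "(1 + q ^ (2 * k + 3)) * alpha (Suc k) + omega k - alpha k = omega (Suc k)"
      using omega_Suc[of k] by (simp add: algebra_simps)
    finally show ?thesis using a Suc by (simp add: a_def b_def)
  qed
qed

section \<open>Letting x tend to 1\<close>

lemma fps_infsum_cmult:
  fixes g :: "nat \<Rightarrow> rat fps"
  assumes "\<And>i. fps_X ^ i dvd g i"
  shows "infsum (\<lambda>i. c * g i) UNIV = c * infsum g UNIV"
proof (rule LIMSEQ_unique)
  show "(\<lambda>L. \<Sum>i\<le>L. c * g i) \<longlonglongrightarrow> infsum (\<lambda>i. c * g i) UNIV"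
    by (rule fps_sum_tendsto_nat) (rule dvd_mult[OF assms])
  show "(\<lambda>L. \<Sum>i\<le>L. c * g i) \<longlonglongrightarrow> c * infsum g UNIV"
    unfolding sum_distrib_left[symmetric]
    by (rule fps_tendsto_cmult[OF fps_sum_tendsto_nat[OF assms]])
qed

lemma fps_infsum_add:
  fixes f g :: "nat \<Rightarrow> rat fps"
  assumes "\<And>i. fps_X ^ i dvd f i" "\<And>i. fps_X ^ i dvd g i"
  shows "infsum (\<lambda>i. f i + g i) UNIV = infsum f UNIV + infsum g UNIV"
proof (rule LIMSEQ_unique)
  show "(\<lambda>L. \<Sum>i\<le>L. f i + g i) \<longlonglongrightarrow> infsum (\<lambda>i. f i + g i) UNIV"
    by (rule fps_sum_tendsto_nat) (rule dvd_add[OF assms])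
  show "(\<lambda>L. \<Sum>i\<le>L. f i + g i) \<longlonglongrightarrow> infsum f UNIV + infsum g UNIV"
    unfolding sum.distrib
    by (intro fps_tendsto_add fps_sum_tendsto_nat assms)
qed

lemma qpoch_tendsto:
  assumes "fps_nth a 0 = 0" "fps_nth p 0 = 0"
  shows "(\<lambda>n. \<Prod>j<n. 1 - a * p ^ j) \<longlonglongrightarrow> qpoch a p \<infinity>"
  by (rule has_prod_imp_tendsto'[OF has_prod_qpoch[OF assms]])

definition e_inf :: "nat \<Rightarrow> rat fps" where "e_inf b = inverse (qpoch (q ^ b) (q ^ b) \<infinity>)"

definition qplus_inf :: "rat fps" where "qplus_inf = qpoch (- q) q \<infinity>"

lemma qpoch_inf_nth_0:
  assumes "fps_nth a 0 = 0" "fps_nth p 0 = 0"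
  shows "fps_nth (qpoch a p \<infinity>) 0 = 1"
  by (rule fps_tendsto_nth_eq[OF qpoch_tendsto[OF assms]]) (simp add: fps_prod_nth_0 assms)

lemma qplus_tendsto: "qplus \<longlonglongrightarrow> qplus_inf"
proof -
  have "qplus = (\<lambda>n. \<Prod>j<n. 1 - (- q) * q ^ j)" by (auto simp: qplus_def)
  then show ?thesis unfolding qplus_inf_def using qpoch_tendsto[of "- q" q] by simp
qed

lemma rpoch_tendsto:
  assumes "0 < c" "0 < b"
  shows "(\<lambda>n. rpoch c b (int n + k)) \<longlonglongrightarrow> inverse (qpoch (q ^ c) (q ^ b) \<infinity>)"
proof (rule Lim_transform_eventually)
  have "(\<lambda>n. inverse (\<Prod>j<n. 1 - q ^ c * (q ^ b) ^ j)) \<longlonglongrightarrow> inverse (qpoch (q ^ c) (q ^ b) \<infinity>)"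
    by (rule fps_tendsto_inverse[OF qpoch_tendsto])
     (use assms in \<open>simp_all add: fps_prod_nth_0 fps_power_zeroth zero_power\<close>)
  moreover have "rpoch c b (int n) = inverse (\<Prod>j<n. 1 - q ^ c * (q ^ b) ^ j)" for n
    by (simp add: rpoch_def power_add power_mult)
  ultimately have lim: "(\<lambda>n. rpoch c b (int n)) \<longlonglongrightarrow> inverse (qpoch (q ^ c) (q ^ b) \<infinity>)" by simp
  have "filterlim (\<lambda>n. nat (int n + k)) sequentially sequentially"
    unfolding filterlim_at_top
  proof
    fix Z
    show "\<forall>\<^sub>F n in sequentially. Z \<le> nat (int n + k)"
      unfolding eventually_sequentially by (rule exI[of _ "nat (int Z + \<bar>k\<bar>)"]) auto
  qed
  then show "(\<lambda>n. rpoch c b (int (nat (int n + k)))) \<longlonglongrightarrow> inverse (qpoch (q ^ c) (q ^ b) \<infinity>)"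
    by (rule filterlim_compose[OF lim])
  show "\<forall>\<^sub>F n in sequentially. rpoch c b (int (nat (int n + k))) = rpoch c b (int n + k)"
    unfolding eventually_sequentially by (rule exI[of _ "nat \<bar>k\<bar>"]) auto
qed

lemma e_tendsto: "0 < b \<Longrightarrow> (\<lambda>n. e b (int n)) \<longlonglongrightarrow> e_inf b"
  unfolding e_inf_def using rpoch_tendsto[of b b 0] by simp

lemma e_diff_tendsto: "0 < b \<Longrightarrow> (\<lambda>n. e b (int n - k)) \<longlonglongrightarrow> e_inf b"
  unfolding e_inf_def using rpoch_tendsto[of b b "- k"] by simp

text \<open>For fixed j the factor \<open>e 2 (M - j)\<close> tends to \<open>e_inf 2\<close>, and
  the order of \<open>w j\<close> supplies the majorant.\<close>

lemma convolution_tendsto: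
  assumes "\<And>j. fps_X ^ j dvd w j"
  shows "(\<lambda>M. \<Sum>j\<le>M. w j * e 2 (int M - int j)) \<longlonglongrightarrow> e_inf 2 * infsum w UNIV"
proof -
  have "(\<lambda>M. \<Sum>j\<le>M. w j * e 2 (int M - int j)) \<longlonglongrightarrow> infsum (\<lambda>j. w j * e_inf 2) UNIV"
    by (rule fps_tannery_nat) (use assms in \<open>auto intro!: fps_tendsto_cmult e_diff_tendsto dvd_mult2\<close>)
  then show ?thesis using fps_infsum_cmult[of w "e_inf 2"] assms by (simp add: mult.commute)
qed

lemma euler_mult_nth: "fps_nth (euler * G) M = (\<Sum>k\<le>M. fps_nth G k * e 2 (int M - int k))"
proof -
  have "fps_nth (euler * G) M = fps_nth (G * euler) M" by (simp add: mult.commute)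
  also have "\<dots> = (\<Sum>k\<le>M. fps_nth G k * e 2 (int M - int k))"
    by (simp add: fps_mult_nth atLeast0AtMost euler_def of_nat_diff cong: sum.cong_simp)
  finally show ?thesis .
qed

lemma gf_dvd:
  assumes "\<And>ys x. ys \<in> S \<Longrightarrow> x \<in> set ys \<Longrightarrow> 0 < x"
  shows "fps_X ^ k dvd fps_nth (gf S) k"
proof -
  have "length ys \<le> sum_list ys" if "ys \<in> S" for ys
  proof -
    have "\<forall>x\<in>set ys. 0 < x" using assms that by blast
    then show ?thesis by (induction ys) auto
  qed
  then have "{ys \<in> S. length ys = k \<and> sum_list ys = i} = {}" if "i < k" for i
    using that by force
  then show ?thesis unfolding X_power_dvd_iff gf_nth by (metis card.empty of_nat_0)
qed

lemma gf_rev: "gf (rev ` S) = gf S"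
proof (intro fps_ext)
  fix M n
  have "{ys \<in> rev ` S. length ys = M \<and> sum_list ys = n} = rev ` {ys \<in> S. length ys = M \<and> sum_list ys = n}"
    by auto
  then show "fps_nth (fps_nth (gf (rev ` S)) M) n = fps_nth (fps_nth (gf S) M) n"
    by (simp add: gf_nth card_image)
qed

text \<open>Positive parts make the length at most the size, so each size is attained finitely
  often. Summation by length and summation by size can then be compared one coefficient at a
  time.\<close>

lemma partitions_has_sum:
  assumes pos: "\<And>ys x. ys \<in> S \<Longrightarrow> x \<in> set ys \<Longrightarrow> 0 < x"
  shows "((\<lambda>ys. q ^ sum_list ys) has_sum infsum (fps_nth (gf S)) UNIV) S"
proof -
  have len: "length ys \<le> sum_list ys" if "ys \<in> S" for ys
  proof -
    have "\<forall>x\<in>set ys. 0 < x" using assms that by blast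
    then show ?thesis by (induction ys) auto
  qed
  define B where "B n = {ys \<in> S. sum_list ys < n}" for n
  have "B n \<subseteq> (\<Union>M<n. \<Union>m<n. {ys \<in> S. length ys = M \<and> sum_list ys = m})" for n
    using len by (force simp: B_def)
  then have fin: "finite (B n)" for n
    by (rule finite_subset) (intro finite_UN_I finite_lessThan finite_lists_length_sum)
  have dvd: "fps_X ^ sum_list ys dvd q ^ sum_list ys" for ys by simp
  have hs: "((\<lambda>ys. q ^ sum_list ys) has_sum infsum (\<lambda>ys. q ^ sum_list ys) S) S"
    by (rule fps_has_sum_infsum[where w = sum_list]) (use fin in \<open>auto simp: B_def\<close>)
  have "(\<lambda>L. \<Sum>ys\<in>B L. q ^ sum_list ys) \<longlonglongrightarrow> infsum (\<lambda>ys. q ^ sum_list ys) S"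
    by (rule fps_sum_tendsto_infsum[where w = sum_list])
      (use fin in \<open>auto simp: B_def intro: eventually_gt_at_top\<close>)
  moreover have "(\<lambda>L. \<Sum>ys\<in>B L. q ^ sum_list ys) \<longlonglongrightarrow> infsum (fps_nth (gf S)) UNIV"
    unfolding tendsto_fps_iff
  proof
    fix n
    have "(\<lambda>L. \<Sum>k\<le>L. fps_nth (gf S) k) \<longlonglongrightarrow> infsum (fps_nth (gf S)) UNIV"
      by (rule fps_sum_tendsto_nat) (rule gf_dvd[OF pos])
    then have "\<forall>\<^sub>F L in sequentially. fps_nth (\<Sum>k\<le>L. fps_nth (gf S) k) n = fps_nth (infsum (fps_nth (gf S)) UNIV) n"
      by (simp add: tendsto_fps_iff)
    moreover have "\<forall>\<^sub>F L in sequentially. n < L" by (rule eventually_gt_at_top)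
    ultimately show "\<forall>\<^sub>F L in sequentially. fps_nth (\<Sum>ys\<in>B L. q ^ sum_list ys) n = fps_nth (infsum (fps_nth (gf S)) UNIV) n"
    proof eventually_elim
      case (elim L)
      let ?C = "{ys \<in> S. sum_list ys = n}"
      have C: "?C = (\<Union>k\<le>L. {ys \<in> S. length ys = k \<and> sum_list ys = n})"
        using len elim by force
      have "fps_nth (\<Sum>ys\<in>B L. q ^ sum_list ys) n = (\<Sum>ys\<in>B L. if sum_list ys = n then 1 else 0)"
        by (simp add: fps_sum_nth eq_commute)
      also have "\<dots> = of_nat (card {ys \<in> B L. sum_list ys = n})"
        using fin by (simp add: sum.If_cases Int_def)
      also have "{ys \<in> B L. sum_list ys = n} = ?C" using elim by (auto simp: B_def)
      also have "card ?C = (\<Sum>k\<le>L. card {ys \<in> S. length ys = k \<and> sum_list ys = n})"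
        unfolding C by (rule card_UN_disjoint) (auto intro: finite_lists_length_sum)
      finally show ?case using elim by (simp add: fps_sum_nth gf_nth)
    qed
  qed
  ultimately have "infsum (\<lambda>ys. q ^ sum_list ys) S = infsum (fps_nth (gf S)) UNIV"
    by (rule LIMSEQ_unique)
  with hs show ?thesis by simp
qed

lemma e_inf_mult: "0 < b \<Longrightarrow> e_inf b * qpoch (q ^ b) (q ^ b) \<infinity> = 1"
proof -
  assume "0 < b"
  then have "fps_nth (qpoch (q ^ b) (q ^ b) \<infinity>) 0 = 1" by (intro qpoch_inf_nth_0) simp_all
  then show ?thesis unfolding e_inf_def by (intro inverse_mult_eq_1) simp
qed

lemma e_inf_nonzero: "0 < b \<Longrightarrow> e_inf b \<noteq> 0"
  using e_inf_mult[of b] by (metis mult_zero_left zero_neq_one)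

text \<open>Both sides of \<open>eq\<close> converge as M grows, the left one to
  \<open>e_inf 2\<close> times the wanted sum over all lengths. Cancelling the nonzero
  \<open>e_inf 2\<close> replaces the evaluation at x = 1.\<close>

lemma infsum_gf:
  assumes pos: "\<And>ys x. ys \<in> S \<Longrightarrow> x \<in> set ys \<Longrightarrow> 0 < x"
    and w: "\<And>j. fps_X ^ j dvd w j"
    and eq: "\<And>M. fps_nth (euler * gf S) (Suc M) = qplus (r (Suc M)) * (\<Sum>j\<le>Suc M. w j * e 2 (int (Suc M) - int j))"
    and r: "filterlim r sequentially sequentially"
  shows "infsum (fps_nth (gf S)) UNIV = qplus_inf * infsum w UNIV"
proof -
  have "(\<lambda>M. fps_nth (euler * gf S) M) \<longlonglongrightarrow> e_inf 2 * infsum (fps_nth (gf S)) UNIV"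
    unfolding euler_mult_nth by (rule convolution_tendsto[OF gf_dvd[OF pos]])
  then have "(\<lambda>M. fps_nth (euler * gf S) (Suc M)) \<longlonglongrightarrow> e_inf 2 * infsum (fps_nth (gf S)) UNIV"
    by (rule LIMSEQ_Suc)
  moreover have "(\<lambda>M. qplus (r M) * (\<Sum>j\<le>M. w j * e 2 (int M - int j))) \<longlonglongrightarrow> qplus_inf * (e_inf 2 * infsum w UNIV)"
    by (intro fps_tendsto_mult convolution_tendsto w filterlim_compose[OF qplus_tendsto r])
  then have "(\<lambda>M. qplus (r (Suc M)) * (\<Sum>j\<le>Suc M. w j * e 2 (int (Suc M) - int j))) \<longlonglongrightarrow> qplus_inf * (e_inf 2 * infsum w UNIV)"
    by (rule LIMSEQ_Suc)
  ultimately have "e_inf 2 * infsum (fps_nth (gf S)) UNIV = qplus_inf * (e_inf 2 * infsum w UNIV)"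
    unfolding eq by (rule LIMSEQ_unique)
  then have "e_inf 2 * infsum (fps_nth (gf S)) UNIV = e_inf 2 * (qplus_inf * infsum w UNIV)" by (simp only: ac_simps)
  then show ?thesis using e_inf_nonzero[of 2] by (simp only: mult_cancel_left) simp
qed

text \<open>The j-summand left from the first double sum.\<close>

definition v :: "nat \<Rightarrow> rat fps" where
  "v j = (-1) ^ j * q ^ j^2 * e 2 (int j) * inverse (qplus (2 * j))"

lemma u_eq: "u j * (1 + q ^ (2 * j + 1)) = (-1) ^ j * q ^ (j^2 + 2 * j) * e 2 (int j) * inverse (qplus (2 * j))"
  unfolding u_def using inverse_qplus_Suc[of "2 * j"] by (simp add: mult.assoc)

lemma v_u: "q ^ (2 * j) * v j = u j * (1 + q ^ (2 * j + 1))"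
  unfolding u_eq unfolding v_def power_add by (simp only: ac_simps)

lemma dvd_q_power: "k \<le> n \<Longrightarrow> fps_X ^ k dvd a * q ^ n * b"
  by (rule dvd_mult2, rule dvd_mult, rule le_imp_power_dvd)

lemma u_dvd: "fps_X ^ j dvd u j"
  unfolding u_def by (rule dvd_mult2, rule dvd_q_power) simp

lemma v_dvd: "fps_X ^ j dvd v j"
  unfolding v_def by (rule dvd_mult2, rule dvd_q_power) (simp add: power2_eq_square)

lemma u_dvd': "fps_X ^ j dvd u j * (1 + q ^ (2 * j + 1))"
  by (rule dvd_mult2[OF u_dvd])

text \<open>By the first relation of \<open>hat_rec\<close> the coefficient is a difference of
  consecutive values of \<open>omega\<close>. Termwise this difference gives q^(2(m+1-j)), and the
  weight of \<open>omega\<close> is q^(2j) \<open>v j\<close>, so the common power q^(2m+2)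
  cancels.\<close>

lemma hat_explicit_V:
  "fps_nth (euler * gf (lang Free 2)) (Suc m) = qplus (2 * Suc m) * (\<Sum>j\<le>Suc m. v j * e 2 (int (Suc m) - int j))"
proof -
  define a where "a = fps_nth (euler * gf (lang Armed 1))"
  define V where "V = fps_nth (euler * gf (lang Free 2))"
  have a: "a k = qplus (2 * k + 1) * alpha k" for k using hat_explicit[of k] by (simp add: a_def)
  have "q ^ (2 * m + 2) * V (Suc m) = a (Suc m) - (1 + q ^ (2 * m + 2)) * a m"
    unfolding a_def V_def by (rule hat_rec(1)[OF refl refl refl refl])
  also have "\<dots> = qplus (2 * Suc m) * ((1 + q ^ (2 * m + 3)) * alpha (Suc m) - alpha m)"
  proof -
    have "qplus (2 * Suc m) = qplus (2 * m + 1) * (1 + q ^ (2 * m + 2))" using qplus_Suc[of "2 * m + 1"] by simp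
    moreover have "qplus (2 * Suc m + 1) = qplus (2 * Suc m) * (1 + q ^ (2 * m + 3))"
      using qplus_Suc[of "2 * m + 2"] by (simp add: eval_nat_numeral)
    ultimately show ?thesis unfolding a by (simp add: algebra_simps)
  qed
  also have "(1 + q ^ (2 * m + 3)) * alpha (Suc m) - alpha m = omega (Suc m) - omega m"
    unfolding omega_Suc by (simp add: algebra_simps)
  also have "omega (Suc m) - omega m = (\<Sum>j\<le>Suc m. u j * (1 + q ^ (2 * j + 1)) *
     (e 2 (int (Suc m) - int j) - e 2 (int (Suc m) - 1 - int j)))"
  proof -
    have omega: "omega m = (\<Sum>j\<le>Suc m. u j * (1 + q ^ (2 * j + 1)) * e 2 (int (Suc m) - 1 - int j))"
      unfolding omega_def by (simp add: algebra_simps)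
    show ?thesis unfolding omega by (simp only: omega_def sum_subtractf[symmetric] right_diff_distrib)
  qed
  also have "\<dots> = (\<Sum>j\<le>Suc m. q ^ (2 * m + 2) * (v j * e 2 (int (Suc m) - int j)))"
  proof (rule sum.cong[OF refl])
    fix j assume "j \<in> {..Suc m}"
    then have j: "j \<le> Suc m" by simp
    have "e 2 (int (Suc m) - 1 - int j) = e 2 (int (Suc m) - int j - 1)" by (simp add: algebra_simps)
    also have "\<dots> = (1 - q ^ (2 * nat (int (Suc m) - int j))) * e 2 (int (Suc m) - int j)"
      by (rule e_pred) simp
    also have "nat (int (Suc m) - int j) = Suc m - j" using j by simp
    finally have "e 2 (int (Suc m) - int j) - e 2 (int (Suc m) - 1 - int j) = q ^ (2 * (Suc m - j)) * e 2 (int (Suc m) - int j)"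
      by (simp add: algebra_simps)
    moreover have "q ^ (2 * m + 2) = q ^ (2 * (Suc m - j)) * q ^ (2 * j)"
      by (simp only: power_add[symmetric], rule power_cong_exp) (use j in simp)
    ultimately show "u j * (1 + q ^ (2 * j + 1)) * (e 2 (int (Suc m) - int j) - e 2 (int (Suc m) - 1 - int j)) =
      q ^ (2 * m + 2) * (v j * e 2 (int (Suc m) - int j))"
      unfolding v_u[symmetric] by (simp only: ac_simps)
  qed
  finally have "q ^ (2 * m + 2) * V (Suc m) =
    q ^ (2 * m + 2) * (qplus (2 * Suc m) * (\<Sum>j\<le>Suc m. v j * e 2 (int (Suc m) - int j)))"
    unfolding sum_distrib_left[symmetric] by (simp only: ac_simps)
  then show ?thesis unfolding V_def by (simp only: mult_cancel_left) simp
qed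

text \<open>For r > 0 the bound of \<open>accepts_ge\<close> suffices; the start
  \<open>Single\<close> with r = 0 needs the strict inequality imposed on its first part.\<close>

lemma lang_pos: "ys \<in> lang s r \<Longrightarrow> 0 < r \<or> s = Single \<Longrightarrow> s \<noteq> Doublable \<Longrightarrow> x \<in> set ys \<Longrightarrow> 0 < x"
proof -
  assume ys: "ys \<in> lang s r" "s \<noteq> Doublable" "x \<in> set ys" and "0 < r \<or> s = Single"
  then have "r \<le> x" using accepts_ge[of s r ys x] by (simp add: lang_def)
  moreover have "0 < x" if "s = Single"
  proof -
    obtain a as where "ys = a # as" using ys by (cases ys) auto
    then have "0 < a" "x = a \<or> x \<in> set as" using ys that by (auto simp: lang_def)
    moreover have "a + 1 \<le> x + 1" if "x \<in> set as"
      using accepts_ge[of _ "a + 1" as x] ys \<open>ys = a # as\<close> that \<open>s = Single\<close> by (auto simp: lang_def split: if_splits)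
    ultimately show ?thesis by auto
  qed
  ultimately show ?thesis using \<open>0 < r \<or> s = Single\<close> by auto
qed

lemma setN_has_sum:
  shows "((\<lambda>xs. q ^ sum_list xs) has_sum qplus_inf * infsum v UNIV) setN1"
    and "((\<lambda>xs. q ^ sum_list xs) has_sum qplus_inf * infsum (\<lambda>j. u j * (1 + q ^ (2 * j + 1))) UNIV) setN2"
    and "((\<lambda>xs. q ^ sum_list xs) has_sum qplus_inf * infsum u UNIV) setN3"
proof -
  have lim: "filterlim (\<lambda>M. 2 * M + k) sequentially sequentially" for k :: nat
    by (rule filterlim_subseq) (auto simp: strict_mono_def)
  have main: "((\<lambda>xs. q ^ sum_list xs) has_sum infsum (fps_nth (gf (lang s r))) UNIV) S"
    if S: "\<And>xs. xs \<in> S \<longleftrightarrow> accepts s r (rev xs)" and s: "0 < r \<or> s = Single" "s \<noteq> Doublable" for S s r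
  proof -
    have r: "rev ` S = lang s r"
    proof (intro equalityI subsetI)
      fix x assume "x \<in> lang s r"
      then have "rev x \<in> S" unfolding S by (simp add: lang_def)
      then show "x \<in> rev ` S" by (metis image_eqI rev_rev_ident)
    qed (auto simp: S lang_def)
    have "0 < x" if "ys \<in> S" "x \<in> set ys" for ys x
      using lang_pos[of "rev ys" s r x] that s by (auto simp: S lang_def)
    then have "((\<lambda>xs. q ^ sum_list xs) has_sum infsum (fps_nth (gf S)) UNIV) S"
      by (rule partitions_has_sum)
    then show ?thesis using gf_rev[of S] r by simp
  qed
  have "infsum (fps_nth (gf (lang Free 2))) UNIV = qplus_inf * infsum v UNIV"
    by (rule infsum_gf[where r = "\<lambda>M. 2 * M + 0"])
      (use lang_pos[of _ Free 2] v_dvd lim[of 0] hat_explicit_V in auto)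
  with main[OF setN1_iff] show "((\<lambda>xs. q ^ sum_list xs) has_sum qplus_inf * infsum v UNIV) setN1" by simp
  have "infsum (fps_nth (gf (lang Single 0))) UNIV = qplus_inf * infsum (\<lambda>j. u j * (1 + q ^ (2 * j + 1))) UNIV"
    by (rule infsum_gf[where r = "\<lambda>M. 2 * M + 0"])
      (use lang_pos[of _ Single 0] u_dvd' lim[of 0] hat_explicit in \<open>auto simp: omega_def\<close>)
  with main[OF setN2_iff] show "((\<lambda>xs. q ^ sum_list xs) has_sum qplus_inf * infsum (\<lambda>j. u j * (1 + q ^ (2 * j + 1))) UNIV) setN2"
    by simp
  have "infsum (fps_nth (gf (lang Armed 1))) UNIV = qplus_inf * infsum u UNIV"
    by (rule infsum_gf[where r = "\<lambda>M. 2 * M + 1"])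
      (use lang_pos[of _ Armed 1] u_dvd lim[of 1] hat_explicit in \<open>auto simp: alpha_def\<close>)
  with main[OF setN3_iff] show "((\<lambda>xs. q ^ sum_list xs) has_sum qplus_inf * infsum u UNIV) setN3" by simp
qed

section \<open>The double sums\<close>

text \<open>Terms of Euler's series for (-q^m; q)_inf.\<close>

definition euler_term :: "nat \<Rightarrow> nat \<Rightarrow> rat fps" where
  "euler_term m i = q ^ ((i choose 2) + m * i) * e 1 (int i)"

lemma euler_term_dvd: "0 < m \<Longrightarrow> fps_X ^ i dvd euler_term m i"
  unfolding euler_term_def using dvd_q_power[of i "(i choose 2) + m * i" 1] by (simp add: trans_le_add2)

text \<open>Write 1 = q^i + (1 - q^i) in the i-th term: the first piece raises m by one, and the
  second cancels a factor of the denominator, after which an index shift gives the same series times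
  q^m.\<close>

lemma euler_term_rec: "0 < m \<Longrightarrow> infsum (euler_term m) UNIV = (1 + q ^ m) * infsum (euler_term (Suc m)) UNIV"
proof -
  assume m: "0 < m"
  define g where "g i = q ^ ((i choose 2) + m * i) * (1 - q ^ i) * e 1 (int i)" for i
  have "euler_term m = (\<lambda>i. euler_term (Suc m) i + g i)"
    by (rule ext) (simp add: euler_term_def g_def power_add algebra_simps)
  then have "infsum (euler_term m) UNIV = infsum (euler_term (Suc m)) UNIV + infsum g UNIV"
    using m by (simp only:) (intro fps_infsum_add, simp add: euler_term_dvd, unfold g_def mult.assoc,
      rule dvd_mult2, rule le_imp_power_dvd, simp add: trans_le_add2)
  also have "infsum g UNIV = q ^ m * infsum (euler_term (Suc m)) UNIV"
  proof (rule infsum_fps_shift_zero)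
    show "fps_X ^ i dvd euler_term (Suc m) i" for i by (simp add: euler_term_dvd)
    show "fps_X ^ i dvd g i" for i
      unfolding g_def mult.assoc using m by (intro dvd_mult2 le_imp_power_dvd) (simp add: trans_le_add2)
    show "g 0 = 0" by (simp add: g_def)
    fix i
    have "(1 - q ^ Suc i) * e 1 (int (Suc i)) = e 1 (int i)" using e_Suc[of 1 i] by simp
    moreover have "q ^ ((Suc i choose 2) + m * Suc i) = q ^ m * q ^ ((i choose 2) + Suc m * i)"
      by (simp only: power_add[symmetric], rule power_cong_exp) (simp add: numeral_2_eq_2)
    ultimately show "g (Suc i) = q ^ m * euler_term (Suc m) i"
      unfolding g_def euler_term_def by (simp only: mult.assoc)
  qed
  finally show ?thesis by (simp add: algebra_simps)
qed

text \<open>By the recurrence, \<open>qplus k\<close> times the sum for m = k + 1 does not depend on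
  k. As k grows that sum tends to 1, which identifies the constant as
  \<open>qplus_inf\<close>.\<close>

lemma euler_term_sum: "infsum (euler_term (Suc k)) UNIV = qplus_inf * inverse (qplus k)"
proof -
  have const: "qplus k * infsum (euler_term (Suc k)) UNIV = infsum (euler_term 1) UNIV" for k
  proof (induction k)
    case (Suc k)
    then show ?case using euler_term_rec[of "Suc k"] by (simp add: qplus_Suc ac_simps)
  qed simp
  have "(\<lambda>k. qplus k * infsum (euler_term (Suc k)) UNIV) \<longlonglongrightarrow> qplus_inf * 1"
  proof (intro fps_tendsto_mult qplus_tendsto)
    have "fps_X ^ Suc k dvd infsum (euler_term (Suc k)) UNIV - 1" for k
    proof (rule fps_dvd_limit)
      show "(\<lambda>L. (\<Sum>i\<le>L. euler_term (Suc k) i) - 1) \<longlonglongrightarrow> infsum (euler_term (Suc k)) UNIV - 1"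
        by (intro fps_tendsto_diff fps_sum_tendsto_nat euler_term_dvd) auto
      fix L
      have "euler_term (Suc k) 0 = 1" by (simp add: euler_term_def binomial_eq_0)
      then have "(\<Sum>i\<le>L. euler_term (Suc k) i) - 1 = (\<Sum>i<L. euler_term (Suc k) (Suc i))"
        by (simp add: lessThan_Suc_atMost[symmetric] sum.lessThan_Suc_shift del: sum.lessThan_Suc)
      also have "fps_X ^ Suc k dvd \<dots>"
        unfolding euler_term_def by (intro dvd_sum dvd_mult2 le_imp_power_dvd) (simp add: trans_le_add2)
      finally show "fps_X ^ Suc k dvd (\<Sum>i\<le>L. euler_term (Suc k) i) - 1" .
    qed
    then have *: "fps_X ^ n dvd infsum (euler_term (Suc k)) UNIV - 1" if "n \<le> k" for n k
      using that by (meson dvd_trans le_SucI le_imp_power_dvd)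
    show "(\<lambda>k. infsum (euler_term (Suc k)) UNIV) \<longlonglongrightarrow> 1"
      unfolding fps_tendsto_iff_dvd eventually_sequentially
    proof
      fix n
      show "\<exists>N. \<forall>k\<ge>N. fps_X ^ n dvd infsum (euler_term (Suc k)) UNIV - 1"
        by (rule exI[of _ n]) (use * in blast)
    qed
  qed
  then have "infsum (euler_term 1) UNIV = qplus_inf" unfolding const by (simp add: LIMSEQ_const_iff)
  with const[of k] have 1: "qplus k * infsum (euler_term (Suc k)) UNIV = qplus_inf" by simp
  have "infsum (euler_term (Suc k)) UNIV = inverse (qplus k) * (qplus k * infsum (euler_term (Suc k)) UNIV)"
    by (simp add: qplus_inverse mult.assoc[symmetric])
  then show ?thesis unfolding 1 by (simp only: mult.commute)
qed

lemma qpoch_fin_inverse: "inverse (qpoch (q ^ b) (q ^ b) (enat n)) = e b (int n)"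
  by (simp add: qpoch_def rpoch_def power_add power_mult)

lemma double_sum_term_eq:
  "double_sum_term A i j = (-1) ^ j * q ^ ((i choose 2) + 2 * (j choose 2) + 2 * i * j + A i j) * e 1 (int i) * e 2 (int j)"
proof -
  have "fps_nth (qpoch (q ^ b) (q ^ b) (enat n)) 0 = 1" if "0 < b" for b n
    using that by (simp add: qpoch_def fps_prod_nth_0 fps_power_zeroth zero_power)
  from this[of 1] this[of 2]
  have "fps_nth (qpoch q q (enat i) * qpoch (q ^ 2) (q ^ 2) (enat j)) 0 \<noteq> 0" by simp
  then show ?thesis unfolding double_sum_term_def
    using qpoch_fin_inverse[of 1 i] qpoch_fin_inverse[of 2 j]
    by (simp add: fps_divide_unit fps_inverse_mult mult.assoc)
qed

text \<open>The cross term 2ij joins the part of the exponent that is linear in i, so for fixed j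
  the sum over i is Euler's series with m = 2j + s.\<close>

lemma double_sum:
  assumes s: "s = Suc s'" and t: "0 < t"
  shows "((\<lambda>(i, j). double_sum_term (\<lambda>i j. s * i + t * j) i j) has_sum
    qplus_inf * infsum (\<lambda>j. (-1) ^ j * q ^ (2 * (j choose 2) + t * j) * e 2 (int j) * inverse (qplus (2 * j + s'))) UNIV) UNIV"
proof -
  define f where "f = (\<lambda>(i, j). double_sum_term (\<lambda>i j. s * i + t * j) i j)"
  define c where "c j = (-1) ^ j * q ^ (2 * (j choose 2) + t * j) * e 2 (int j)" for j
  have f: "f (i, j) = c j * euler_term (Suc (2 * j + s')) i" for i j
  proof -
    have "q ^ ((i choose 2) + 2 * (j choose 2) + 2 * i * j + (s * i + t * j)) =
      q ^ (2 * (j choose 2) + t * j) * q ^ ((i choose 2) + Suc (2 * j + s') * i)"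
      by (simp only: power_add[symmetric], rule power_cong_exp) (simp add: s algebra_simps)
    then show ?thesis unfolding f_def prod.case double_sum_term_eq c_def euler_term_def by (simp only: ac_simps)
  qed
  have fin: "finite {i \<in> UNIV. fst i + snd i < n}" for n :: nat
    by (rule finite_subset[of _ "{..n} \<times> {..n}"]) auto
  have dvdc: "fps_X ^ j dvd c j" for j unfolding c_def
    by (rule dvd_q_power) (use t in \<open>simp add: trans_le_add2\<close>)
  have dvd: "fps_X ^ (fst i + snd i) dvd f i" for i
    unfolding f[of "fst i" "snd i", unfolded prod.collapse] power_add
    by (subst mult.commute) (intro mult_dvd_mono dvdc euler_term_dvd; simp)
  have hs: "(f has_sum infsum f UNIV) UNIV"
    by (rule fps_has_sum_infsum[where w = "\<lambda>i. fst i + snd i"]) (use fin dvd in auto)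
  have "(\<lambda>L. \<Sum>i\<in>{..L} \<times> {..L}. f i) \<longlonglongrightarrow> infsum f UNIV"
  proof (rule fps_sum_tendsto_infsum[where w = "\<lambda>i. fst i + snd i"])
    fix i :: "nat \<times> nat"
    show "\<forall>\<^sub>F L in sequentially. i \<in> {..L} \<times> {..L}"
      unfolding eventually_sequentially by (rule exI[of _ "max (fst i) (snd i)"]) (cases i; auto)
  qed (use fin dvd in auto)
  moreover have "(\<Sum>i\<in>{..L} \<times> {..L}. f i) = (\<Sum>j\<le>L. c j * (\<Sum>i\<le>L. euler_term (Suc (2 * j + s')) i))" for L
  proof -
    have "(\<Sum>i\<in>{..L} \<times> {..L}. f i) = (\<Sum>i\<le>L. \<Sum>j\<le>L. f (i, j))"
      by (subst sum.cartesian_product) simp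
    also have "\<dots> = (\<Sum>j\<le>L. \<Sum>i\<le>L. f (i, j))" by (rule sum.swap)
    finally show ?thesis by (simp only: f sum_distrib_left)
  qed
  \<comment> \<open>The truncation by j \<le> L changes no sum; it provides the vanishing beyond L
    that \<open>fps_tannery_nat\<close> asks for.\<close>
  moreover have "(\<lambda>L. \<Sum>j\<le>L. if j \<le> L then c j * (\<Sum>i\<le>L. euler_term (Suc (2 * j + s')) i) else 0)
      \<longlonglongrightarrow> infsum (\<lambda>j. c j * infsum (euler_term (Suc (2 * j + s'))) UNIV) UNIV"
  proof (rule fps_tannery_nat)
    show "fps_X ^ j dvd (if j \<le> L then c j * (\<Sum>i\<le>L. euler_term (Suc (2 * j + s')) i) else 0)" for L j
      using dvdc by (auto intro: dvd_mult2)
    fix j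
    show "(\<lambda>L. if j \<le> L then c j * (\<Sum>i\<le>L. euler_term (Suc (2 * j + s')) i) else 0)
        \<longlonglongrightarrow> c j * infsum (euler_term (Suc (2 * j + s'))) UNIV"
    proof (rule Lim_transform_eventually)
      show "(\<lambda>L. c j * (\<Sum>i\<le>L. euler_term (Suc (2 * j + s')) i)) \<longlonglongrightarrow> c j * infsum (euler_term (Suc (2 * j + s'))) UNIV"
        by (intro fps_tendsto_cmult fps_sum_tendsto_nat euler_term_dvd) simp
      show "\<forall>\<^sub>F L in sequentially. c j * (\<Sum>i\<le>L. euler_term (Suc (2 * j + s')) i) =
        (if j \<le> L then c j * (\<Sum>i\<le>L. euler_term (Suc (2 * j + s')) i) else 0)"
        unfolding eventually_sequentially by (rule exI[of _ j]) simp
    qed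
  qed simp
  ultimately have "infsum f UNIV = infsum (\<lambda>j. c j * infsum (euler_term (Suc (2 * j + s'))) UNIV) UNIV"
    by (intro LIMSEQ_unique[of "\<lambda>L. \<Sum>j\<le>L. c j * (\<Sum>i\<le>L. euler_term (Suc (2 * j + s')) i)"]) (simp_all cong: sum.cong_simp)
  also have "\<dots> = infsum (\<lambda>j. qplus_inf * (c j * inverse (qplus (2 * j + s')))) UNIV"
    unfolding euler_term_sum by (simp only: ac_simps)
  also have "\<dots> = qplus_inf * infsum (\<lambda>j. c j * inverse (qplus (2 * j + s'))) UNIV"
    by (rule fps_infsum_cmult) (rule dvd_mult2[OF dvdc])
  finally show ?thesis using hs unfolding f_def c_def by simp
qed

lemma two_choose_two: "2 * (j choose 2) + j = j^2"
  by (induction j) (simp_all add: numeral_2_eq_2)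

lemma double_sums_has_sum:
  shows "((\<lambda>(i, j). double_sum_term (\<lambda>i j. i + j) i j) has_sum qplus_inf * infsum v UNIV) UNIV"
    and "((\<lambda>(i, j). double_sum_term (\<lambda>i j. i + 3 * j) i j) has_sum qplus_inf * infsum (\<lambda>j. u j * (1 + q ^ (2 * j + 1))) UNIV) UNIV"
    and "((\<lambda>(i, j). double_sum_term (\<lambda>i j. 2 * i + 3 * j) i j) has_sum qplus_inf * infsum u UNIV) UNIV"
proof -
  have 1: "2 * (j choose 2) + 1 * j = j^2" "2 * (j choose 2) + 3 * j = j^2 + 2 * j" for j
    using two_choose_two[of j] by linarith+
  show "((\<lambda>(i, j). double_sum_term (\<lambda>i j. i + j) i j) has_sum qplus_inf * infsum v UNIV) UNIV"
    using double_sum[of 1 0 1] unfolding 1 by (simp add: v_def[abs_def])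
  show "((\<lambda>(i, j). double_sum_term (\<lambda>i j. i + 3 * j) i j) has_sum qplus_inf * infsum (\<lambda>j. u j * (1 + q ^ (2 * j + 1))) UNIV) UNIV"
    using double_sum[of 1 0 3] unfolding 1 u_eq by simp
  show "((\<lambda>(i, j). double_sum_term (\<lambda>i j. 2 * i + 3 * j) i j) has_sum qplus_inf * infsum u UNIV) UNIV"
    using double_sum[of 2 1 3] unfolding 1 by (simp add: u_def[abs_def])
qed

section \<open>A Bailey pair and the quintuple product\<close>

lemma sum_int_telescope:
  fixes G :: "int \<Rightarrow> 'a :: ab_group_add" and L :: nat
  shows "(\<Sum>r\<in>{- int L..int L}. G (r + 1) - G r) = G (int L + 1) - G (- int L)"
proof (induction L)
  case (Suc L)
  have "{- int (Suc L)..int (Suc L)} = insert (- 1 - int L) (insert (1 + int L) {- int L..int L})" by auto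
  then show ?case using Suc by (simp add: algebra_simps)
qed simp

text \<open>The core of the telescoping below, with a = x^(n-3r) and b = x^(n+s+3r). Three factors
  in a and three in b appear because r -> r + 1 moves each argument of E by 3.\<close>

lemma bailey_poly:
  fixes x a b :: "'a :: comm_ring_1"
  shows "(a - b) * ((1 - a * b) * (1 - a * b * x) - (1 - x * a) * (1 - x * b)) =
    - (b^2 * ((x - a) * (1 - a) * (1 - x * a))) + a^2 * ((x - b) * (1 - b) * (1 - b * x))"
  by (simp add: algebra_simps power2_eq_square)

lemma bailey_step:
  fixes x a b :: "'a :: field"
  assumes "x \<noteq> 0" "a \<noteq> 0"
  shows "(1 - b / a) * ((1 - a * b) * (1 - a * b * x) - (1 - x * a) * (1 - x * b)) =
    - (x * b^2 / a) * ((1 - a / x) * (1 - a) * (1 - x * a)) + x * a * ((1 - b / x) * (1 - b) * (1 - b * x))"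
proof -
  have "1 - b / a = (a - b) / a" using assms by (simp add: field_simps)
  then have "(1 - b / a) * ((1 - a * b) * (1 - a * b * x) - (1 - x * a) * (1 - x * b)) =
    ((a - b) * ((1 - a * b) * (1 - a * b * x) - (1 - x * a) * (1 - x * b))) / a" by simp
  also have "\<dots> = - (b^2 * ((x - a) * (1 - a) * (1 - x * a))) / a + a^2 * ((x - b) * (1 - b) * (1 - b * x)) / a"
    unfolding bailey_poly by (simp only: add_divide_distrib)
  also have "a^2 * ((x - b) * (1 - b) * (1 - b * x)) / a = a * ((x - b) * (1 - b) * (1 - b * x))"
    using assms by (simp add: power2_eq_square)
  also have "x - b = x * (1 - b / x)" using assms by (simp add: field_simps)
  also have "x - a = x * (1 - a / x)" using assms by (simp add: field_simps)
  finally show ?thesis by (simp only: ac_simps times_divide_eq_right times_divide_eq_left minus_divide_left mult_minus_left mult_minus_right)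
qed

text \<open>
  A Bailey pair for \<open>E j = 1 / (x; x)\<^sub>j\<close>, proved by telescoping; \<open>L\<close> only has to exceed the range in
  which the summand is nonzero.
\<close>

lemma bailey_field:
  fixes x :: "'a :: field" and E :: "int \<Rightarrow> 'a" and s :: int and n L :: nat
  assumes x: "x \<noteq> 0" and x_neq: "\<And>m. 0 < m \<Longrightarrow> x powi m \<noteq> 1"
    and E_neg: "\<And>m. m < 0 \<Longrightarrow> E m = 0" and E_0: "E 0 = 1"
    and E_rec: "\<And>m. E (m - 1) = (1 - x powi m) * E m"
    and s: "s = 1 \<or> s = 2" and L: "n \<le> L" "1 \<le> L"
  shows "(\<Sum>r\<in>{- int L..int L}. x powi (6 * r^2 + (2 * s - 3) * r) * (1 - x powi (6 * r + s)) *
           E (int n - 3 * r) * E (int n + s + 3 * r)) = E (2 * int n + s - 1)"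
  using L(1)
proof (induction n)
  case 0
  have z: "E (int 0 - 3 * r) = 0 \<or> E (int 0 + s + 3 * r) = 0" if "r \<noteq> 0" for r
    using that s by (cases "0 < r") (auto intro!: E_neg)
  have "(\<Sum>r\<in>{- int L..int L}. x powi (6 * r^2 + (2 * s - 3) * r) * (1 - x powi (6 * r + s)) *
      E (int 0 - 3 * r) * E (int 0 + s + 3 * r)) =
    (\<Sum>r\<in>{0}. x powi (6 * r^2 + (2 * s - 3) * r) * (1 - x powi (6 * r + s)) *
      E (int 0 - 3 * r) * E (int 0 + s + 3 * r))"
    using z by (intro sum.mono_neutral_right) auto
  also have "\<dots> = E (s - 1)" by (simp add: E_0 E_rec)
  finally show ?case by simp
next
  case (Suc n)
  define W where "W r = x powi (6 * r^2 + (2 * s - 3) * r)" for r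
  define T where "T n r = W r * (1 - x powi (6 * r + s)) * E (n - 3 * r) * E (n + s + 3 * r)" for n r
  define N where "N = x powi int n"
  define S where "S = x powi s"
  \<comment> \<open>The certificate: the combination of the summands at n + 1 and n prescribed by
    the right-hand side equals \<open>G (r + 1) - G r\<close>. It vanishes at both ends of the
    range, where an argument of E is negative.\<close>
  define G where "G r = - (x powi (1 + int n + 6 * r^2 + (2 * s - 6) * r)) * E (int n + 1 - 3 * r) * E (int n + 3 * r + s - 2)" for r
  note pa = power_int_add[OF disjI1[OF x]]
  have C: "x powi (2 * int n + s) = N^2 * S" "x powi (2 * int n + s + 1) = N^2 * S * x"
  proof -
    have "2 * int n + s = int n + (int n + s)" by simp
    then show *: "x powi (2 * int n + s) = N^2 * S"
      by (simp only: pa N_def S_def power2_eq_square mult.assoc)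
    show "x powi (2 * int n + s + 1) = N^2 * S * x" by (simp only: pa[of "2 * int n + s" 1] * power_int_1_right)
  qed
  have step: "(1 - N^2 * S) * (1 - N^2 * S * x) * T (int n + 1) r - T (int n) r = G (r + 1) - G r" for r
  proof -
    define a where "a = x powi (int n - 3 * r)"
    define b where "b = x powi (int n + s + 3 * r)"
    have a: "a \<noteq> 0" using x by (simp add: a_def)
    have ab: "N^2 * S = a * b"
      unfolding C(1)[symmetric] a_def b_def pa[symmetric] by (rule arg_cong[where f = "power_int x"]) simp
    have ba: "x powi (6 * r + s) = b / a"
    proof -
      have "x powi (6 * r + s) * a = b"
        unfolding a_def b_def pa[symmetric] by (rule arg_cong[where f = "power_int x"]) simp
      then show ?thesis using a by (simp add: field_simps)
    qed
    define alpha where "alpha = E (int n + 1 - 3 * r)"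
    define be where "be = E (int n + s + 3 * r + 1)"
    have pw: "x powi (int n - 3 * r + 1) = x * a" "x powi (int n - 3 * r - 1) = a / x"
      "x powi (int n + s + 3 * r + 1) = b * x" "x powi (int n + s + 3 * r - 1) = b / x"
      unfolding a_def b_def
      by (simp_all only: pa power_int_diff[OF disjI1[OF x]] power_int_1_right mult.commute)
    have a1: "E (int n - 3 * r) = (1 - x * a) * alpha"
      using E_rec[of "int n - 3 * r + 1"] unfolding pw alpha_def by (simp add: algebra_simps)
    have a2: "E (int n - 3 * r - 1) = (1 - a) * ((1 - x * a) * alpha)"
      using E_rec[of "int n - 3 * r"] unfolding a1 a_def[symmetric] .
    have a3: "E (int n - 3 * r - 2) = (1 - a / x) * ((1 - a) * ((1 - x * a) * alpha))"
      using E_rec[of "int n - 3 * r - 1"] unfolding a2 pw by simp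
    have b1: "E (int n + s + 3 * r) = (1 - b * x) * be"
      using E_rec[of "int n + s + 3 * r + 1"] unfolding pw be_def by simp
    have b2: "E (int n + s + 3 * r - 1) = (1 - b) * ((1 - b * x) * be)"
      using E_rec[of "int n + s + 3 * r"] unfolding b_def[symmetric] b1 .
    have b3: "E (int n + s + 3 * r - 2) = (1 - b / x) * ((1 - b) * ((1 - b * x) * be))"
    proof -
      have "int n + s + 3 * r - 2 = int n + s + 3 * r - 1 - 1" by simp
      then show ?thesis by (simp only: E_rec[of "int n + s + 3 * r - 1"] pw b2)
    qed
    have G0: "G r = - (x * a) * W r * alpha * ((1 - b / x) * ((1 - b) * ((1 - b * x) * be)))"
    proof -
      have "1 + int n + 6 * r^2 + (2 * s - 6) * r = 1 + ((int n - 3 * r) + (6 * r^2 + (2 * s - 3) * r))"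
        by (simp add: algebra_simps)
      then have "x powi (1 + int n + 6 * r^2 + (2 * s - 6) * r) = x * a * W r"
        by (simp only: pa W_def a_def power_int_1_right mult.assoc)
      moreover have "E (int n + 3 * r + s - 2) = E (int n + s + 3 * r - 2)" by (simp add: algebra_simps)
      ultimately show ?thesis unfolding G_def b3 alpha_def by simp
    qed
    have G1: "G (r + 1) = - (x * b^2 / a) * W r * ((1 - a / x) * ((1 - a) * ((1 - x * a) * alpha))) * be"
    proof -
      have "(1 + int n + 6 * (r + 1)^2 + (2 * s - 6) * (r + 1)) + (int n - 3 * r) =
         1 + ((int n + s + 3 * r) + ((int n + s + 3 * r) + (6 * r^2 + (2 * s - 3) * r)))"
        by (simp add: algebra_simps power2_eq_square)
      then have "x powi (1 + int n + 6 * (r + 1)^2 + (2 * s - 6) * (r + 1)) * a = x * (b * (b * W r))"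
        by (simp only: pa[symmetric] W_def a_def b_def) (simp only: pa power_int_1_right)
      then have "x powi (1 + int n + 6 * (r + 1)^2 + (2 * s - 6) * (r + 1)) = x * b^2 / a * W r"
        using a by (simp add: field_simps power2_eq_square)
      moreover have "E (int n + 1 - 3 * (r + 1)) = E (int n - 3 * r - 2)" by (simp add: algebra_simps)
      moreover have "E (int n + 3 * (r + 1) + s - 2) = be" unfolding be_def by (simp add: algebra_simps)
      ultimately show ?thesis unfolding G_def a3 by simp
    qed
    have T1: "T (int n + 1) r = W r * (1 - b / a) * alpha * be"
      unfolding T_def ba alpha_def be_def by (simp add: algebra_simps)
    have T0: "T (int n) r = W r * (1 - b / a) * ((1 - x * a) * alpha) * ((1 - b * x) * be)"
      unfolding T_def ba a1 b1 ..
    have "(1 - N^2 * S) * (1 - N^2 * S * x) * T (int n + 1) r - T (int n) r = W r * alpha * be *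
      ((1 - b / a) * ((1 - a * b) * (1 - a * b * x) - (1 - x * a) * (1 - x * b)))"
    proof -
      have "C * (W' * p * c * d) - W' * p * (y * c) * (z * d) = W' * c * d * (p * (C - y * z))"
        for C W' p c d y z :: 'a by (simp add: algebra_simps)
      then have "(1 - a * b) * (1 - a * b * x) * (W r * (1 - b / a) * alpha * be) -
          W r * (1 - b / a) * ((1 - x * a) * alpha) * ((1 - b * x) * be) =
        W r * alpha * be * ((1 - b / a) * ((1 - a * b) * (1 - a * b * x) - (1 - x * a) * (1 - b * x)))" .
      moreover have "1 - b * x = 1 - x * b" by (simp add: mult.commute)
      ultimately show ?thesis unfolding T0 T1 ab by (simp only:)
    qed
    also have "\<dots> = W r * alpha * be * (- (x * b^2 / a) * ((1 - a / x) * (1 - a) * (1 - x * a))) +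
      W r * alpha * be * (x * a * ((1 - b / x) * (1 - b) * (1 - b * x)))"
      unfolding bailey_step[OF x a] by (simp only: ring_distribs)
    also have "\<dots> = G (r + 1) - G r"
      unfolding G0 G1 by (simp only: mult_minus_left mult_minus_right minus_minus diff_minus_eq_add ac_simps)
    finally show ?thesis .
  qed
  have "(1 - N^2 * S) * (1 - N^2 * S * x) * (\<Sum>r\<in>{- int L..int L}. T (int n + 1) r) -
     (\<Sum>r\<in>{- int L..int L}. T (int n) r) = (\<Sum>r\<in>{- int L..int L}. G (r + 1) - G r)"
    unfolding step[symmetric] by (simp add: sum_subtractf sum_distrib_left)
  also have "\<dots> = G (int L + 1) - G (- int L)" by (rule sum_int_telescope)
  also have "\<dots> = 0"
  proof -
    have "E (int n + 1 - 3 * (int L + 1)) = 0" using Suc.prems by (intro E_neg) auto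
    moreover have "E (int n + 3 * (- int L) + s - 2) = 0" using Suc.prems s by (intro E_neg) auto
    ultimately show ?thesis by (simp add: G_def)
  qed
  finally have "(1 - N^2 * S) * (1 - N^2 * S * x) * (\<Sum>r\<in>{- int L..int L}. T (int n + 1) r) = E (2 * int n + s - 1)"
    using Suc.IH Suc.prems by (simp add: T_def W_def)
  also have "\<dots> = (1 - N^2 * S) * (1 - N^2 * S * x) * E (2 * int n + s + 1)"
  proof -
    have 1: "E (2 * int n + s - 1) = (1 - N^2 * S) * E (2 * int n + s)"
      using E_rec[of "2 * int n + s"] unfolding C .
    have 2: "E (2 * int n + s) = (1 - N^2 * S * x) * E (2 * int n + s + 1)"
      using E_rec[of "2 * int n + s + 1"] unfolding C by simp
    show ?thesis unfolding 1 2 mult.assoc ..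
  qed
  \<comment> \<open>The cancelled factors are 1 - x^(2n+s) and 1 - x^(2n+s+1), nonzero because no
    positive power of x equals 1.\<close>
  finally have "(\<Sum>r\<in>{- int L..int L}. T (int n + 1) r) = E (2 * int n + s + 1)"
    using x_neq[of "2 * int n + s"] x_neq[of "2 * int n + s + 1"] s unfolding C by auto
  then show ?case by (simp add: T_def W_def algebra_simps)
qed

section \<open>The quintuple product in finite form\<close>

text \<open>The certificate identity with denominators cleared. Each pair of factors is invariant
  under z -> 1/z, so z enters only through c = z + 1/z.\<close>

lemma quintuple_poly:
  fixes x M w c :: "'a :: comm_ring_1"
  shows "(1 + w) * ((1 - M^2) * (x - M^2) * (1 - c * M + M^2) * w^2 -
      x * (1 - c * w * M + w^2 * M^2) * (w^2 - c * M * w + M^2)) =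
    - (w * (w^2 - c * M * w + M^2) * (M^2 * (x * w^2 + x * w + 1) - c * M * w * x - M^4 * w)) -
      (1 - c * w * M + w^2 * M^2) * (M^2 * (w^2 + x * w + x) - c * M * w * x - M^4 * w)"
  by (simp add: algebra_simps eval_nat_numeral)

lemma quintuple_step:
  fixes x M w z c :: "'a :: field"
  defines "h \<equiv> \<lambda>w. (M^2 * (w^2 + x * w + x) - c * M * w * x - M^4 * w) / (x * w^2)"
  assumes nz: "x \<noteq> 0" "w \<noteq> 0" "z \<noteq> 0" and c: "c = z + 1 / z"
  shows "(1 + w) * ((1 - M^2) * (1 - M^2 / x) * ((1 - z * M) * (1 - M / z)) -
      (1 - M * w / z) * (1 - M * z * w) * ((1 - M * z / w) * (1 - M / (z * w)))) =
    - (w^3 * x * ((1 - M * z / w) * (1 - M / (z * w))) * h (x * w)) - (1 - M * w / z) * (1 - M * z * w) * h w"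
proof -
  have 1: "(1 - z * M) * (1 - M / z) = 1 - c * M + M^2"
    using nz by (simp add: c field_simps power2_eq_square)
  have 2: "(1 - M * w / z) * (1 - M * z * w) = 1 - c * w * M + w^2 * M^2"
    using nz by (simp add: c field_simps power2_eq_square)
  have 3: "(1 - M * z / w) * (1 - M / (z * w)) = (w^2 - c * M * w + M^2) / w^2"
    using nz by (simp add: c field_simps power2_eq_square)
  have 4: "1 - M^2 / x = (x - M^2) / x" using nz by (simp add: field_simps)
  have h: "h (x * w) = (M^2 * (x * w^2 + x * w + 1) - c * M * w * x - M^4 * w) / (x^2 * w^2)"
    using nz by (simp add: h_def divide_simps) (simp add: algebra_simps eval_nat_numeral)
  have "(1 + w) * ((1 - M^2) * ((x - M^2) / x) * (1 - c * M + M^2) -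
      (1 - c * w * M + w^2 * M^2) * ((w^2 - c * M * w + M^2) / w^2)) =
    (1 + w) * ((1 - M^2) * (x - M^2) * (1 - c * M + M^2) * w^2 -
      x * (1 - c * w * M + w^2 * M^2) * (w^2 - c * M * w + M^2)) / (x * w^2)"
    using nz by (simp add: divide_simps)
  also have "\<dots> = - (w * (w^2 - c * M * w + M^2) * (M^2 * (x * w^2 + x * w + 1) - c * M * w * x - M^4 * w)) / (x * w^2) -
      (1 - c * w * M + w^2 * M^2) * h w"
    unfolding quintuple_poly by (subst diff_divide_distrib) (simp add: h_def)
  also have "- (w * (w^2 - c * M * w + M^2) * (M^2 * (x * w^2 + x * w + 1) - c * M * w * x - M^4 * w)) / (x * w^2) =
     - (w^3 * x * ((w^2 - c * M * w + M^2) / w^2) * h (x * w))"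
    unfolding h using nz by (simp add: power2_eq_square power3_eq_cube)
  finally show ?thesis unfolding 1 2 3 4 .
qed

text \<open>
  A finite form of the quintuple product identity, which is its limit \<open>m \<rightarrow> \<infinity>\<close>. Here \<open>E1\<close>, \<open>E2\<close> and \<open>R\<close> are
  reciprocals of finite products given by their recurrences, so that no infinite product is needed over a field.
\<close>

lemma quintuple_field:
  fixes x y z :: "'a :: field" and E1 E2 :: "int \<Rightarrow> 'a" and R :: "nat \<Rightarrow> 'a" and m L :: nat
  assumes nz: "y \<noteq> 0" "z \<noteq> 0" and xy: "x = y^2"
    and E1_neg: "\<And>j. j < 0 \<Longrightarrow> E1 j = 0" and E2_neg: "\<And>j. j < 0 \<Longrightarrow> E2 j = 0"
    and E1_rec: "\<And>j. E1 (j - 1) = (1 - x powi j) * (1 - z^2 * x powi j) * E1 j"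
    and E2_rec: "\<And>j. E2 (j - 1) = (1 - x powi j) * (1 - x powi j / z^2) * E2 j"
    and R_0: "(1 + z) * E1 0 * E2 0 = R 0"
    and R_rec: "\<And>m. (1 - (x powi (int m + 1))^2) * (1 - (x powi (int m + 1))^2 / x) *
      ((1 - z * x powi (int m + 1)) * (1 - x powi (int m + 1) / z)) * R (Suc m) = R m"
    and F_nz: "\<And>m. (1 - (x powi (int m + 1))^2) * (1 - (x powi (int m + 1))^2 / x) *
      ((1 - z * x powi (int m + 1)) * (1 - x powi (int m + 1) / z)) \<noteq> 0"
    and L: "m \<le> L"
  shows "(\<Sum>k\<in>{- int L..int L}. (-1) powi k * z powi (3 * k) * y powi (3 * k^2 - k) * (1 + z * x powi k) *
           E1 (int m + k) * E2 (int m - k)) = R m"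
  using L
proof (induction m)
  case 0
  have z: "E1 (int 0 + k) = 0 \<or> E2 (int 0 - k) = 0" if "k \<noteq> 0" for k
    using that E1_neg E2_neg by (cases "0 < k") auto
  have "(\<Sum>k\<in>{- int L..int L}. (-1) powi k * z powi (3 * k) * y powi (3 * k^2 - k) * (1 + z * x powi k) *
           E1 (int 0 + k) * E2 (int 0 - k)) =
    (\<Sum>k\<in>{0}. (-1) powi k * z powi (3 * k) * y powi (3 * k^2 - k) * (1 + z * x powi k) *
           E1 (int 0 + k) * E2 (int 0 - k))"
    using z by (intro sum.mono_neutral_right) auto
  also have "\<dots> = R 0" using R_0 by simp
  finally show ?case by simp
next
  case (Suc m)
  have x: "x \<noteq> 0" using nz xy by simp
  define W where "W k = (-1) powi k * z powi (3 * k) * y powi (3 * k^2 - k)" for k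
  define T where "T m k = W k * (1 + z * x powi k) * E1 (m + k) * E2 (m - k)" for m k
  define M where "M = x powi (int m + 1)"
  define c where "c = z + 1 / z"
  \<comment> \<open>The rational part of the certificate \<open>G\<close>. It depends on k only
    through w = z x^k, so \<open>h (x * w)\<close> is its value at k + 1.\<close>
  define h where "h = (\<lambda>w. (M^2 * (w^2 + x * w + x) - c * M * w * x - M^4 * w) / (x * w^2))"
  define F where "F = (1 - M^2) * (1 - M^2 / x) * ((1 - z * M) * (1 - M / z))"
  define G where "G k = W k * E1 (int m + k) * E2 (int m + 1 - k) * h (z * x powi k)" for k
  note pa = power_int_add[OF disjI1[OF x]]
  have step: "F * T (int m + 1) k - T (int m) k = G (k + 1) - G k" for k
  proof -
    define w where "w = z * x powi k"
    have w: "w \<noteq> 0" using x nz by (simp add: w_def)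
    define alpha where "alpha = E1 (int m + 1 + k)"
    define be where "be = E2 (int m + 1 - k)"
    have MK: "x powi (int m + 1 + k) = M * w / z" using nz by (simp add: M_def w_def pa)
    have MK': "x powi (int m + 1 - k) = M * z / w"
      using nz x by (simp add: M_def w_def power_int_diff)
    have a: "E1 (int m + k) = (1 - M * w / z) * (1 - M * z * w) * alpha"
      using E1_rec[of "int m + 1 + k"] nz unfolding MK alpha_def by (simp add: power2_eq_square algebra_simps)
    have b: "E2 (int m - k) = (1 - M * z / w) * (1 - M / (z * w)) * be"
    proof -
      have "E2 (int m - k) = (1 - M * z / w) * (1 - M * z / w / z^2) * be"
        using E2_rec[of "int m + 1 - k"] unfolding MK' be_def by simp
      also have "M * z / w / z^2 = M / (z * w)" using nz w by (simp add: power2_eq_square)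
      finally show ?thesis .
    qed
    have W1: "W (k + 1) = - (w^3 * x) * W k"
    proof -
      have "3 * (k + 1)^2 - (k + 1) = (3 * k^2 - k) + (2 * (3 * k) + 2)" by (simp add: algebra_simps power2_eq_square)
      then have "y powi (3 * (k + 1)^2 - (k + 1)) = y powi (3 * k^2 - k) * (x powi (3 * k) * x)"
        using nz by (simp only: power_int_add[OF disjI1[OF nz(1)]] power_int_mult xy) simp
      moreover have "z powi (3 * (k + 1)) = z powi (3 * k) * z^3"
        using nz by (simp add: power_int_add distrib_left)
      moreover have "(-1) powi (k + 1) = - ((-1 :: 'a) powi k)" by (simp add: power_int_add)
      moreover have "x powi (3 * k) = (x powi k)^3"
        by (simp add: mult.commute[of 3] power_int_mult)
      ultimately show ?thesis unfolding W_def w_def by (simp add: power_mult_distrib)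
    qed
    have xw: "z * x powi (k + 1) = x * w" using x by (simp add: w_def power_int_add)
    have G1: "G (k + 1) = - (w^3 * x) * W k * alpha * ((1 - M * z / w) * (1 - M / (z * w)) * be) * h (x * w)"
    proof -
      have "E1 (int m + (k + 1)) = alpha" "E2 (int m + 1 - (k + 1)) = E2 (int m - k)" by (simp_all add: alpha_def algebra_simps)
      then show ?thesis unfolding G_def W1 xw b by simp
    qed
    have G0: "G k = W k * ((1 - M * w / z) * (1 - M * z * w) * alpha) * be * h w"
      unfolding G_def a be_def[symmetric] w_def[symmetric] ..
    have T1: "T (int m + 1) k = W k * (1 + w) * alpha * be" unfolding T_def alpha_def be_def w_def ..
    have T0: "T (int m) k = W k * (1 + w) * ((1 - M * w / z) * (1 - M * z * w) * alpha) * ((1 - M * z / w) * (1 - M / (z * w)) * be)"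
      unfolding T_def a b w_def[symmetric] ..
    have "F * T (int m + 1) k - T (int m) k = W k * alpha * be * ((1 + w) * (F -
      (1 - M * w / z) * (1 - M * z * w) * ((1 - M * z / w) * (1 - M / (z * w)))))"
      unfolding T0 T1 by (simp only: right_diff_distrib left_diff_distrib) (simp only: ac_simps)
    also have "\<dots> = W k * alpha * be * (- (w^3 * x * ((1 - M * z / w) * (1 - M / (z * w))) * h (x * w)) -
      (1 - M * w / z) * (1 - M * z * w) * h w)"
      unfolding F_def quintuple_step[OF x w nz(2) c_def] h_def ..
    also have "\<dots> = G (k + 1) - G k"
    proof -
      have "W' * a * b * (- (s * t * h') - r * h) = - s * W' * a * (t * b) * h' - W' * (r * a) * b * h"
        for W' a b s t h' r h :: 'a by (simp add: algebra_simps)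
      then show ?thesis unfolding G0 G1 .
    qed
    finally show ?thesis .
  qed
  have "F * (\<Sum>k\<in>{- int L..int L}. T (int m + 1) k) - (\<Sum>k\<in>{- int L..int L}. T (int m) k) =
    (\<Sum>k\<in>{- int L..int L}. G (k + 1) - G k)"
    unfolding step[symmetric] by (simp add: sum_subtractf sum_distrib_left)
  also have "\<dots> = G (int L + 1) - G (- int L)" by (rule sum_int_telescope)
  also have "\<dots> = 0"
  proof -
    have "E2 (int m + 1 - (int L + 1)) = 0" using Suc.prems by (intro E2_neg) auto
    moreover have "E1 (int m + (- int L)) = 0" using Suc.prems by (intro E1_neg) auto
    ultimately show ?thesis by (simp add: G_def)
  qed
  finally have "F * (\<Sum>k\<in>{- int L..int L}. T (int m + 1) k) = R m"
    using Suc.IH Suc.prems by (simp add: T_def W_def)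
  also have "\<dots> = F * R (Suc m)" using R_rec[of m] by (simp add: F_def M_def)
  finally have "F * (\<Sum>k\<in>{- int L..int L}. T (int m + 1) k) = F * R (Suc m)" .
  moreover have "F \<noteq> 0" using F_nz[of m] unfolding F_def M_def .
  ultimately have "(\<Sum>k\<in>{- int L..int L}. T (int m + 1) k) = R (Suc m)"
    by (simp only: mult_cancel_left) simp
  then show ?case by (simp add: T_def W_def algebra_simps)
qed

section \<open>Transfer from Laurent series to power series\<close>

lemma fps_tendstoI_dvd:
  fixes f :: "nat \<Rightarrow> rat fps"
  assumes "\<And>n. fps_X ^ n dvd f n - g"
  shows "f \<longlonglongrightarrow> g"
  unfolding fps_tendsto_iff_dvd eventually_sequentially
proof
  fix n
  have "fps_X ^ n dvd f k - g" if "n \<le> k" for k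
    by (rule dvd_trans[OF le_imp_power_dvd[OF that] assms])
  then show "\<exists>N. \<forall>k\<ge>N. fps_X ^ n dvd f k - g" by blast
qed

lemma to_fls_mult: "fps_to_fls (f * g) = fps_to_fls f * fps_to_fls g" for f g :: "rat fps"
  by (rule fls_times_fps_to_fls)

lemma to_fls_sum: "fps_to_fls (sum f A) = (\<Sum>i\<in>A. fps_to_fls (f i))" for f :: "'i \<Rightarrow> rat fps"
  by (induction A rule: infinite_finite_induct) auto

lemma to_fls_q_power: "0 \<le> i \<Longrightarrow> fps_to_fls (q ^ nat i) = fls_X powi i"
  by (simp add: fps_to_fls_power power_int_def)

lemma to_fls_e_rec:
  assumes "0 < b"
  shows "fps_to_fls (e b (m - 1)) = (1 - (fls_X powi int b) powi m) * fps_to_fls (e b m)"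
proof (cases "m < 0")
  case False
  have "(fls_X powi int b :: rat fls) powi m = fls_X powi (int b * m)" by (rule power_int_mult[symmetric])
  also have "\<dots> = fps_to_fls (q ^ nat (int b * m))" using False by (intro to_fls_q_power[symmetric]) simp
  also have "nat (int b * m) = b * nat m" by (simp add: nat_mult_distrib)
  finally have "(fls_X powi int b) powi m = fps_to_fls (q ^ (b * nat m))" .
  then show ?thesis using e_pred[OF assms, of m] by (simp add: to_fls_mult)
qed simp

lemma fls_X_powi_neq_1: "0 < b \<Longrightarrow> 0 < m \<Longrightarrow> (fls_X powi int b :: rat fls) powi m \<noteq> 1"
proof
  assume b: "0 < b" and m: "0 < m" and 1: "(fls_X powi int b :: rat fls) powi m = 1"
  have "(fls_X powi int b :: rat fls) powi m = fls_X powi (int b * m)" by (rule power_int_mult[symmetric])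
  also have "\<dots> = fps_to_fls (q ^ nat (int b * m))" using m by (intro to_fls_q_power[symmetric]) simp
  finally have "q ^ nat (int b * m) = 1" using 1 by simp
  then show False using one_minus_q_power_nz[of "nat (int b * m)"] b m by simp
qed

lemma square_ge_abs: "\<bar>r\<bar> \<le> r^2" for r :: int
proof (cases "r = 0")
  case False
  then have "\<bar>r\<bar> * 1 \<le> \<bar>r\<bar> * \<bar>r\<bar>" by (intro mult_left_mono) auto
  then show ?thesis by (simp add: power2_eq_square)
qed simp

text \<open>The case x = q^2. The two powers are multiplied out first: the exponent 6r + s alone can
  be negative, while both resulting exponents are nonnegative.\<close>

lemma bailey_fps:
  fixes s :: int and n B :: nat
  assumes s: "s = 1 \<or> s = 2" and B: "n \<le> B" "1 \<le> B"
  defines "a \<equiv> \<lambda>r. 6 * r^2 + (2 * s - 3) * r"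
  shows "(\<Sum>r\<in>{- int B..int B}. (q ^ nat (2 * a r) - q ^ nat (2 * (a r + 6 * r + s))) *
           e 2 (int n - 3 * r) * e 2 (int n + s + 3 * r)) = e 2 (2 * int n + s - 1)"
proof -
  let ?x = "fls_X powi int 2 :: rat fls"
  have "(\<Sum>r\<in>{- int B..int B}. ?x powi (6 * r^2 + (2 * s - 3) * r) * (1 - ?x powi (6 * r + s)) *
           fps_to_fls (e 2 (int n - 3 * r)) * fps_to_fls (e 2 (int n + s + 3 * r))) =
        fps_to_fls (e 2 (2 * int n + s - 1))"
    by (rule bailey_field[OF _ fls_X_powi_neq_1 _ _ to_fls_e_rec s B]) auto
  also have "(\<Sum>r\<in>{- int B..int B}. ?x powi (6 * r^2 + (2 * s - 3) * r) * (1 - ?x powi (6 * r + s)) *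
           fps_to_fls (e 2 (int n - 3 * r)) * fps_to_fls (e 2 (int n + s + 3 * r))) =
     fps_to_fls (\<Sum>r\<in>{- int B..int B}. (q ^ nat (2 * a r) - q ^ nat (2 * (a r + 6 * r + s))) *
           e 2 (int n - 3 * r) * e 2 (int n + s + 3 * r))"
    unfolding to_fls_sum
  proof (rule sum.cong[OF refl], goal_cases)
    case (1 r)
    have r: "\<bar>r\<bar> \<le> r^2" by (rule square_ge_abs)
    have a: "0 \<le> 2 * a r" using s r by (auto simp: a_def)
    have b: "0 \<le> 2 * (a r + 6 * r + s)"
    proof (cases "r = -1")
      case True
      then show ?thesis using s by (auto simp: a_def)
    next
      case False
      have "0 \<le> 6 * r^2 + 7 * r \<and> 0 \<le> 6 * r^2 + 5 * r"
      proof (cases "0 \<le> r")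
        case F: False
        then have "0 \<le> (- r) * (- r - 2)" using False by (intro mult_nonneg_nonneg) auto
        then have "2 * (- r) \<le> r^2" by (simp add: power2_eq_square algebra_simps)
        then show ?thesis using F by simp
      qed simp
      then show ?thesis using s by (auto simp: a_def)
    qed
    have "?x powi (6 * r^2 + (2 * s - 3) * r) * (1 - ?x powi (6 * r + s)) =
      ?x powi (a r) - ?x powi (a r + (6 * r + s))"
      by (simp add: a_def right_diff_distrib power_int_add)
    also have "\<dots> = fls_X powi (2 * a r) - fls_X powi (2 * (a r + 6 * r + s))"
      by (simp only: power_int_mult[symmetric] of_nat_numeral add.assoc)
    also have "\<dots> = fps_to_fls (q ^ nat (2 * a r) - q ^ nat (2 * (a r + 6 * r + s)))"
      using to_fls_q_power[OF a] to_fls_q_power[OF b] by simp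
    finally show ?case by (simp only: to_fls_mult)
  qed
  finally show ?thesis by simp
qed

section \<open>The conjugate Bailey pair\<close>

definition qodd :: "nat \<Rightarrow> rat fps" where "qodd n = (\<Prod>j<n. 1 - q ^ (2 * j + 1))"

text \<open>The weights of Bailey's lemma in base q^2 with a = 1, one parameter equal to q and the
  other sent to infinity.\<close>

definition delta :: "nat \<Rightarrow> rat fps" where "delta j = (-1) ^ j * q ^ j^2 * qodd j"

lemma qodd_Suc: "qodd (Suc n) = qodd n * (1 - q ^ (2 * n + 1))" by (simp add: qodd_def)

lemma delta_dvd: "fps_X ^ j dvd delta j"
  unfolding delta_def by (rule dvd_q_power) (simp add: power2_eq_square)

lemma delta_Suc: "delta (Suc j) = - ((1 - q * q ^ (2 * j)) * (q * q ^ (2 * j)) * delta j)"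
proof -
  have "q ^ (Suc j)^2 = q ^ j^2 * (q * q ^ (2 * j))"
    by (simp only: power_Suc[symmetric] power_add[symmetric], rule power_cong_exp) (simp add: power2_eq_square)
  then show ?thesis unfolding delta_def qodd_Suc by (simp add: ac_simps)
qed

text \<open>Behind this lie (q^2; q^2)_{2j} = (q; q)_{2j} (-q; q)_{2j} and (q; q)_{2j} = (q; q^2)_j
  (q^2; q^2)_j. It links the Bailey pair to the weights \<open>v\<close>.\<close>

lemma qodd_e: "qodd j * e 2 (2 * int j) = e 2 (int j) * inverse (qplus (2 * j))"
proof (induction j)
  case 0
  then show ?case by (simp add: qodd_def)
next
  case (Suc j)
  have e1: "(1 - q ^ (4 * j + 2)) * ((1 - q ^ (4 * j + 4)) * e 2 (2 * int (Suc j))) = e 2 (2 * int j)"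
  proof -
    have "2 * Suc (2 * j + 1) = 4 * j + 4" "int (Suc (2 * j + 1)) = 2 * int (Suc j)"
      "2 * Suc (2 * j) = 4 * j + 2" "int (Suc (2 * j)) = int (2 * j + 1)" "int (2 * j) = 2 * int j" by simp_all
    then show ?thesis using e_Suc[of 2 "2 * j + 1"] e_Suc[of 2 "2 * j"] by (simp only: zero_less_numeral)
  qed
  have e2: "(1 - q ^ (2 * j + 2)) * e 2 (int (Suc j)) = e 2 (int j)"
    using e_Suc[of 2 j] by (simp add: algebra_simps)
  have 1: "inverse (qplus (2 * Suc j)) * (1 + q ^ (2 * j + 2)) = inverse (qplus (2 * j + 1))"
    using inverse_qplus_Suc[of "2 * j + 1"] by simp
  have 2: "inverse (qplus (2 * j + 1)) * (1 + q ^ (2 * j + 1)) = inverse (qplus (2 * j))"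
    using inverse_qplus_Suc[of "2 * j"] by simp
  have f: "1 - q ^ (4 * j + 2) = (1 - q ^ (2 * j + 1)) * (1 + q ^ (2 * j + 1))"
    "1 - q ^ (4 * j + 4) = (1 - q ^ (2 * j + 2)) * (1 + q ^ (2 * j + 2))"
  proof -
    have *: "1 - x * x = (1 - x) * (1 + x)" for x :: "rat fps" by (simp add: algebra_simps)
    have "q ^ (4 * j + 2) = q ^ (2 * j + 1) * q ^ (2 * j + 1)" "q ^ (4 * j + 4) = q ^ (2 * j + 2) * q ^ (2 * j + 2)"
      by (simp_all only: power_add[symmetric]; rule power_cong_exp; simp)+
    then show "1 - q ^ (4 * j + 2) = (1 - q ^ (2 * j + 1)) * (1 + q ^ (2 * j + 1))"
      "1 - q ^ (4 * j + 4) = (1 - q ^ (2 * j + 2)) * (1 + q ^ (2 * j + 2))" by (simp_all only: *)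
  qed
  let ?c = "(1 + q ^ (2 * j + 1)) * ((1 - q ^ (2 * j + 2)) * (1 + q ^ (2 * j + 2)))"
  have "?c * (qodd (Suc j) * e 2 (2 * int (Suc j))) = qodd j * ((1 - q ^ (4 * j + 2)) * ((1 - q ^ (4 * j + 4)) * e 2 (2 * int (Suc j))))"
    unfolding qodd_Suc f by (simp only: ac_simps)
  also have "\<dots> = e 2 (int j) * inverse (qplus (2 * j))" unfolding e1 by (rule Suc.IH)
  also have "\<dots> = ((1 - q ^ (2 * j + 2)) * e 2 (int (Suc j))) *
     (inverse (qplus (2 * Suc j)) * (1 + q ^ (2 * j + 2)) * (1 + q ^ (2 * j + 1)))" unfolding e2 1 2 ..
  also have "\<dots> = ?c * (e 2 (int (Suc j)) * inverse (qplus (2 * Suc j)))" by (simp only: ac_simps)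
  finally have "?c * (qodd (Suc j) * e 2 (2 * int (Suc j))) = ?c * (e 2 (int (Suc j)) * inverse (qplus (2 * Suc j)))" .
  moreover have "?c \<noteq> 0"
  proof -
    have "fps_nth ?c 0 \<noteq> fps_nth 0 0" by (simp add: fps_power_zeroth)
    then show ?thesis by (rule contrapos_nn) (erule arg_cong)
  qed
  ultimately show ?case by (simp only: mult_cancel_left) simp
qed

text \<open>The conjugate Bailey pair \<open>(delta, Phi)\<close>, which is evaluated by \<open>Phi_eq\<close> and \<open>Phi_0\<close>.\<close>

definition Phi :: "int \<Rightarrow> rat fps" where
  "Phi k = infsum (\<lambda>j. delta j * e 2 (int j - k) * e 2 (int j + k)) UNIV"

lemma Phi_dvd: "fps_X ^ j dvd delta j * a * b"
  by (rule dvd_mult2, rule dvd_mult2, rule delta_dvd)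

lemma Phi_minus: "Phi (- k) = Phi k"
  unfolding Phi_def by (simp add: ac_simps)

text \<open>The terms of Phi(k+1) + q^(2k+1) Phi(k) telescope in j, and the boundary term tends to 0
  because it contains \<open>delta (Suc N)\<close>.\<close>

lemma Phi_Suc: "Phi (int k + 1) = - (q ^ (2 * k + 1)) * Phi (int k)"
proof -
  define K where "K = q ^ (2 * k)"
  define G where "G j = - ((1 + q * K) * delta j * e 2 (int j - int k - 1) * e 2 (int j + int k))" for j
  have step: "delta j * e 2 (int j - (int k + 1)) * e 2 (int j + (int k + 1)) +
      q * K * (delta j * e 2 (int j - int k) * e 2 (int j + int k)) = G (Suc j) - G j" for j
  proof (cases "j < k")
    case True
    then have "e 2 (int j - int k) = 0" "e 2 (int j - int k - 1) = 0" "e 2 (int j - (int k + 1)) = 0"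
      "e 2 (int (Suc j) - int k - 1) = 0" by auto
    then show ?thesis by (simp add: G_def)
  next
    case False
    define d where "d = j - k"
    have j: "j = k + d" using False by (simp add: d_def)
    define D where "D = q ^ (2 * d)"
    have J: "q ^ (2 * j) = K * D" by (simp add: K_def D_def j power_add distrib_left)
    define x where "x = e 2 (int d)"
    define y where "y = e 2 (int j + int k + 1)"
    have 1: "e 2 (int d - 1) = (1 - D) * x" using e_pred[of 2 "int d"] by (simp add: D_def x_def)
    have 2: "e 2 (int j + int k) = (1 - K * D * K * q^2) * y"
    proof -
      have "nat (int j + int k + 1) = j + k + 1" by simp
      then have "e 2 (int j + int k) = (1 - q ^ (2 * (j + k + 1))) * y"
        using e_pred[of 2 "int j + int k + 1"] unfolding y_def by simp
      also have "q ^ (2 * (j + k + 1)) = K * D * K * q^2"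
        unfolding K_def D_def j by (simp only: power_add[symmetric], rule power_cong_exp) simp
      finally show ?thesis .
    qed
    have eqs: "int j - (int k + 1) = int d - 1" "int j - int k = int d" "int (Suc j) - int k - 1 = int d"
      "int j - int k - 1 = int d - 1" "int j + (int k + 1) = int j + int k + 1" "int (Suc j) + int k = int j + int k + 1"
      by (simp_all add: j)
    have alg: "dl' * ((1 - D) * x) * y + q * K * (dl' * x * ((1 - K * D * K * q^2) * y)) =
      - ((1 + q * K) * - ((1 - q * (K * D)) * (q * (K * D)) * dl') * x * y) -
      - ((1 + q * K) * dl' * ((1 - D) * x) * ((1 - K * D * K * q^2) * y))" for dl' x y K D q :: "rat fps"
      by (simp add: algebra_simps power2_eq_square)
    show ?thesis
      unfolding G_def eqs 1 2 delta_Suc J unfolding x_def[symmetric] y_def[symmetric] by (rule alg)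
  qed
  have sum: "(\<Sum>j\<le>N. delta j * e 2 (int j - (int k + 1)) * e 2 (int j + (int k + 1)) +
      q * K * (delta j * e 2 (int j - int k) * e 2 (int j + int k))) = G (Suc N)" for N
  proof -
    have "(\<Sum>j\<le>N. G (Suc j) - G j) = G (Suc N) - G 0"
      by (subst lessThan_Suc_atMost[symmetric], subst sum_lessThan_telescope) simp
    moreover have "G 0 = 0" by (simp add: G_def)
    ultimately show ?thesis unfolding step by simp
  qed
  have "(\<lambda>N. G (Suc N)) \<longlonglongrightarrow> Phi (int k + 1) + q * K * Phi (int k)"
    unfolding sum[symmetric] sum.distrib sum_distrib_left[symmetric] Phi_def
    by (intro fps_tendsto_add fps_tendsto_cmult fps_sum_tendsto_nat Phi_dvd)
  moreover have "(\<lambda>N. G (Suc N)) \<longlonglongrightarrow> 0"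
  proof (rule fps_tendstoI_dvd)
    fix N
    have "fps_X ^ Suc N dvd G (Suc N)"
      unfolding G_def dvd_minus_iff by (rule dvd_mult2, rule dvd_mult2, rule dvd_mult, rule delta_dvd)
    then show "fps_X ^ N dvd G (Suc N) - 0"
      unfolding diff_0_right by (rule dvd_trans[OF le_imp_power_dvd, rotated]) simp
  qed
  ultimately have "Phi (int k + 1) + q * K * Phi (int k) = 0" by (rule LIMSEQ_unique)
  then show ?thesis unfolding K_def by (simp add: add_eq_0_iff2)
qed

lemma Phi_nat: "Phi (int k) = (-1) ^ k * q ^ k^2 * Phi 0"
proof (induction k)
  case (Suc k)
  have "q ^ (Suc k)^2 = q ^ (2 * k + 1) * q ^ k^2"
    by (simp only: power_add[symmetric], rule power_cong_exp) (simp add: power2_eq_square)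
  moreover have "Phi (int (Suc k)) = - (q ^ (2 * k + 1)) * Phi (int k)" using Phi_Suc[of k] by (simp add: add.commute)
  ultimately show ?case using Suc by (simp add: ac_simps)
qed simp

lemma Phi_eq: "Phi k = (-1) ^ nat \<bar>k\<bar> * q ^ nat (k^2) * Phi 0"
proof -
  have "Phi k = Phi (int (nat \<bar>k\<bar>))" using Phi_minus[of k] by (auto simp: abs_if)
  moreover have "nat (k^2) = (nat \<bar>k\<bar>)^2" by (metis nat_power_eq power2_abs abs_ge_zero)
  ultimately show ?thesis by (simp only: Phi_nat)
qed

definition qodd_inf :: "rat fps" where "qodd_inf = qpoch q (q ^ 2) \<infinity>"

lemma qodd_tendsto: "qodd \<longlonglongrightarrow> qodd_inf"
proof -
  have "qodd = (\<lambda>n. \<Prod>j<n. 1 - q * (q ^ 2) ^ j)" by (auto simp: qodd_def power_mult)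
  then show ?thesis unfolding qodd_inf_def using qpoch_tendsto[of q "q ^ 2"] by simp
qed

text \<open>Putting j = i + k in Phi(k) and taking out (-1)^k q^(k^2) leaves the series of
  \<open>f k\<close>. By \<open>Phi_nat\<close> that same factor separates Phi(k) from Phi(0), so
  Phi(0) is the sum of \<open>f k\<close> for every k. As k grows only the term i = 0
  survives.\<close>

lemma Phi_0: "Phi 0 = qodd_inf * e_inf 2"
proof -
  define f where "f k i = (-1) ^ i * q ^ (i^2 + 2 * k * i) * qodd (k + i) * e 2 (int i) * e 2 (2 * int k + int i)" for k i
  have f_dvd: "fps_X ^ (i + 2 * k * i) dvd f k i" for k i
    unfolding f_def by (rule dvd_mult2, rule dvd_mult2, rule dvd_q_power) (simp add: power2_eq_square)
  have f_dvd': "fps_X ^ i dvd f k i" for k i by (rule dvd_trans[OF le_imp_power_dvd f_dvd]) simp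
  have Phi_f: "Phi 0 = infsum (f k) UNIV" for k
  proof -
    have "(\<lambda>N. \<Sum>i\<le>N + k. delta i * e 2 (int i - int k) * e 2 (int i + int k)) \<longlonglongrightarrow> Phi (int k)"
      unfolding Phi_def by (rule LIMSEQ_ignore_initial_segment[OF fps_sum_tendsto_nat[OF Phi_dvd]])
    moreover have "(\<Sum>i\<le>N + k. delta i * e 2 (int i - int k) * e 2 (int i + int k)) =
       (-1) ^ k * q ^ k^2 * (\<Sum>i\<le>N. f k i)" for N
    proof -
      have "(\<Sum>i\<le>N + k. delta i * e 2 (int i - int k) * e 2 (int i + int k)) =
        (\<Sum>i\<in>{k..N + k}. delta i * e 2 (int i - int k) * e 2 (int i + int k))"
        by (rule sum.mono_neutral_right) auto
      also have "\<dots> = (\<Sum>i\<in>{0..N}. delta (i + k) * e 2 (int (i + k) - int k) * e 2 (int (i + k) + int k))"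
        using sum.shift_bounds_cl_nat_ivl[of "\<lambda>i. delta i * e 2 (int i - int k) * e 2 (int i + int k)" 0 k N]
        by (simp only: add_0)
      also have "\<dots> = (\<Sum>i\<in>{0..N}. (-1) ^ k * q ^ k^2 * f k i)"
      proof (rule sum.cong[OF refl])
        fix i
        have "q ^ (i + k)^2 = q ^ k^2 * q ^ (i^2 + 2 * k * i)"
          by (simp only: power_add[symmetric], rule power_cong_exp) (simp add: power2_eq_square algebra_simps)
        moreover have "e 2 (int (i + k) + int k) = e 2 (2 * int k + int i)" by (simp add: algebra_simps)
        moreover have "e 2 (int (i + k) - int k) = e 2 (int i)" by simp
        moreover have "qodd (k + i) = qodd (i + k)" by (simp add: add.commute)
        ultimately show "delta (i + k) * e 2 (int (i + k) - int k) * e 2 (int (i + k) + int k) = (-1) ^ k * q ^ k^2 * f k i"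
          unfolding delta_def f_def power_add[of "-1"] by (simp only: ac_simps)
      qed
      finally show ?thesis by (simp add: sum_distrib_left atLeast0AtMost)
    qed
    ultimately have "(\<lambda>N. (-1) ^ k * q ^ k^2 * (\<Sum>i\<le>N. f k i)) \<longlonglongrightarrow> Phi (int k)" by simp
    moreover have "(\<lambda>N. (-1) ^ k * q ^ k^2 * (\<Sum>i\<le>N. f k i)) \<longlonglongrightarrow> (-1) ^ k * q ^ k^2 * infsum (f k) UNIV"
      by (intro fps_tendsto_cmult fps_sum_tendsto_nat f_dvd')
    ultimately have "Phi (int k) = (-1) ^ k * q ^ k^2 * infsum (f k) UNIV" by (rule LIMSEQ_unique)
    then have "(-1) ^ k * q ^ k^2 * Phi 0 = (-1) ^ k * q ^ k^2 * infsum (f k) UNIV" by (simp only: Phi_nat)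
    moreover have "(-1) ^ k * q ^ k^2 \<noteq> (0 :: rat fps)" by simp
    ultimately show ?thesis by (simp only: mult_cancel_left) simp
  qed
  have close: "fps_X ^ k dvd f k 0 - Phi 0" for k
  proof -
    have "fps_X ^ k dvd infsum (f k) UNIV - f k 0"
    proof (rule fps_dvd_limit)
      show "(\<lambda>N. (\<Sum>i\<le>N. f k i) - f k 0) \<longlonglongrightarrow> infsum (f k) UNIV - f k 0"
        by (intro fps_tendsto_diff fps_sum_tendsto_nat f_dvd') auto
      fix N
      have "(\<Sum>i\<le>N. f k i) - f k 0 = (\<Sum>i<N. f k (Suc i))"
        by (simp add: lessThan_Suc_atMost[symmetric] sum.lessThan_Suc_shift del: sum.lessThan_Suc)
      also have "fps_X ^ k dvd \<dots>"
        by (intro dvd_sum dvd_trans[OF le_imp_power_dvd f_dvd]) simp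
      finally show "fps_X ^ k dvd (\<Sum>i\<le>N. f k i) - f k 0" .
    qed
    then show ?thesis unfolding Phi_f[of k] by (simp add: dvd_diff_commute)
  qed
  have "(\<lambda>k. f k 0) \<longlonglongrightarrow> Phi 0"
    by (rule fps_tendstoI_dvd) (rule close)
  moreover have "(\<lambda>k. qodd k * e 2 (int (2 * k))) \<longlonglongrightarrow> qodd_inf * e_inf 2"
    by (intro fps_tendsto_mult qodd_tendsto filterlim_compose[OF e_tendsto] filterlim_subseq)
      (auto simp: strict_mono_def)
  moreover have "f k 0 = qodd k * e 2 (int (2 * k))" for k by (simp add: f_def)
  ultimately show ?thesis by (simp add: LIMSEQ_unique)
qed

text \<open>Euler's product identity for distinct and odd parts, obtained as the limit of
  \<open>qodd_e\<close>.\<close>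

lemma qplus_inf_qodd_inf: "qplus_inf * qodd_inf = 1"
proof -
  have "(\<lambda>j. qplus (2 * j) * (qodd j * e 2 (int (2 * j)))) \<longlonglongrightarrow> qplus_inf * (qodd_inf * e_inf 2)"
    by (intro fps_tendsto_mult qodd_tendsto filterlim_compose[OF e_tendsto] filterlim_compose[OF qplus_tendsto] filterlim_subseq)
      (auto simp: strict_mono_def)
  moreover have "qplus (2 * j) * (qodd j * e 2 (int (2 * j))) = e 2 (int j)" for j
    using qodd_e[of j] qplus_inverse[of "2 * j"] by (simp add: mult.left_commute mult.commute)
  ultimately have "(\<lambda>j. e 2 (int j)) \<longlonglongrightarrow> qplus_inf * (qodd_inf * e_inf 2)" by simp
  then have "qplus_inf * (qodd_inf * e_inf 2) = e_inf 2"
    by (rule LIMSEQ_unique) (rule e_tendsto, simp)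
  moreover have "e_inf 2 * (qplus_inf * qodd_inf) = qplus_inf * (qodd_inf * e_inf 2)" by (simp only: ac_simps)
  ultimately have "e_inf 2 * (qplus_inf * qodd_inf) = e_inf 2 * 1" by simp
  then show ?thesis using e_inf_nonzero[of 2] by (simp only: mult_cancel_left) simp
qed

text \<open>Exchanging the sums over j and r turns each product of reciprocals at n - k and n + k
  into \<open>Phi k\<close>. Only k = 3r and k = 3r + 1 occur, and both have absolute value at least
  |r|, which gives the majorant.\<close>

lemma bailey_limit:
  fixes A B :: "int \<Rightarrow> rat fps" and be :: "nat \<Rightarrow> rat fps"
  assumes be: "\<And>n N. n \<le> N \<Longrightarrow> 1 \<le> N \<Longrightarrow> be n = (\<Sum>r\<in>{- int N..int N}.
      A r * e 2 (int n - 3 * r) * e 2 (int n + 3 * r) - B r * e 2 (int n - (3 * r + 1)) * e 2 (int n + (3 * r + 1)))"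
  shows "infsum (\<lambda>j. delta j * be j) UNIV = infsum (\<lambda>r. A r * Phi (3 * r) - B r * Phi (3 * r + 1)) UNIV"
proof -
  define S where "S N k = (\<Sum>j\<le>N. delta j * e 2 (int j - k) * e 2 (int j + k))" for N k
  have S_lim: "(\<lambda>N. S N k) \<longlonglongrightarrow> Phi k" for k
    unfolding S_def Phi_def by (rule fps_sum_tendsto_nat[OF Phi_dvd])
  have S_dvd: "fps_X ^ n dvd S N k" if "int n \<le> \<bar>k\<bar>" for N k n
    unfolding S_def
  proof (rule dvd_sum)
    fix j
    show "fps_X ^ n dvd delta j * e 2 (int j - k) * e 2 (int j + k)"
    proof (cases "n \<le> j")
      case True
      then show ?thesis by (rule dvd_trans[OF le_imp_power_dvd Phi_dvd])
    next
      case False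
      then have "int j - k < 0 \<or> int j + k < 0" using that by linarith
      then show ?thesis by auto
    qed
  qed
  have S_0: "S N k = 0" if "int N < \<bar>k\<bar>" for N k
    unfolding S_def
  proof (rule sum.neutral, rule)
    fix j assume "j \<in> {..N}"
    then have "int j - k < 0 \<or> int j + k < 0" using that by auto
    then show "delta j * e 2 (int j - k) * e 2 (int j + k) = 0" by auto
  qed
  have lim1: "(\<lambda>N. \<Sum>r\<in>{- int N..int N}. A r * S N (3 * r) - B r * S N (3 * r + 1))
     \<longlonglongrightarrow> infsum (\<lambda>r. A r * Phi (3 * r) - B r * Phi (3 * r + 1)) UNIV"
  proof (rule fps_tannery_int)
    fix N and r :: int
    show "fps_X ^ nat \<bar>r\<bar> dvd A r * S N (3 * r) - B r * S N (3 * r + 1)"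
      by (intro dvd_diff dvd_mult S_dvd) auto
    show "(\<lambda>N. A r * S N (3 * r) - B r * S N (3 * r + 1)) \<longlonglongrightarrow> A r * Phi (3 * r) - B r * Phi (3 * r + 1)"
      by (intro fps_tendsto_diff fps_tendsto_cmult S_lim)
    assume "int N < \<bar>r\<bar>"
    then have "int N < \<bar>3 * r\<bar>" "int N < \<bar>3 * r + 1\<bar>" by auto
    then show "A r * S N (3 * r) - B r * S N (3 * r + 1) = 0" using S_0 by simp
  qed
  have eq: "(\<Sum>j\<le>N. delta j * be j) = (\<Sum>r\<in>{- int N..int N}. A r * S N (3 * r) - B r * S N (3 * r + 1))" if "1 \<le> N" for N
  proof -
    have "(\<Sum>j\<le>N. delta j * be j) = (\<Sum>j\<le>N. \<Sum>r\<in>{- int N..int N}.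
      A r * (delta j * e 2 (int j - 3 * r) * e 2 (int j + 3 * r)) - B r * (delta j * e 2 (int j - (3 * r + 1)) * e 2 (int j + (3 * r + 1))))"
    proof (rule sum.cong[OF refl])
      fix j assume "j \<in> {..N}"
      then have j: "be j = (\<Sum>r\<in>{- int N..int N}.
        A r * e 2 (int j - 3 * r) * e 2 (int j + 3 * r) - B r * e 2 (int j - (3 * r + 1)) * e 2 (int j + (3 * r + 1)))"
        using that by (intro be) auto
      show "delta j * be j = (\<Sum>r\<in>{- int N..int N}.
        A r * (delta j * e 2 (int j - 3 * r) * e 2 (int j + 3 * r)) - B r * (delta j * e 2 (int j - (3 * r + 1)) * e 2 (int j + (3 * r + 1))))"
        unfolding j sum_distrib_left by (rule sum.cong[OF refl]) (simp only: right_diff_distrib ac_simps)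
    qed
    also have "\<dots> = (\<Sum>r\<in>{- int N..int N}. \<Sum>j\<le>N.
      A r * (delta j * e 2 (int j - 3 * r) * e 2 (int j + 3 * r)) - B r * (delta j * e 2 (int j - (3 * r + 1)) * e 2 (int j + (3 * r + 1))))"
      by (rule sum.swap)
    finally show ?thesis by (simp only: S_def sum_subtractf sum_distrib_left)
  qed
  have be_dvd: "fps_X ^ j dvd delta j * be j" for j by (rule dvd_mult2[OF delta_dvd])
  have "(\<lambda>N. \<Sum>j\<le>N. delta j * be j) \<longlonglongrightarrow> infsum (\<lambda>r. A r * Phi (3 * r) - B r * Phi (3 * r + 1)) UNIV"
  proof (rule Lim_transform_eventually[OF lim1])
    show "\<forall>\<^sub>F N in sequentially. (\<Sum>r\<in>{- int N..int N}. A r * S N (3 * r) - B r * S N (3 * r + 1)) = (\<Sum>j\<le>N. delta j * be j)"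
      unfolding eventually_sequentially using eq by (intro exI[of _ 1]) simp
  qed
  then show ?thesis by (rule LIMSEQ_unique[OF fps_sum_tendsto_nat[OF be_dvd]])
qed

section \<open>Theta series and products\<close>

definition int_sign :: "int \<Rightarrow> rat fps" where "int_sign k = (if even k then 1 else -1)"

lemma int_sign_eq: "(-1) ^ nat \<bar>k\<bar> = int_sign k"
  by (simp add: int_sign_def minus_one_power_iff even_nat_iff)

definition theta :: "int \<Rightarrow> int \<Rightarrow> rat fps" where
  "theta c d = infsum (\<lambda>r. int_sign r * q ^ nat (21 * r^2 + c * r + d)) UNIV"

text \<open>The weight |r| required for dominated convergence over the integers; it also makes
  truncation of the exponent by \<open>nat\<close> harmless.\<close>

definition theta_bound :: "int \<Rightarrow> int \<Rightarrow> bool" where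
  "theta_bound c d \<longleftrightarrow> (\<forall>r. \<bar>r\<bar> \<le> 21 * r^2 + c * r + d)"

lemma theta_boundI: "\<bar>c\<bar> \<le> 20 \<Longrightarrow> 0 \<le> d \<Longrightarrow> theta_bound c d"
  unfolding theta_bound_def
proof
  fix r
  assume "\<bar>c\<bar> \<le> 20" "0 \<le> d"
  then have "\<bar>c * r\<bar> \<le> 20 * \<bar>r\<bar>" unfolding abs_mult by (intro mult_right_mono) auto
  then show "\<bar>r\<bar> \<le> 21 * r^2 + c * r + d" using square_ge_abs[of r] \<open>0 \<le> d\<close> by linarith
qed

text \<open>The linear coefficient 22 exceeds the range of \<open>theta_boundI\<close>; reflecting r
  to -1 - r brings it down to 20.\<close>

lemma theta_bound_22_5: "theta_bound 22 5"
  unfolding theta_bound_def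
proof
  fix r :: int
  define y where "y = - 1 - r"
  have r: "r = - 1 - y" by (simp add: y_def)
  have "21 * r^2 + 22 * r + 5 = 21 * y^2 + 20 * y + 4"
    unfolding r by (simp add: power2_eq_square algebra_simps)
  then show "\<bar>r\<bar> \<le> 21 * r^2 + 22 * r + 5" using square_ge_abs[of y] r by linarith
qed

lemma theta_dvd: "theta_bound c d \<Longrightarrow> fps_X ^ nat \<bar>r\<bar> dvd int_sign r * q ^ nat (21 * r^2 + c * r + d)"
  unfolding theta_bound_def by (intro dvd_mult le_imp_power_dvd nat_mono) simp

lemma fps_sum_tendsto_int:
  fixes g :: "int \<Rightarrow> rat fps"
  assumes "\<And>i. fps_X ^ nat \<bar>i\<bar> dvd g i"
  shows "(\<lambda>N. \<Sum>i\<in>{- int N..int N}. g i) \<longlonglongrightarrow> infsum g UNIV"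
proof (rule fps_sum_tendsto_infsum[where w = "\<lambda>i. nat \<bar>i\<bar>"])
  fix i :: int
  show "\<forall>\<^sub>F N in sequentially. i \<in> {- int N..int N}"
    unfolding eventually_sequentially by (rule exI[of _ "nat \<bar>i\<bar>"]) auto
qed (use assms finite_int_abs_less in auto)

lemma fps_infsum_int_cmult_add:
  fixes f g :: "int \<Rightarrow> rat fps"
  assumes "\<And>i. fps_X ^ nat \<bar>i\<bar> dvd f i" "\<And>i. fps_X ^ nat \<bar>i\<bar> dvd g i"
  shows "infsum (\<lambda>i. c * (f i + b * g i)) UNIV = c * (infsum f UNIV + b * infsum g UNIV)"
proof (rule LIMSEQ_unique)
  show "(\<lambda>N. \<Sum>i\<in>{- int N..int N}. c * (f i + b * g i)) \<longlonglongrightarrow> infsum (\<lambda>i. c * (f i + b * g i)) UNIV"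
    by (rule fps_sum_tendsto_int) (intro dvd_mult dvd_add assms)
  show "(\<lambda>N. \<Sum>i\<in>{- int N..int N}. c * (f i + b * g i)) \<longlonglongrightarrow> c * (infsum f UNIV + b * infsum g UNIV)"
    unfolding sum_distrib_left[symmetric] sum.distrib
    by (intro fps_tendsto_cmult fps_tendsto_add fps_sum_tendsto_int assms)
qed

lemma theta_combine:
  assumes "theta_bound c d" "theta_bound c' d'"
  shows "infsum (\<lambda>r. C * (int_sign r * q ^ nat (21 * r^2 + c * r + d) + b * (int_sign r * q ^ nat (21 * r^2 + c' * r + d')))) UNIV =
    C * (theta c d + b * theta c' d')"
  unfolding theta_def by (rule fps_infsum_int_cmult_add) (rule theta_dvd[OF assms(1)], rule theta_dvd[OF assms(2)])

lemma theta_reflect: "theta (- c) d = theta c d"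
proof -
  have "bij (uminus :: int \<Rightarrow> int)" by (rule bij_uminus)
  from infsum_reindex_bij_betw[OF this, of "\<lambda>r. int_sign r * q ^ nat (21 * r^2 + c * r + d)"]
  show ?thesis unfolding theta_def by (simp add: int_sign_def)
qed

text \<open>The reflection r -> -1 - r reverses the sign. It turns the sum from the quintuple
  product into the difference that occurs in \<open>slater3\<close>.\<close>

lemma theta_22_5: "theta 22 5 = - theta 20 4"
proof -
  have "bij (\<lambda>r :: int. -1 - r)" by (rule o_bij[of "\<lambda>r. -1 - r"]) auto
  from infsum_reindex_bij_betw[OF this, of "\<lambda>r. int_sign r * q ^ nat (21 * r^2 + 22 * r + 5)"]
  have "theta 22 5 = infsum (\<lambda>r. int_sign (- 1 - r) * q ^ nat (21 * (- 1 - r)^2 + 22 * (- 1 - r) + 5)) UNIV"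
    by (simp add: theta_def)
  also have "\<dots> = infsum (\<lambda>r. (-1) * (int_sign r * q ^ nat (21 * r^2 + 20 * r + 4) + 0 * (int_sign r * q ^ nat (21 * r^2 + 20 * r + 4)))) UNIV"
  proof (rule infsum_cong, goal_cases)
    case (1 r)
    have 1: "21 * (- 1 - r)^2 + 22 * (- 1 - r) + 5 = 21 * r^2 + 20 * r + 4"
      by (simp add: power2_eq_square algebra_simps)
    have 2: "int_sign (- 1 - r) = - int_sign r" by (simp add: int_sign_def)
    show ?case unfolding 1 2 by simp
  qed
  also have "\<dots> = (-1) * (theta 20 4 + 0 * theta 20 4)" by (rule theta_combine) (auto intro: theta_boundI)
  finally show ?thesis by simp
qed

lemma Phi_3:
  shows "Phi (3 * r) = int_sign r * q ^ nat (9 * r^2) * Phi 0"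
    and "Phi (3 * r + 1) = - (int_sign r * q ^ nat ((3 * r + 1)^2) * Phi 0)"
  using Phi_eq[of "3 * r"] Phi_eq[of "3 * r + 1"] unfolding int_sign_eq
  by (simp_all add: int_sign_def power_mult_distrib)

section \<open>The single sums as combinations of two theta series\<close>

lemma q_mult_nat: "0 \<le> a \<Longrightarrow> 0 \<le> b \<Longrightarrow> c = a + b \<Longrightarrow> q ^ nat a * q ^ nat b = q ^ nat c"
  by (simp add: power_add nat_add_distrib)

text \<open>Lowers the index sum i + l from 2n + 1, as in the Bailey pair, to 2n, the form n - k, n
  + k that \<open>Phi\<close> needs. After \<open>e_pred\<close> the two mixed terms cancel because
  a + 2l = b + 2i.\<close>

lemma e_split:
  assumes "0 \<le> a" "0 \<le> b" "b - a = 2 * (l - i)"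
  shows "(q ^ nat a - q ^ nat b) * e 2 i * e 2 l = q ^ nat a * e 2 i * e 2 (l - 1) - q ^ nat b * e 2 (i - 1) * e 2 l"
proof (cases "i < 0 \<or> l < 0")
  case False
  have e: "e 2 (l - 1) = (1 - q ^ nat (2 * l)) * e 2 l" "e 2 (i - 1) = (1 - q ^ nat (2 * i)) * e 2 i"
    by (subst e_pred; simp add: nat_mult_distrib)+
  have "q ^ nat a * q ^ nat (2 * l) = q ^ nat (a + 2 * l)" "q ^ nat b * q ^ nat (2 * i) = q ^ nat (a + 2 * l)"
    using assms False by (auto intro!: q_mult_nat)
  moreover have "q ^ nat a * e 2 i * ((1 - ql) * e 2 l) - q ^ nat b * ((1 - qi) * e 2 i) * e 2 l =
    (q ^ nat a - q ^ nat b) * e 2 i * e 2 l - (q ^ nat a * ql - q ^ nat b * qi) * (e 2 i * e 2 l)" for ql qi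
    by (simp add: algebra_simps)
  ultimately show ?thesis unfolding e by simp
qed auto

text \<open>The same change of indices for the pair multiplied by q^(2n). Here the two leading terms
  cancel, and the mixed ones absorb the extra factor.\<close>

lemma e_split':
  assumes "0 \<le> a" "0 \<le> b" "0 \<le> c" "0 \<le> n" "a + 2 * n = c + 2 * i" "b + 2 * n = c + 2 * l"
  shows "q ^ nat (2 * n) * ((q ^ nat a - q ^ nat b) * e 2 i * e 2 l) = q ^ nat c * e 2 i * e 2 (l - 1) - q ^ nat c * e 2 (i - 1) * e 2 l"
proof (cases "i < 0 \<or> l < 0")
  case False
  have e: "e 2 (l - 1) = (1 - q ^ nat (2 * l)) * e 2 l" "e 2 (i - 1) = (1 - q ^ nat (2 * i)) * e 2 i"
    by (subst e_pred; simp add: nat_mult_distrib)+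
  have "q ^ nat a * q ^ nat (2 * n) = q ^ nat (a + 2 * n)" "q ^ nat c * q ^ nat (2 * i) = q ^ nat (a + 2 * n)"
    "q ^ nat b * q ^ nat (2 * n) = q ^ nat (b + 2 * n)" "q ^ nat c * q ^ nat (2 * l) = q ^ nat (b + 2 * n)"
    using assms False by (auto intro!: q_mult_nat)
  moreover have "q ^ nat (2 * n) * ((q ^ nat a - q ^ nat b) * e 2 i * e 2 l) =
    (q ^ nat a * q ^ nat (2 * n) - q ^ nat b * q ^ nat (2 * n)) * (e 2 i * e 2 l)"
    by (simp add: algebra_simps)
  moreover have "q ^ nat c * e 2 i * ((1 - ql) * e 2 l) - q ^ nat c * ((1 - qi) * e 2 i) * e 2 l =
    (q ^ nat c * qi - q ^ nat c * ql) * (e 2 i * e 2 l)" for ql qi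
    by (simp add: algebra_simps)
  ultimately show ?thesis unfolding e by simp
qed auto

lemma exponents_nonneg:
  fixes r :: int
  shows "0 \<le> 6 * r^2 - r" "0 \<le> 6 * r^2 + 5 * r + 1" "0 \<le> 6 * r^2 + r" "0 \<le> 6 * r^2 + 7 * r + 2" "0 \<le> 6 * r^2 + 2 * r"
proof -
  have 1: "\<bar>r\<bar> \<le> r^2" by (rule square_ge_abs)
  have 2: "\<bar>r + 1\<bar> \<le> (r + 1)^2" by (rule square_ge_abs)
  have 3: "(r + 1)^2 = r^2 + 2 * r + 1" by (simp add: power2_eq_square algebra_simps)
  show "0 \<le> 6 * r^2 - r" "0 \<le> 6 * r^2 + 5 * r + 1" "0 \<le> 6 * r^2 + r" "0 \<le> 6 * r^2 + 2 * r"
    using 1 by linarith+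
  show "0 \<le> 6 * r^2 + 7 * r + 2" using 1 2 unfolding 3 by linarith
qed

lemma delta_e_v: "delta j * e 2 (2 * int j) = v j"
  unfolding delta_def v_def using qodd_e[of j] by (simp add: mult.assoc)

text \<open>The case s = 1 of the Bailey pair. The quadratic coefficient 21 is 12 from the pair plus
  9 from \<open>Phi\<close> at 3r and 3r + 1.\<close>

lemma slater1: "infsum v UNIV = Phi 0 * (theta 2 0 + theta 16 3)"
proof -
  define a where "a = (\<lambda>r :: int. 2 * (6 * r^2 - r))"
  define b where "b = (\<lambda>r :: int. 2 * (6 * r^2 + 5 * r + 1))"
  have "infsum (\<lambda>j. delta j * e 2 (2 * int j)) UNIV =
    infsum (\<lambda>r. q ^ nat (a r) * Phi (3 * r) - q ^ nat (b r) * Phi (3 * r + 1)) UNIV"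
  proof (rule bailey_limit)
    fix n N :: nat assume N: "n \<le> N" "1 \<le> N"
    show "e 2 (2 * int n) = (\<Sum>r\<in>{- int N..int N}. q ^ nat (a r) * e 2 (int n - 3 * r) * e 2 (int n + 3 * r) -
         q ^ nat (b r) * e 2 (int n - (3 * r + 1)) * e 2 (int n + (3 * r + 1)))" (is "_ = ?rhs")
    proof -
      have "e 2 (2 * int n) = (\<Sum>r\<in>{- int N..int N}. (q ^ nat (2 * (6 * r^2 + (2 * 1 - 3) * r)) -
         q ^ nat (2 * ((6 * r^2 + (2 * 1 - 3) * r) + 6 * r + 1))) * e 2 (int n - 3 * r) * e 2 (int n + 1 + 3 * r))"
        using bailey_fps[of 1 n N] N by simp
      also have "\<dots> = ?rhs"
      proof (rule sum.cong[OF refl], goal_cases)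
        case (1 r)
        have ab: "2 * (6 * r^2 + (2 * 1 - 3) * r) = a r" "2 * ((6 * r^2 + (2 * 1 - 3) * r) + 6 * r + 1) = b r"
          by (simp_all add: a_def b_def algebra_simps)
        have i: "int n + (3 * r + 1) - 1 = int n + 3 * r" "int n - 3 * r - 1 = int n - (3 * r + 1)"
          "int n + 1 + 3 * r = int n + (3 * r + 1)" by simp_all
        have "(q ^ nat (a r) - q ^ nat (b r)) * e 2 (int n - 3 * r) * e 2 (int n + 1 + 3 * r) =
          q ^ nat (a r) * e 2 (int n - 3 * r) * e 2 (int n + 1 + 3 * r - 1) - q ^ nat (b r) * e 2 (int n - 3 * r - 1) * e 2 (int n + 1 + 3 * r)"
          by (rule e_split, unfold a_def b_def) (use exponents_nonneg[of r] in presburger)+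
        then show ?case unfolding ab i .
      qed
      finally show ?thesis .
    qed
  qed
  also have "\<dots> = infsum (\<lambda>r. Phi 0 * (int_sign r * q ^ nat (21 * r^2 + (- 2) * r + 0) + 1 * (int_sign r * q ^ nat (21 * r^2 + 16 * r + 3)))) UNIV"
  proof (rule infsum_cong, goal_cases)
    case (1 r)
    have sq: "(3 * r + 1)^2 = 9 * r^2 + 6 * r + 1" by (simp add: power2_eq_square algebra_simps)
    have r2: "0 \<le> r^2" "0 \<le> 9 * r^2 + 6 * r + 1" using zero_le_power2[of "3 * r + 1"] unfolding sq by simp_all
    have 1: "q ^ nat (a r) * q ^ nat (9 * r^2) = q ^ nat (21 * r^2 + (- 2) * r + 0)"
      by (rule q_mult_nat, unfold a_def sq) (use exponents_nonneg[of r] r2 in presburger)+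
    have 2: "q ^ nat (b r) * q ^ nat ((3 * r + 1)^2) = q ^ nat (21 * r^2 + 16 * r + 3)"
      by (rule q_mult_nat, unfold b_def sq) (use exponents_nonneg[of r] r2 in presburger)+
    show ?case unfolding Phi_3 1[symmetric] 2[symmetric] by (simp add: algebra_simps)
  qed
  also have "\<dots> = Phi 0 * (theta (- 2) 0 + 1 * theta 16 3)" by (rule theta_combine; rule theta_boundI; simp)
  finally show ?thesis unfolding delta_e_v theta_reflect by simp
qed

text \<open>The pair of \<open>slater1\<close> times q^(2n), which supplies the factor q^(2j) in
  \<open>v_u\<close>; both coefficient sequences then share the exponent c.\<close>

lemma slater2: "infsum (\<lambda>j. u j * (1 + q ^ (2 * j + 1))) UNIV = Phi 0 * (theta (- 4) 0 + theta 10 1)"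
proof -
  define a where "a = (\<lambda>r :: int. 2 * (6 * r^2 - r))"
  define b where "b = (\<lambda>r :: int. 2 * (6 * r^2 + 5 * r + 1))"
  define c where "c = (\<lambda>r :: int. 2 * (6 * r^2 + 2 * r))"
  have "infsum (\<lambda>j. delta j * (q ^ (2 * j) * e 2 (2 * int j))) UNIV =
    infsum (\<lambda>r. q ^ nat (c r) * Phi (3 * r) - q ^ nat (c r) * Phi (3 * r + 1)) UNIV"
  proof (rule bailey_limit)
    fix n N :: nat assume N: "n \<le> N" "1 \<le> N"
    show "q ^ (2 * n) * e 2 (2 * int n) = (\<Sum>r\<in>{- int N..int N}. q ^ nat (c r) * e 2 (int n - 3 * r) * e 2 (int n + 3 * r) -
         q ^ nat (c r) * e 2 (int n - (3 * r + 1)) * e 2 (int n + (3 * r + 1)))" (is "_ = ?rhs")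
    proof -
      have "q ^ (2 * n) * e 2 (2 * int n) = (\<Sum>r\<in>{- int N..int N}. q ^ (2 * n) * ((q ^ nat (2 * (6 * r^2 + (2 * 1 - 3) * r)) -
         q ^ nat (2 * ((6 * r^2 + (2 * 1 - 3) * r) + 6 * r + 1))) * e 2 (int n - 3 * r) * e 2 (int n + 1 + 3 * r)))"
        unfolding sum_distrib_left[symmetric] using bailey_fps[of 1 n N] N by simp
      also have "\<dots> = ?rhs"
      proof (rule sum.cong[OF refl], goal_cases)
        case (1 r)
        have ab: "2 * (6 * r^2 + (2 * 1 - 3) * r) = a r" "2 * ((6 * r^2 + (2 * 1 - 3) * r) + 6 * r + 1) = b r"
          by (simp_all add: a_def b_def algebra_simps)
        have i: "int n + (3 * r + 1) - 1 = int n + 3 * r" "int n - 3 * r - 1 = int n - (3 * r + 1)"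
          "int n + 1 + 3 * r = int n + (3 * r + 1)" and n: "nat (2 * int n) = 2 * n" by simp_all
        have "q ^ nat (2 * int n) * ((q ^ nat (a r) - q ^ nat (b r)) * e 2 (int n - 3 * r) * e 2 (int n + 1 + 3 * r)) =
          q ^ nat (c r) * e 2 (int n - 3 * r) * e 2 (int n + 1 + 3 * r - 1) - q ^ nat (c r) * e 2 (int n - 3 * r - 1) * e 2 (int n + 1 + 3 * r)"
          by (rule e_split', unfold a_def b_def c_def) (use exponents_nonneg[of r] in \<open>presburger | simp\<close>)+
        then show ?case unfolding ab i n .
      qed
      finally show ?thesis .
    qed
  qed
  also have "\<dots> = infsum (\<lambda>r. Phi 0 * (int_sign r * q ^ nat (21 * r^2 + 4 * r + 0) + 1 * (int_sign r * q ^ nat (21 * r^2 + 10 * r + 1)))) UNIV"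
  proof (rule infsum_cong, goal_cases)
    case (1 r)
    have sq: "(3 * r + 1)^2 = 9 * r^2 + 6 * r + 1" by (simp add: power2_eq_square algebra_simps)
    have r2: "0 \<le> r^2" "0 \<le> 9 * r^2 + 6 * r + 1" using zero_le_power2[of "3 * r + 1"] unfolding sq by simp_all
    have 1: "q ^ nat (c r) * q ^ nat (9 * r^2) = q ^ nat (21 * r^2 + 4 * r + 0)"
      by (rule q_mult_nat, unfold c_def sq) (use exponents_nonneg[of r] r2 in presburger)+
    have 2: "q ^ nat (c r) * q ^ nat ((3 * r + 1)^2) = q ^ nat (21 * r^2 + 10 * r + 1)"
      by (rule q_mult_nat, unfold c_def sq) (use exponents_nonneg[of r] r2 in presburger)+
    show ?case unfolding Phi_3 1[symmetric] 2[symmetric] by (simp add: algebra_simps)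
  qed
  also have "\<dots> = Phi 0 * (theta 4 0 + 1 * theta 10 1)" by (rule theta_combine; rule theta_boundI; simp)
  also have "(\<lambda>j. delta j * (q ^ (2 * j) * e 2 (2 * int j))) = (\<lambda>j. u j * (1 + q ^ (2 * j + 1)))"
    unfolding v_u[symmetric] delta_e_v[symmetric] by (simp only: ac_simps)
  finally show ?thesis unfolding theta_reflect by simp
qed

text \<open>The case s = 2 taken at n - 1, so that both reciprocals already have the form n - k, n +
  k with k = 3r + 1 and no splitting is required. An index shift in j identifies the left side as -q
  times the sum of \<open>u\<close>, and the same factor q comes out of the theta exponents.\<close>

lemma slater3: "infsum u UNIV = Phi 0 * (theta 8 0 - theta 20 4)"
proof -
  define a where "a = (\<lambda>r :: int. 2 * (6 * r^2 + r))"
  define b where "b = (\<lambda>r :: int. 2 * (6 * r^2 + 7 * r + 2))"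
  have "infsum (\<lambda>j. delta j * e 2 (2 * int j - 1)) UNIV =
    infsum (\<lambda>r. 0 * Phi (3 * r) - (- (q ^ nat (a r) - q ^ nat (b r))) * Phi (3 * r + 1)) UNIV"
  proof (rule bailey_limit)
    fix n N :: nat assume N: "n \<le> N" "1 \<le> N"
    show "e 2 (2 * int n - 1) = (\<Sum>r\<in>{- int N..int N}. 0 * e 2 (int n - 3 * r) * e 2 (int n + 3 * r) -
         (- (q ^ nat (a r) - q ^ nat (b r))) * e 2 (int n - (3 * r + 1)) * e 2 (int n + (3 * r + 1)))"
    proof (cases n)
      case 0
      have "e 2 (int n - (3 * r + 1)) = 0 \<or> e 2 (int n + (3 * r + 1)) = 0" for r
        unfolding 0 by (cases "0 \<le> r") auto
      then have z: "(- (q ^ nat (a r) - q ^ nat (b r))) * e 2 (int n - (3 * r + 1)) * e 2 (int n + (3 * r + 1)) = 0" for r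
        by (metis mult_zero_left mult_zero_right)
      have "e 2 (2 * int n - 1) = 0" using 0 by simp
      then show ?thesis unfolding z by simp
    next
      case (Suc m)
      have "e 2 (2 * int n - 1) = (\<Sum>r\<in>{- int N..int N}. (q ^ nat (2 * (6 * r^2 + (2 * 2 - 3) * r)) -
         q ^ nat (2 * ((6 * r^2 + (2 * 2 - 3) * r) + 6 * r + 2))) * e 2 (int m - 3 * r) * e 2 (int m + 2 + 3 * r))"
        using bailey_fps[of 2 m N] N Suc by simp
      also have "\<dots> = (\<Sum>r\<in>{- int N..int N}. 0 * e 2 (int n - 3 * r) * e 2 (int n + 3 * r) -
         (- (q ^ nat (a r) - q ^ nat (b r))) * e 2 (int n - (3 * r + 1)) * e 2 (int n + (3 * r + 1)))"
      proof (rule sum.cong[OF refl], goal_cases)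
        case (1 r)
        have ab: "2 * (6 * r^2 + (2 * 2 - 3) * r) = a r" "2 * ((6 * r^2 + (2 * 2 - 3) * r) + 6 * r + 2) = b r"
          by (simp_all add: a_def b_def algebra_simps)
        have i: "int m - 3 * r = int n - (3 * r + 1)" "int m + 2 + 3 * r = int n + (3 * r + 1)" using Suc by simp_all
        show ?case unfolding ab i by (simp only: mult_zero_left mult_minus_left minus_minus diff_0)
      qed
      finally show ?thesis .
    qed
  qed
  also have "\<dots> = infsum (\<lambda>r. - (q * Phi 0) * (int_sign r * q ^ nat (21 * r^2 + 8 * r + 0) + (- 1) * (int_sign r * q ^ nat (21 * r^2 + 20 * r + 4)))) UNIV"
  proof (rule infsum_cong, goal_cases)
    case (1 r)
    have sq: "(3 * r + 1)^2 = 9 * r^2 + 6 * r + 1" by (simp add: power2_eq_square algebra_simps)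
    have r2: "0 \<le> r^2" "0 \<le> 9 * r^2 + 6 * r + 1" using zero_le_power2[of "3 * r + 1"] unfolding sq by simp_all
    have mult_q: "q * q ^ nat a = q ^ nat (1 + a)" if "0 \<le> a" for a
      using that by (simp add: nat_add_distrib)
    have p: "0 \<le> 21 * r^2 + 8 * r + 0" "0 \<le> 21 * r^2 + 20 * r + 4"
      using square_ge_abs[of r] by linarith+
    have 1: "q ^ nat (a r) * q ^ nat ((3 * r + 1)^2) = q * q ^ nat (21 * r^2 + 8 * r + 0)"
      unfolding mult_q[OF p(1)]
      by (rule q_mult_nat, unfold a_def sq) (use exponents_nonneg[of r] r2 in presburger)+
    have 2: "q ^ nat (b r) * q ^ nat ((3 * r + 1)^2) = q * q ^ nat (21 * r^2 + 20 * r + 4)"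
      unfolding mult_q[OF p(2)]
      by (rule q_mult_nat, unfold b_def sq) (use exponents_nonneg[of r] r2 in presburger)+
    have "0 * Phi (3 * r) - (- (q ^ nat (a r) - q ^ nat (b r))) * Phi (3 * r + 1) =
       - (int_sign r * Phi 0 * (q ^ nat (a r) * q ^ nat ((3 * r + 1)^2) - q ^ nat (b r) * q ^ nat ((3 * r + 1)^2)))"
      unfolding Phi_3 by (simp add: algebra_simps)
    then show ?case unfolding 1 2 by (simp add: algebra_simps)
  qed
  also have "\<dots> = - (q * Phi 0) * (theta 8 0 + (- 1) * theta 20 4)" by (rule theta_combine; rule theta_boundI; simp)
  finally have *: "infsum (\<lambda>j. delta j * e 2 (2 * int j - 1)) UNIV = - q * (Phi 0 * (theta 8 0 - theta 20 4))" by simp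
  have "infsum (\<lambda>j. delta j * e 2 (2 * int j - 1)) UNIV = - q * infsum u UNIV"
  proof (rule infsum_fps_shift_zero[OF u_dvd dvd_mult2[OF delta_dvd]])
    show "delta 0 * e 2 (2 * int 0 - 1) = 0" by simp
    fix j
    have "delta (Suc j) * e 2 (2 * int (Suc j) - 1) = - q * (q ^ (2 * j) * (delta j * ((1 - q ^ (2 * j + 1)) * e 2 (2 * int j + 1))))"
      unfolding delta_Suc by (simp add: algebra_simps)
    also have "delta j * ((1 - q ^ (2 * j + 1)) * e 2 (2 * int j + 1)) = v j * inverse (qplus (2 * j + 1)) * qplus (2 * j)"
    proof -
      have e: "(1 - q ^ (2 * j + 1)) * (1 + q ^ (2 * j + 1)) * e 2 (2 * int j + 1) = e 2 (2 * int j)"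
      proof -
        have "(1 - q ^ (2 * j + 1)) * (1 + q ^ (2 * j + 1)) = 1 - q ^ (2 * j + 1) * q ^ (2 * j + 1)" by (simp add: algebra_simps)
        also have "q ^ (2 * j + 1) * q ^ (2 * j + 1) = q ^ (2 * Suc (2 * j))"
          by (simp only: power_add[symmetric], rule power_cong_exp) simp
        finally show ?thesis using e_Suc[of 2 "2 * j"] by (simp add: add.commute)
      qed
      have qplus: "inverse (qplus (2 * j + 1)) * qplus (2 * j) * (1 + q ^ (2 * j + 1)) = 1"
        using inverse_qplus_Suc[of "2 * j"] qplus_inverse[of "2 * j"] by (simp add: ac_simps)
      have "delta j * ((1 - q ^ (2 * j + 1)) * e 2 (2 * int j + 1)) =
        delta j * ((1 - q ^ (2 * j + 1)) * e 2 (2 * int j + 1)) * (inverse (qplus (2 * j + 1)) * qplus (2 * j) * (1 + q ^ (2 * j + 1)))"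
        unfolding qplus by simp
      also have "\<dots> = delta j * ((1 - q ^ (2 * j + 1)) * (1 + q ^ (2 * j + 1)) * e 2 (2 * int j + 1)) * inverse (qplus (2 * j + 1)) * qplus (2 * j)"
        by (simp only: ac_simps)
      finally show ?thesis unfolding e delta_e_v .
    qed
    also have "q ^ (2 * j) * (v j * inverse (qplus (2 * j + 1)) * qplus (2 * j)) = u j"
    proof -
      have "q ^ (2 * j) * (v j * inverse (qplus (2 * j + 1)) * qplus (2 * j)) = (q ^ (2 * j) * v j) * inverse (qplus (2 * j + 1)) * qplus (2 * j)"
        by (simp only: ac_simps)
      also have "\<dots> = u j * (inverse (qplus (2 * j + 1)) * (1 + q ^ (2 * j + 1)) * qplus (2 * j))"
        unfolding v_u by (simp only: ac_simps)
      also have "inverse (qplus (2 * j + 1)) * (1 + q ^ (2 * j + 1)) * qplus (2 * j) = 1"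
        using inverse_qplus_Suc[of "2 * j"] qplus_inverse[of "2 * j"] by simp
      finally show ?thesis by simp
    qed
    finally show "delta (Suc j) * e 2 (2 * int (Suc j) - 1) = - q * u j" .
  qed
  with * have "- q * infsum u UNIV = - q * (Phi 0 * (theta 8 0 - theta 20 4))" by simp
  then show ?thesis by (simp only: mult_cancel_left) simp
qed

section \<open>The quintuple product modulo 14\<close>

abbreviation "r14 c \<equiv> rpoch c 14"

definition qp14 :: "nat \<Rightarrow> rat fps" where "qp14 c = qpoch (q ^ c) (q ^ 14) \<infinity>"

lemma qp14_nth_0: "0 < c \<Longrightarrow> fps_nth (qp14 c) 0 = 1"
  unfolding qp14_def by (rule qpoch_inf_nth_0) simp_all

lemma r14_tendsto: "0 < c \<Longrightarrow> (\<lambda>n. r14 c (int n + k)) \<longlonglongrightarrow> inverse (qp14 c)"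
  unfolding qp14_def by (rule rpoch_tendsto) simp_all

lemma fls_X_power_powi: "(fls_X ^ n :: rat fls) powi j = fls_X powi (int n * j)"
  by (simp only: power_int_of_nat[symmetric] power_int_mult[symmetric])

lemma to_fls_one_minus: "0 \<le> i \<Longrightarrow> 1 - fls_X powi i = fps_to_fls (1 - q ^ nat i)"
  by (simp only: fps_to_fls_minus to_fls_q_power fps_one_to_fls)

text \<open>The specialisation x = q^14, y = q^7, z = q^a. The bounds on a keep 2a and 14 - 2a
  positive, so every factor of the reciprocal products is invertible.\<close>

lemma quintuple_fps:
  assumes a: "0 < a" "a < 7"
  defines "R \<equiv> \<lambda>m. e 14 (int (2 * m)) * r14 a (int m + 1) * r14 (14 - a) (int m)"
  shows "(\<Sum>k\<in>{- int m..int m}. (int_sign k * q ^ nat (21 * k^2 + (3 * int a - 7) * k + 0) +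
      1 * (int_sign k * q ^ nat (21 * k^2 + (3 * int a + 7) * k + int a))) *
      (e 14 (int m + k) * r14 (2 * a) (int m + k + 1) * (e 14 (int m - k) * r14 (14 - 2 * a) (int m - k)))) = R m"
proof -
  let ?x = "fls_X ^ 14 :: rat fls" and ?y = "fls_X ^ 7 :: rat fls" and ?z = "fls_X ^ a :: rat fls"
  \<comment> \<open>The offset j + 1 reflects that (z^2; x) begins with the factor 1 - z^2, which
    the recurrence attaches to j = 0.\<close>
  define E1 where "E1 j = fps_to_fls (e 14 j * r14 (2 * a) (j + 1))" for j
  define E2 where "E2 j = fps_to_fls (e 14 j * r14 (14 - 2 * a) j)" for j
  let ?G = "\<lambda>k. (int_sign k * q ^ nat (21 * k^2 + (3 * int a - 7) * k + 0) +
      1 * (int_sign k * q ^ nat (21 * k^2 + (3 * int a + 7) * k + int a))) *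
      (e 14 (int m + k) * r14 (2 * a) (int m + k + 1) * (e 14 (int m - k) * r14 (14 - 2 * a) (int m - k)))"
  let ?W = "\<lambda>k. (-1) powi k * ?z powi (3 * k) * ?y powi (3 * k^2 - k) *
      (1 + ?z * ?x powi k) * E1 (int m + k) * E2 (int m - k)"
  have X: "(fls_X :: rat fls) \<noteq> 0" by simp
  note pa = power_int_add[OF disjI1[OF X], symmetric]
  have xj: "?x powi j = fls_X powi (14 * j)" for j
    unfolding fls_X_power_powi by simp
  have z: "?z = fls_X powi int a" by (simp only: power_int_of_nat)
  have z2: "?z^2 = fls_X powi (2 * int a)"
    unfolding z power2_eq_square pa by (rule arg_cong[where f = "power_int fls_X"]) simp
  have zx: "?z * ?x powi j = fls_X powi (int a + 14 * j)" for j
    unfolding z xj pa ..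
  have zx': "?x powi j / ?z = fls_X powi (14 * j - int a)" for j
    unfolding z xj by (rule power_int_diff[symmetric]) simp
  have z2x: "?z^2 * ?x powi j = fls_X powi (2 * int a + 14 * j)" for j
    unfolding z2 xj pa ..
  have z2x': "?x powi j / ?z^2 = fls_X powi (14 * j - 2 * int a)" for j
    unfolding z2 xj by (rule power_int_diff[symmetric]) simp
  have e14: "e 14 (j - 1) = (1 - q ^ nat (14 * j)) * e 14 j" for j
    by (subst e_pred) (simp_all add: nat_mult_distrib)
  have r14_rec: "r14 c j = (1 - q ^ nat (int c + 14 * j)) * r14 c (j + 1)" if "0 < c" "0 \<le> j" for c j
  proof -
    have "int (Suc (nat j)) = j + 1" "int (nat j) = j" using that by auto
    moreover have "nat (int c + 14 * j) = c + 14 * nat j" using that by (simp add: nat_add_distrib nat_mult_distrib)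
    ultimately show ?thesis using rpoch_Suc[OF that(1), of 14 "nat j"] by (simp only:)
  qed
  have E1_rec: "E1 (j - 1) = (1 - ?x powi j) * (1 - ?z^2 * ?x powi j) * E1 j" for j
  proof (cases "j < 0")
    case False
    then have "r14 (2 * a) j = (1 - q ^ nat (2 * int a + 14 * j)) * r14 (2 * a) (j + 1)"
      using r14_rec[of "2 * a" j] a by simp
    then have "e 14 (j - 1) * r14 (2 * a) (j - 1 + 1) =
      (1 - q ^ nat (14 * j)) * (1 - q ^ nat (2 * int a + 14 * j)) * (e 14 j * r14 (2 * a) (j + 1))"
      unfolding e14 by (simp add: ac_simps)
    moreover have "0 \<le> 14 * j" "0 \<le> 2 * int a + 14 * j" using False by auto
    ultimately show ?thesis unfolding z2x unfolding E1_def xj by (simp only: to_fls_one_minus to_fls_mult)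
  qed (simp add: E1_def)
  have E2_rec: "E2 (j - 1) = (1 - ?x powi j) * (1 - ?x powi j / ?z^2) * E2 j" for j
  proof (cases "j \<le> 0")
    case True
    then show ?thesis by (cases "j = 0") (simp_all add: E2_def)
  next
    case False
    have "int (14 - 2 * a) + 14 * (j - 1) = 14 * j - 2 * int a" using a by (simp add: of_nat_diff)
    then have "r14 (14 - 2 * a) (j - 1) = (1 - q ^ nat (14 * j - 2 * int a)) * r14 (14 - 2 * a) j"
      using r14_rec[of "14 - 2 * a" "j - 1"] a False by simp
    then have "e 14 (j - 1) * r14 (14 - 2 * a) (j - 1) =
      (1 - q ^ nat (14 * j)) * (1 - q ^ nat (14 * j - 2 * int a)) * (e 14 j * r14 (14 - 2 * a) j)"
      unfolding e14 by (simp add: ac_simps)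
    moreover have "0 \<le> 14 * j" "0 \<le> 14 * j - 2 * int a" using False a by auto
    ultimately show ?thesis unfolding z2x' unfolding E2_def xj by (simp only: to_fls_one_minus to_fls_mult)
  qed
  have factors: "(1 - (?x powi (int m + 1))^2) * (1 - (?x powi (int m + 1))^2 / ?x) *
      ((1 - ?z * ?x powi (int m + 1)) * (1 - ?x powi (int m + 1) / ?z)) =
    fps_to_fls ((1 - q ^ (14 * (2 * m + 2))) * (1 - q ^ (14 * (2 * m + 1))) *
      ((1 - q ^ (a + 14 * (m + 1))) * (1 - q ^ (14 - a + 14 * m))))" for m
  proof -
    have 1: "(?x powi (int m + 1))^2 = fls_X powi (14 * (2 * int m + 2))"
      unfolding xj power2_eq_square pa by (rule arg_cong[where f = "power_int fls_X"]) simp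
    have 2: "(?x powi (int m + 1))^2 / ?x = fls_X powi (14 * (2 * int m + 1))"
    proof -
      have "?x = fls_X powi 14" by (simp only: power_int_numeral)
      then have "(?x powi (int m + 1))^2 / ?x = fls_X powi (14 * (2 * int m + 2) - 14)"
        unfolding 1 by (simp only: power_int_diff[OF disjI1[OF X]])
      also have "14 * (2 * int m + 2) - 14 = 14 * (2 * int m + 1)" by simp
      finally show ?thesis .
    qed
    have nats: "nat (14 * (2 * int m + 2)) = 14 * (2 * m + 2)" "nat (14 * (2 * int m + 1)) = 14 * (2 * m + 1)"
      "nat (int a + 14 * (int m + 1)) = a + 14 * (m + 1)" "nat (14 * (int m + 1) - int a) = 14 - a + 14 * m"
      using a by (simp_all add: nat_eq_iff of_nat_diff algebra_simps)
    have nn: "0 \<le> 14 * (2 * int m + 2)" "0 \<le> 14 * (2 * int m + 1)"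
      "0 \<le> int a + 14 * (int m + 1)" "0 \<le> 14 * (int m + 1) - int a" using a by auto
    show ?thesis unfolding 2 unfolding 1 zx zx' to_fls_one_minus[OF nn(1)] to_fls_one_minus[OF nn(2)] to_fls_one_minus[OF nn(3)]
        to_fls_one_minus[OF nn(4)] nats by (simp only: to_fls_mult)
  qed
  have R_rec: "(1 - q ^ (14 * (2 * m + 2))) * (1 - q ^ (14 * (2 * m + 1))) *
      ((1 - q ^ (a + 14 * (m + 1))) * (1 - q ^ (14 - a + 14 * m))) * R (Suc m) = R m" for m
  proof -
    have 1: "(1 - q ^ (14 * (2 * m + 1))) * ((1 - q ^ (14 * (2 * m + 2))) * e 14 (int (2 * Suc m))) = e 14 (int (2 * m))"
      using e_Suc[of 14 "2 * m + 1"] e_Suc[of 14 "2 * m"] by simp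
    have 2: "(1 - q ^ (a + 14 * (m + 1))) * r14 a (int (Suc m) + 1) = r14 a (int m + 1)"
      using rpoch_Suc[of a 14 "m + 1"] a by (simp add: add.commute)
    have 3: "(1 - q ^ (14 - a + 14 * m)) * r14 (14 - a) (int (Suc m)) = r14 (14 - a) (int m)"
      using rpoch_Suc[of "14 - a" 14 m] a by simp
    have "(1 - q ^ (14 * (2 * m + 2))) * (1 - q ^ (14 * (2 * m + 1))) *
      ((1 - q ^ (a + 14 * (m + 1))) * (1 - q ^ (14 - a + 14 * m))) * R (Suc m) =
      ((1 - q ^ (14 * (2 * m + 1))) * ((1 - q ^ (14 * (2 * m + 2))) * e 14 (int (2 * Suc m)))) *
      ((1 - q ^ (a + 14 * (m + 1))) * r14 a (int (Suc m) + 1)) * ((1 - q ^ (14 - a + 14 * m)) * r14 (14 - a) (int (Suc m)))"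
      unfolding R_def by (simp only: ac_simps)
    then show ?thesis unfolding 1 2 3 R_def .
  qed
  \<comment> \<open>The factor 1 + q^a cancels into 1 - q^(2a) and leaves 1 - q^a, the first factor
    counted by \<open>r14 a\<close>.\<close>
  have R_0: "(1 + ?z) * E1 0 * E2 0 = fps_to_fls (R 0)"
  proof -
    have "(1 - q ^ a) * ((1 + q ^ a) * r14 (2 * a) 1) = (1 - q ^ (2 * a)) * r14 (2 * a) 1"
      unfolding mult_2 power_add by (simp add: algebra_simps)
    also have "\<dots> = 1" using rpoch_Suc[of "2 * a" 14 0] a by (simp add: rpoch_0)
    also have "1 = (1 - q ^ a) * r14 a 1" using rpoch_Suc[of a 14 0] a by (simp add: rpoch_0)
    finally have "(1 + q ^ a) * r14 (2 * a) 1 = r14 a 1"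
      using one_minus_q_power_nz[OF a(1)] by (simp only: mult_cancel_left) simp
    then have "R 0 = (1 + q ^ a) * (e 14 0 * r14 (2 * a) (0 + 1)) * (e 14 0 * r14 (14 - 2 * a) 0)"
      unfolding R_def by (simp add: rpoch_0)
    then show ?thesis unfolding E1_def E2_def by (simp only: to_fls_mult fps_to_fls_plus fps_one_to_fls fps_to_fls_power fps_X_to_fls)
  qed
  have y: "?y \<noteq> 0" "?z \<noteq> 0" by simp_all
  have xy: "?x = ?y^2" by (simp only: power_mult[symmetric]) simp
  have "(\<Sum>k\<in>{- int m..int m}. ?W k) = fps_to_fls (R m)"
  proof (rule quintuple_field[where R = "\<lambda>m. fps_to_fls (R m)", OF y xy _ _ E1_rec E2_rec R_0 _ _ order_refl])
    show "E1 j = 0" if "j < 0" for j using that by (simp add: E1_def)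
    show "E2 j = 0" if "j < 0" for j using that by (simp add: E2_def)
    show "(1 - (?x powi (int m + 1))^2) * (1 - (?x powi (int m + 1))^2 / ?x) *
          ((1 - ?z * ?x powi (int m + 1)) * (1 - ?x powi (int m + 1) / ?z)) * fps_to_fls (R (Suc m)) =
          fps_to_fls (R m)" for m
      unfolding factors to_fls_mult[symmetric] R_rec ..
    have "(1 - q ^ (14 * (2 * m + 2))) * (1 - q ^ (14 * (2 * m + 1))) *
      ((1 - q ^ (a + 14 * (m + 1))) * (1 - q ^ (14 - a + 14 * m))) \<noteq> 0" for m
      unfolding mult_eq_0_iff de_Morgan_disj using a by (intro conjI one_minus_q_power_nz) auto
    then show "(1 - (?x powi (int m + 1))^2) * (1 - (?x powi (int m + 1))^2 / ?x) *
          ((1 - ?z * ?x powi (int m + 1)) * (1 - ?x powi (int m + 1) / ?z)) \<noteq> 0" for m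
      unfolding factors by (rule fps_to_fls_nonzeroI)
  qed
  also have "(\<Sum>k\<in>{- int m..int m}. ?W k) =
    fps_to_fls (\<Sum>k\<in>{- int m..int m}. ?G k)"
    unfolding to_fls_sum
  proof (rule sum.cong[OF refl], goal_cases)
    case (1 k)
    have k2: "\<bar>k\<bar> \<le> k^2" by (rule square_ge_abs)
    have n1: "0 \<le> 21 * k^2 + (3 * int a - 7) * k + 0"
    proof -
      have "\<bar>(3 * int a - 7) * k\<bar> \<le> 20 * \<bar>k\<bar>" unfolding abs_mult using a by (intro mult_right_mono) auto
      then show ?thesis using k2 by linarith
    qed
    have n2: "0 \<le> 21 * k^2 + (3 * int a + 7) * k + int a"
    proof (cases "0 \<le> k")
      case True
      then show ?thesis by (intro add_nonneg_nonneg mult_nonneg_nonneg) auto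
    next
      case False
      have "\<bar>k + 1\<bar> \<le> (k + 1)^2" by (rule square_ge_abs)
      then have "- (k + 1) \<le> k^2 + 2 * k + 1" using False by (simp add: power2_eq_square algebra_simps)
      moreover have "(25 - (3 * int a + 7)) * k \<le> 0" using False a by (intro mult_nonneg_nonpos) auto
      ultimately have "25 * k \<le> (3 * int a + 7) * k" by (simp add: algebra_simps)
      show ?thesis
      proof (cases "k = -1")
        case True
        then show ?thesis using a by simp
      next
        case F: False
        then have "0 \<le> (- k) * (- k - 2)" using False by (intro mult_nonneg_nonneg) auto
        then have "2 * (- k) \<le> k^2" by (simp add: power2_eq_square algebra_simps)
        then show ?thesis using \<open>25 * k \<le> (3 * int a + 7) * k\<close> False by linarith
      qed
    qed
    have s: "(-1) powi k = fps_to_fls (int_sign k)"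
      by (simp add: int_sign_def power_int_minus_one_minus power_int_def minus_one_power_iff even_nat_iff)
    have w: "?z powi (3 * k) * ?y powi (3 * k^2 - k) = fls_X powi (21 * k^2 + (3 * int a - 7) * k + 0)"
      unfolding fls_X_power_powi pa by (rule arg_cong[where f = "power_int fls_X"]) (simp add: algebra_simps)
    have "?z powi (3 * k) * ?y powi (3 * k^2 - k) * (1 + ?z * ?x powi k) =
       fls_X powi (21 * k^2 + (3 * int a - 7) * k + 0) + fls_X powi ((21 * k^2 + (3 * int a - 7) * k + 0) + (int a + 14 * k))"
      unfolding w zx pa[symmetric] by (simp only: distrib_left mult_1_right)
    also have "(21 * k^2 + (3 * int a - 7) * k + 0) + (int a + 14 * k) = 21 * k^2 + (3 * int a + 7) * k + int a"
      by (simp add: algebra_simps)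
    finally have "?z powi (3 * k) * ?y powi (3 * k^2 - k) * (1 + ?z * ?x powi k) =
      fps_to_fls (q ^ nat (21 * k^2 + (3 * int a - 7) * k + 0) + q ^ nat (21 * k^2 + (3 * int a + 7) * k + int a))"
      unfolding fps_to_fls_plus to_fls_q_power[OF n1] to_fls_q_power[OF n2] .
    then have "?W k =
      fps_to_fls (int_sign k) * fps_to_fls (q ^ nat (21 * k^2 + (3 * int a - 7) * k + 0) + q ^ nat (21 * k^2 + (3 * int a + 7) * k + int a)) *
       E1 (int m + k) * E2 (int m - k)"
      unfolding s by (simp only: mult.assoc)
    then show ?case unfolding E1_def E2_def to_fls_mult[symmetric] by (simp only: distrib_left mult_1_left mult.assoc)
  qed
  finally show ?thesis by simp
qed

text \<open>As m grows the reciprocal products attached to the k-th term tend to a constant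
  \<open>C\<close> independent of k, which factors out of the theta series.\<close>

lemma quintuple_limit:
  assumes a: "0 < a" "a < 7" and theta_bound: "theta_bound (3 * int a - 7) 0" "theta_bound (3 * int a + 7) (int a)"
  shows "(theta (3 * int a - 7) 0 + theta (3 * int a + 7) (int a)) * (qp14 a * qp14 (14 - a)) = qp14 14 * qp14 (2 * a) * qp14 (14 - 2 * a)"
proof -
  let ?K = "\<lambda>m k. e 14 (int m + k) * r14 (2 * a) (int m + k + 1) * (e 14 (int m - k) * r14 (14 - 2 * a) (int m - k))"
  define g where "g k = int_sign k * q ^ nat (21 * k^2 + (3 * int a - 7) * k + 0) +
      1 * (int_sign k * q ^ nat (21 * k^2 + (3 * int a + 7) * k + int a))" for k
  define C where "C = e_inf 14 * inverse (qp14 (2 * a)) * (e_inf 14 * inverse (qp14 (14 - 2 * a)))"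
  have g_dvd: "fps_X ^ nat \<bar>k\<bar> dvd g k" for k
    unfolding g_def mult_1_left by (intro dvd_add theta_dvd theta_bound)
  have e: "(\<lambda>n. e 14 (int n + k)) \<longlonglongrightarrow> e_inf 14" for k
    using e_diff_tendsto[of 14 "- k"] by simp
  have e': "(\<lambda>n. e 14 (int (2 * n))) \<longlonglongrightarrow> e_inf 14"
    by (rule filterlim_compose[OF e_tendsto filterlim_subseq]) (auto simp: strict_mono_def)
  have "(\<lambda>m. \<Sum>k\<in>{- int m..int m}. g k *
      ?K m k)
    \<longlonglongrightarrow> infsum (\<lambda>k. g k * C) UNIV"
  proof (rule fps_tannery_int)
    fix m and k :: int
    show "fps_X ^ nat \<bar>k\<bar> dvd g k * ?K m k"
      by (rule dvd_mult2[OF g_dvd])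
    show "(\<lambda>m. g k * ?K m k)
      \<longlonglongrightarrow> g k * C"
      unfolding C_def
      using r14_tendsto[of "2 * a" "k + 1"] r14_tendsto[of "14 - 2 * a" "- k"] a e[of k] e[of "- k"]
      by (intro fps_tendsto_cmult fps_tendsto_mult) (simp_all add: add.assoc)
    assume "int m < \<bar>k\<bar>"
    then have "int m + k < 0 \<or> int m - k < 0" by auto
    then show "g k * ?K m k = 0"
      by auto
  qed
  moreover have "infsum (\<lambda>k. g k * C) UNIV = C * (theta (3 * int a - 7) 0 + 1 * theta (3 * int a + 7) (int a))"
    unfolding g_def mult.commute[of _ C] by (rule theta_combine[OF theta_bound])
  moreover have "(\<lambda>m. e 14 (int (2 * m)) * r14 a (int m + 1) * r14 (14 - a) (int m)) \<longlonglongrightarrow>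
      e_inf 14 * inverse (qp14 a) * inverse (qp14 (14 - a))"
    using a r14_tendsto[of a 1] r14_tendsto[of "14 - a" 0] by (intro fps_tendsto_mult e') auto
  ultimately have *: "C * (theta (3 * int a - 7) 0 + theta (3 * int a + 7) (int a)) = e_inf 14 * inverse (qp14 a) * inverse (qp14 (14 - a))"
    unfolding g_def quintuple_fps[OF a] by (simp add: LIMSEQ_unique)
  have inv: "inverse (qp14 c) * qp14 c = 1" if "0 < c" for c
    using qp14_nth_0[OF that] by (intro inverse_mult_eq_1) simp
  have E: "e_inf 14 * qp14 14 = 1" unfolding qp14_def by (rule e_inf_mult) simp
  have 1: "C * (qp14 14 * qp14 14 * qp14 (2 * a) * qp14 (14 - 2 * a)) = 1"
  proof -
    have "C * (qp14 14 * qp14 14 * qp14 (2 * a) * qp14 (14 - 2 * a)) =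
      (e_inf 14 * qp14 14) * (e_inf 14 * qp14 14) * (inverse (qp14 (2 * a)) * qp14 (2 * a)) * (inverse (qp14 (14 - 2 * a)) * qp14 (14 - 2 * a))"
      unfolding C_def by (simp only: ac_simps)
    then show ?thesis using a by (simp only: E) (simp add: inv)
  qed
  have "(theta (3 * int a - 7) 0 + theta (3 * int a + 7) (int a)) * (qp14 a * qp14 (14 - a)) =
    (C * (qp14 14 * qp14 14 * qp14 (2 * a) * qp14 (14 - 2 * a))) * (theta (3 * int a - 7) 0 + theta (3 * int a + 7) (int a)) * (qp14 a * qp14 (14 - a))"
    unfolding 1 by simp
  also have "\<dots> = (C * (theta (3 * int a - 7) 0 + theta (3 * int a + 7) (int a))) * (qp14 14 * qp14 14 * qp14 (2 * a) * qp14 (14 - 2 * a)) * (qp14 a * qp14 (14 - a))"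
    by (simp only: ac_simps)
  also have "\<dots> = (e_inf 14 * qp14 14) * (inverse (qp14 a) * qp14 a) * (inverse (qp14 (14 - a)) * qp14 (14 - a)) * (qp14 14 * qp14 (2 * a) * qp14 (14 - 2 * a))"
    unfolding * by (simp only: ac_simps)
  finally show ?thesis using a by (simp only: E) (simp add: inv)
qed

section \<open>Assembling the products\<close>

text \<open>The factors of (q^2; q^2)_inf sorted by residue modulo 14, seven consecutive ones per
  block.\<close>

lemma qp14_split: "qp14 2 * qp14 4 * qp14 6 * qp14 8 * qp14 10 * qp14 12 * qp14 14 * e_inf 2 = 1"
proof -
  have lim: "(\<lambda>n. \<Prod>j<n. 1 - q ^ (c + 14 * j)) \<longlonglongrightarrow> qp14 c" if "0 < c" for c
    using qpoch_tendsto[of "q ^ c" "q ^ 14"] that unfolding qp14_def by (simp add: power_add power_mult)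
  have prod: "(\<Prod>j<7 * n. 1 - q ^ (2 * Suc j)) =
    (\<Prod>j<n. 1 - q ^ (2 + 14 * j)) * (\<Prod>j<n. 1 - q ^ (4 + 14 * j)) * (\<Prod>j<n. 1 - q ^ (6 + 14 * j)) *
    (\<Prod>j<n. 1 - q ^ (8 + 14 * j)) * (\<Prod>j<n. 1 - q ^ (10 + 14 * j)) * (\<Prod>j<n. 1 - q ^ (12 + 14 * j)) * (\<Prod>j<n. 1 - q ^ (14 + 14 * j))" for n
  proof (induction n)
    case (Suc n)
    have 7: "7 * Suc n = Suc (Suc (Suc (Suc (Suc (Suc (Suc (7 * n)))))))" by simp
    have "2 * Suc (7 * n) = 2 + 14 * n" "2 * Suc (Suc (7 * n)) = 4 + 14 * n" "2 * Suc (Suc (Suc (7 * n))) = 6 + 14 * n"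
      "2 * Suc (Suc (Suc (Suc (7 * n)))) = 8 + 14 * n" "2 * Suc (Suc (Suc (Suc (Suc (7 * n))))) = 10 + 14 * n"
      "2 * Suc (Suc (Suc (Suc (Suc (Suc (7 * n)))))) = 12 + 14 * n"
      "2 * Suc (Suc (Suc (Suc (Suc (Suc (Suc (7 * n))))))) = 14 + 14 * n" by simp_all
    then show ?case unfolding 7 prod.lessThan_Suc Suc by (simp only: ac_simps)
  qed simp
  have eq: "q ^ 2 * (q ^ 2) ^ j = q ^ (2 * Suc j)" for j
    by (simp only: power_mult[symmetric] power_add[symmetric], rule power_cong_exp, simp)
  have "(\<lambda>n. \<Prod>j<n. 1 - q ^ (2 * Suc j)) \<longlonglongrightarrow> qpoch (q ^ 2) (q ^ 2) \<infinity>"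
    using qpoch_tendsto[of "q ^ 2" "q ^ 2"] unfolding eq by simp
  then have "(\<lambda>n. \<Prod>j<7 * n. 1 - q ^ (2 * Suc j)) \<longlonglongrightarrow> qpoch (q ^ 2) (q ^ 2) \<infinity>"
    by (rule filterlim_compose) (rule filterlim_subseq, auto simp: strict_mono_def)
  moreover have "(\<lambda>n. \<Prod>j<7 * n. 1 - q ^ (2 * Suc j)) \<longlonglongrightarrow> qp14 2 * qp14 4 * qp14 6 * qp14 8 * qp14 10 * qp14 12 * qp14 14"
    unfolding prod by (intro fps_tendsto_mult lim) auto
  ultimately have "qp14 2 * qp14 4 * qp14 6 * qp14 8 * qp14 10 * qp14 12 * qp14 14 = qpoch (q ^ 2) (q ^ 2) \<infinity>"
    by (rule LIMSEQ_unique[symmetric])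
  then show ?thesis using e_inf_mult[of 2] by (simp add: mult.commute)
qed

lemma divide_eq_fps: "f * g = 1 \<Longrightarrow> 1 / g = f" for f g :: "rat fps"
  by (metis mult_zero_right nonzero_mult_div_cancel_right zero_neq_one)

lemma products:
  shows "qplus_inf * infsum v UNIV = 1 / qpochs [q ^ 2, q ^ 3, q ^ 4, q ^ 10, q ^ 11, q ^ 12] (q ^ 14) \<infinity>"
    and "qplus_inf * infsum (\<lambda>j. u j * (1 + q ^ (2 * j + 1))) UNIV = 1 / qpochs [q, q ^ 4, q ^ 6, q ^ 8, q ^ 10, q ^ 13] (q ^ 14) \<infinity>"
    and "qplus_inf * infsum u UNIV = 1 / qpochs [q ^ 2, q ^ 5, q ^ 6, q ^ 8, q ^ 9, q ^ 12] (q ^ 14) \<infinity>"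
proof -
  have qplus: "qplus_inf * (Phi 0 * t) = e_inf 2 * t" for t
    unfolding Phi_0 using qplus_inf_qodd_inf by (simp add: mult.assoc[symmetric])
  \<comment> \<open>Here w is the denominator of the quintuple product and y the pair of even
    residue classes in its numerator; z consists of the other even classes apart from 14, times
    w.\<close>
  have split: "e_inf 2 * x * z = 1"
    if "x * w = qp14 14 * y" "w * (qp14 2 * qp14 4 * qp14 6 * qp14 8 * qp14 10 * qp14 12) = y * z" "y \<noteq> 0" for x w y z
  proof -
    have "y * (e_inf 2 * x * z) = e_inf 2 * x * (y * z)" by (simp only: ac_simps)
    also have "\<dots> = (x * w) * (e_inf 2 * (qp14 2 * qp14 4 * qp14 6 * qp14 8 * qp14 10 * qp14 12))"
      unfolding that(2)[symmetric] by (simp only: ac_simps)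
    also have "\<dots> = (qp14 2 * qp14 4 * qp14 6 * qp14 8 * qp14 10 * qp14 12 * qp14 14 * e_inf 2) * y"
      unfolding that(1) by (simp only: ac_simps)
    finally have "y * (e_inf 2 * x * z) = y * 1" unfolding qp14_split by simp
    then show ?thesis using that(3) by (simp only: mult_cancel_left) simp
  qed
  have nz: "qp14 c * qp14 d \<noteq> 0" if "0 < c" "0 < d" for c d
    using qp14_nth_0[OF that(1)] qp14_nth_0[OF that(2)] by auto
  \<comment> \<open>The three classes use the quintuple product with a = 3, 1 and 5 in turn; the
    theta series of the Slater sums are those with linear coefficients 3a - 7 and 3a + 7, up to
    reflection.\<close>
  have "(theta 2 0 + theta 16 3) * (qp14 3 * qp14 11) = qp14 14 * (qp14 6 * qp14 8)"
    using quintuple_limit[of 3] by (simp add: theta_boundI)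
  then have "e_inf 2 * (theta 2 0 + theta 16 3) * (qp14 2 * qp14 3 * qp14 4 * qp14 10 * qp14 11 * qp14 12) = 1"
    by (rule split) (simp only: ac_simps, simp only: nz zero_less_numeral not_False_eq_True)
  from divide_eq_fps[OF this]
  show "qplus_inf * infsum v UNIV = 1 / qpochs [q ^ 2, q ^ 3, q ^ 4, q ^ 10, q ^ 11, q ^ 12] (q ^ 14) \<infinity>"
    unfolding slater1 qplus by (simp add: qpochs_def qp14_def mult.assoc)
  have "(theta (- 4) 0 + theta 10 1) * (qp14 1 * qp14 13) = qp14 14 * (qp14 2 * qp14 12)"
    using quintuple_limit[of 1] by (simp add: theta_boundI)
  then have "e_inf 2 * (theta (- 4) 0 + theta 10 1) * (qp14 1 * qp14 4 * qp14 6 * qp14 8 * qp14 10 * qp14 13) = 1"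
    by (rule split) (simp only: ac_simps, simp only: nz zero_less_numeral not_False_eq_True)
  from divide_eq_fps[OF this]
  show "qplus_inf * infsum (\<lambda>j. u j * (1 + q ^ (2 * j + 1))) UNIV = 1 / qpochs [q, q ^ 4, q ^ 6, q ^ 8, q ^ 10, q ^ 13] (q ^ 14) \<infinity>"
    unfolding slater2 qplus by (simp add: qpochs_def qp14_def mult.assoc)
  have "(theta 8 0 - theta 20 4) * (qp14 5 * qp14 9) = qp14 14 * (qp14 10 * qp14 4)"
    using quintuple_limit[of 5] by (simp add: theta_boundI theta_bound_22_5 theta_22_5)
  then have "e_inf 2 * (theta 8 0 - theta 20 4) * (qp14 2 * qp14 5 * qp14 6 * qp14 8 * qp14 9 * qp14 12) = 1"
    by (rule split) (simp only: ac_simps, simp only: nz zero_less_numeral not_False_eq_True)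
  from divide_eq_fps[OF this]
  show "qplus_inf * infsum u UNIV = 1 / qpochs [q ^ 2, q ^ 5, q ^ 6, q ^ 8, q ^ 9, q ^ 12] (q ^ 14) \<infinity>"
    unfolding slater3 qplus by (simp add: qpochs_def qp14_def mult.assoc)
qed

theorem theorem1p3:
  shows "((\<lambda>xs. q ^ sum_list xs) has_sum
           (1 / qpochs [q ^ 2, q ^ 3, q ^ 4, q ^ 10, q ^ 11, q ^ 12] (q ^ 14) \<infinity>)) setN1 \<and>
         ((\<lambda>(i, j). double_sum_term (\<lambda>i j. i + j) i j) has_sum
           (1 / qpochs [q ^ 2, q ^ 3, q ^ 4, q ^ 10, q ^ 11, q ^ 12] (q ^ 14) \<infinity>)) UNIV \<and>
         ((\<lambda>xs. q ^ sum_list xs) has_sum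
           (1 / qpochs [q, q ^ 4, q ^ 6, q ^ 8, q ^ 10, q ^ 13] (q ^ 14) \<infinity>)) setN2 \<and>
         ((\<lambda>(i, j). double_sum_term (\<lambda>i j. i + 3 * j) i j) has_sum
           (1 / qpochs [q, q ^ 4, q ^ 6, q ^ 8, q ^ 10, q ^ 13] (q ^ 14) \<infinity>)) UNIV \<and>
         ((\<lambda>xs. q ^ sum_list xs) has_sum
           (1 / qpochs [q ^ 2, q ^ 5, q ^ 6, q ^ 8, q ^ 9, q ^ 12] (q ^ 14) \<infinity>)) setN3 \<and>
         ((\<lambda>(i, j). double_sum_term (\<lambda>i j. 2 * i + 3 * j) i j) has_sum
           (1 / qpochs [q ^ 2, q ^ 5, q ^ 6, q ^ 8, q ^ 9, q ^ 12] (q ^ 14) \<infinity>)) UNIV"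
  using setN_has_sum double_sums_has_sum unfolding products by blast

end
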